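(* Let $\Gamma$ be an amenable group which is generated by a finite symmetric set $S\subseteq\Gamma$, and let $d_\Gamma$ be the associated left-invariant word metric. Fix $p\ge1$, two functions $\omega,\Omega:[0,\infty)\to[0,\infty)$ and a Banach space $(X,\|\cdot\|_X)$ such that there is a mapping $\psi:\Gamma\to X$ which satisfies, for all $g,h\in\Gamma$, $$\omega\left(d_\Gamma(g,h)\right)\le\|\psi(g)-\psi(h)\|_X\le\Omega\left(d_\Gamma(g,h)\right).$$ Then there exist a Banach space $Y$ which is finitely representable in $\ell_p(X)$ and an equivariant mapping $\Psi:\Gamma\to Y$ such that for all $g,h\in\Gamma$, $$\omega\left(d_\Gamma(g,h)\right)\le\|\Psi(g)-\Psi(h)\|_Y\le\Omega\left(d_\Gamma(g,h)\right).$$ Moreover, if $X=L_p(\mu)$ for some measure $\mu$, then $Y$ can be taken to be isometric to $L_p$.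
   Context: A Banach space $U$ is finitely representable in a Banach space $V$ if for every $\varepsilon>0$ and every finite dimensional subspace $F\subseteq U$ there is a linear operator $T:F\to V$ with $\|x\|_U\le\|Tx\|_V\le(1+\varepsilon)\|x\|_U$ for all $x\in F$. $\ell_p(X)$ is the space of $X$-valued sequences $(x_n)$ with norm $\left(\sum_n\|x_n\|_X^p\right)^{1/p}$. A mapping $\Psi:\Gamma\to Y$ is equivariant if there exist an action $\tau$ of $\Gamma$ on $Y$ by affine isometries and a vector $v\in Y$ such that $\Psi(x)=\tau(x)v$ for all $x\in\Gamma$. $L_p=L_p([0,1])$ with Lebesgue measure.
   Formalization: In the "moreover" part, that Y (isometric to L_p) is finitely representable in ℓ_p(X) is claimed only for X ≠ {0}; for X = L_p(μ) = {0} it is false, since ℓ_p(X) = {0}. All other claims are kept in that case. *)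

theory Defs
  imports "HOL-Analysis.Analysis" "HOL-Algebra.Generated_Groups" "HOL-Algebra.Group_Action"
begin

text \<open>
  All Banach spaces are real. Spaces that are constructed rather than given as a type of class
  \<^class>\<open>banach\<close> (for instance \<open>L\<^sub>p(\<mu>)\<close>, whose norm depends on \<open>p\<close> and \<open>\<mu>\<close>) are records with an
  explicit carrier; the operations are only meaningful on the carrier.
\<close>

record 'a nspace =
  vcarrier :: "'a set"
  vadd :: "'a \<Rightarrow> 'a \<Rightarrow> 'a"
  vzero :: 'a
  vscale :: "real \<Rightarrow> 'a \<Rightarrow> 'a"
  vnorm :: "'a \<Rightarrow> real"

definition vdiff :: "'a nspace \<Rightarrow> 'a \<Rightarrow> 'a \<Rightarrow> 'a" where
  "vdiff V x y = vadd V x (vscale V (-1) y)"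

definition normed_space :: "'a nspace \<Rightarrow> bool" where
  "normed_space V \<longleftrightarrow>
     comm_group \<lparr>carrier = vcarrier V, mult = vadd V, one = vzero V\<rparr> \<and>
     (\<forall>a. \<forall>x\<in>vcarrier V. vscale V a x \<in> vcarrier V) \<and>
     (\<forall>a. \<forall>x\<in>vcarrier V. \<forall>y\<in>vcarrier V.
        vscale V a (vadd V x y) = vadd V (vscale V a x) (vscale V a y)) \<and>
     (\<forall>a b. \<forall>x\<in>vcarrier V. vscale V (a + b) x = vadd V (vscale V a x) (vscale V b x)) \<and>
     (\<forall>a b. \<forall>x\<in>vcarrier V. vscale V (a * b) x = vscale V a (vscale V b x)) \<and>
     (\<forall>x\<in>vcarrier V. vscale V 1 x = x) \<and>
     (\<forall>x\<in>vcarrier V. 0 \<le> vnorm V x) \<and>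
     (\<forall>x\<in>vcarrier V. vnorm V x = 0 \<longleftrightarrow> x = vzero V) \<and>
     (\<forall>a. \<forall>x\<in>vcarrier V. vnorm V (vscale V a x) = \<bar>a\<bar> * vnorm V x) \<and>
     (\<forall>x\<in>vcarrier V. \<forall>y\<in>vcarrier V. vnorm V (vadd V x y) \<le> vnorm V x + vnorm V y)"

definition banach_space :: "'a nspace \<Rightarrow> bool" where
  "banach_space V \<longleftrightarrow> normed_space V \<and>
     (\<forall>s :: nat \<Rightarrow> 'a. range s \<subseteq> vcarrier V \<longrightarrow>
        (\<forall>e>0. \<exists>N. \<forall>m\<ge>N. \<forall>n\<ge>N. vnorm V (vdiff V (s m) (s n)) < e) \<longrightarrow>
        (\<exists>l\<in>vcarrier V. (\<lambda>n. vnorm V (vdiff V (s n) l)) \<longlonglongrightarrow> 0))"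

definition type_space :: "'x::real_normed_vector nspace" where
  "type_space = \<lparr>vcarrier = UNIV, vadd = (+), vzero = 0, vscale = (*\<^sub>R), vnorm = norm\<rparr>"

definition vsubspace :: "'a nspace \<Rightarrow> 'a set \<Rightarrow> bool" where
  "vsubspace V F \<longleftrightarrow> F \<subseteq> vcarrier V \<and> vzero V \<in> F \<and>
     (\<forall>x\<in>F. \<forall>y\<in>F. vadd V x y \<in> F) \<and> (\<forall>a. \<forall>x\<in>F. vscale V a x \<in> F)"

definition vspan :: "'a nspace \<Rightarrow> 'a set \<Rightarrow> 'a set" where
  "vspan V B = \<Inter>{W. vsubspace V W \<and> B \<subseteq> W}"

definition finite_dim_subspace :: "'a nspace \<Rightarrow> 'a set \<Rightarrow> bool" where
  "finite_dim_subspace V F \<longleftrightarrow>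
     vsubspace V F \<and> (\<exists>B. finite B \<and> B \<subseteq> vcarrier V \<and> F = vspan V B)"

definition linear_between :: "'a nspace \<Rightarrow> 'a set \<Rightarrow> 'b nspace \<Rightarrow> ('a \<Rightarrow> 'b) \<Rightarrow> bool" where
  "linear_between U F V T \<longleftrightarrow> T \<in> F \<rightarrow> vcarrier V \<and>
     (\<forall>x\<in>F. \<forall>y\<in>F. T (vadd U x y) = vadd V (T x) (T y)) \<and>
     (\<forall>a. \<forall>x\<in>F. T (vscale U a x) = vscale V a (T x))"

definition isometric_spaces :: "'a nspace \<Rightarrow> 'b nspace \<Rightarrow> bool" where
  "isometric_spaces U V \<longleftrightarrow>
     (\<exists>T. linear_between U (vcarrier U) V T \<and> T ` vcarrier U = vcarrier V \<and>
          (\<forall>x\<in>vcarrier U. vnorm V (T x) = vnorm U x))"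

definition finitely_representable :: "'a nspace \<Rightarrow> 'b nspace \<Rightarrow> bool" where
  "finitely_representable U V \<longleftrightarrow>
     (\<forall>\<epsilon>>0. \<forall>F. finite_dim_subspace U F \<longrightarrow>
        (\<exists>T. linear_between U F V T \<and>
             (\<forall>x\<in>F. vnorm U x \<le> vnorm V (T x) \<and> vnorm V (T x) \<le> (1 + \<epsilon>) * vnorm U x)))"

definition ell_p :: "real \<Rightarrow> (nat \<Rightarrow> 'x::real_normed_vector) nspace" where
  "ell_p p = \<lparr>vcarrier = {x. summable (\<lambda>n. norm (x n) powr p)},
     vadd = (\<lambda>x y n. x n + y n), vzero = (\<lambda>n. 0), vscale = (\<lambda>a x n. a *\<^sub>R x n),
     vnorm = (\<lambda>x. (\<Sum>n. norm (x n) powr p) powr (1 / p))\<rparr>"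

definition Lp_funs :: "real \<Rightarrow> 'm measure \<Rightarrow> ('m \<Rightarrow> real) set" where
  "Lp_funs p M = {f \<in> borel_measurable M. integrable M (\<lambda>x. \<bar>f x\<bar> powr p)}"

definition Lp_class :: "real \<Rightarrow> 'm measure \<Rightarrow> ('m \<Rightarrow> real) \<Rightarrow> ('m \<Rightarrow> real) set" where
  "Lp_class p M f = {g \<in> Lp_funs p M. AE x in M. g x = f x}"

text \<open>The vector operations and the norm do not depend on the representatives picked by \<open>Lp_rep\<close>.\<close>

definition Lp_rep :: "('m \<Rightarrow> real) set \<Rightarrow> 'm \<Rightarrow> real" where
  "Lp_rep A = (SOME f. f \<in> A)"

definition Lp :: "real \<Rightarrow> 'm measure \<Rightarrow> ('m \<Rightarrow> real) set nspace" where
  "Lp p M = \<lparr>vcarrier = Lp_class p M ` Lp_funs p M,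
     vadd = (\<lambda>A B. Lp_class p M (\<lambda>x. Lp_rep A x + Lp_rep B x)),
     vzero = Lp_class p M (\<lambda>x. 0),
     vscale = (\<lambda>a A. Lp_class p M (\<lambda>x. a * Lp_rep A x)),
     vnorm = (\<lambda>A. (\<integral>x. \<bar>Lp_rep A x\<bar> powr p \<partial>M) powr (1 / p))\<rparr>"

definition affine_isometry :: "'a nspace \<Rightarrow> ('a \<Rightarrow> 'a) \<Rightarrow> bool" where
  "affine_isometry V A \<longleftrightarrow>
     (\<exists>L. \<exists>b\<in>vcarrier V. linear_between V (vcarrier V) V L \<and>
        (\<forall>x\<in>vcarrier V. A x = vadd V (L x) b)) \<and>
     (\<forall>x\<in>vcarrier V. \<forall>y\<in>vcarrier V. vnorm V (vdiff V (A x) (A y)) = vnorm V (vdiff V x y))"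

definition equivariant :: "('g, 'b) monoid_scheme \<Rightarrow> 'a nspace \<Rightarrow> ('g \<Rightarrow> 'a) \<Rightarrow> bool" where
  "equivariant G V \<Psi> \<longleftrightarrow>
     (\<exists>\<tau>. \<exists>v\<in>vcarrier V. group_action G (vcarrier V) \<tau> \<and>
        (\<forall>g\<in>carrier G. affine_isometry V (\<tau> g)) \<and> (\<forall>x\<in>carrier G. \<Psi> x = \<tau> x v))"

text \<open>
  Amenability of a discrete group: a left-invariant mean on the bounded real functions. Linearity
  and positivity force a mean to depend only on the values on the carrier.
\<close>

definition bounded_funs :: "('g, 'b) monoid_scheme \<Rightarrow> ('g \<Rightarrow> real) set" where
  "bounded_funs G = {f. bounded (f ` carrier G)}"

definition left_invariant_mean :: "('g, 'b) monoid_scheme \<Rightarrow> (('g \<Rightarrow> real) \<Rightarrow> real) \<Rightarrow> bool" where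
  "left_invariant_mean G m \<longleftrightarrow>
     (\<forall>a b. \<forall>f\<in>bounded_funs G. \<forall>h\<in>bounded_funs G.
        m (\<lambda>x. a * f x + b * h x) = a * m f + b * m h) \<and>
     (\<forall>f\<in>bounded_funs G. (\<forall>x\<in>carrier G. 0 \<le> f x) \<longrightarrow> 0 \<le> m f) \<and>
     m (\<lambda>x. 1) = 1 \<and>
     (\<forall>f\<in>bounded_funs G. \<forall>g\<in>carrier G. m (\<lambda>x. f (g \<otimes>\<^bsub>G\<^esub> x)) = m f)"

definition amenable :: "('g, 'b) monoid_scheme \<Rightarrow> bool" where
  "amenable G \<longleftrightarrow> (\<exists>m. left_invariant_mean G m)"

definition word_length :: "('g, 'b) monoid_scheme \<Rightarrow> 'g set \<Rightarrow> 'g \<Rightarrow> nat" where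
  "word_length G S g =
     (LEAST n. \<exists>ws. length ws = n \<and> set ws \<subseteq> S \<and> foldr (\<lambda>s t. s \<otimes>\<^bsub>G\<^esub> t) ws \<one>\<^bsub>G\<^esub> = g)"

definition word_dist :: "('g, 'b) monoid_scheme \<Rightarrow> 'g set \<Rightarrow> 'g \<Rightarrow> 'g \<Rightarrow> nat" where
  "word_dist G S g h = word_length G S (inv\<^bsub>G\<^esub> g \<otimes>\<^bsub>G\<^esub> h)"

text \<open>
  HOL cannot quantify existentially over types, so an existentially quantified Banach space needs
  a fixed type of points. The type below, that of the elements of \<open>L\<^sub>p([0,1])\<close>, has room for an
  isometric copy of every Banach space of cardinality at most the continuum, in particular of
  every separable one. This suffices for targets of equivariant maps on a finitely generated
  group: such a group is countable, so one may pass to the closed linear span of the orbits of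
  \<open>v\<close> and of \<open>0\<close>, which is separable and invariant under the action.
\<close>

type_synonym point = "(real \<Rightarrow> real) set"

end

theory Submission
  imports Defs "HOL-Library.Function_Algebras"
begin

text \<open>
  Let \<open>m\<close> be an invariant mean on \<open>\<Gamma>\<close>. On the bounded functions \<open>F : \<Gamma> \<rightarrow> X\<close> it gives the seminorm
  \<open>q F = (m \<parallel>F x\<parallel>\<^sup>p)\<^sup>1\<^sup>/\<^sup>p\<close>, and translations preserve \<open>q\<close>. The functions
  \<open>disp g : x \<mapsto> \<psi> (x\<inverse> g) - \<psi> (x\<inverse>)\<close> are bounded because the word metric is left-invariant, they satisfy the
  cocycle identity \<open>disp (g h) = translate g (disp h) + disp g\<close>, and \<open>disp g - disp h\<close> takes at \<open>x\<close> the
  value \<open>\<psi> (x\<inverse> g) - \<psi> (x\<inverse> h)\<close>, whose norm lies between \<open>\<omega>\<close> and \<open>\<Omega>\<close> of the one distance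
  \<open>d (g, h)\<close>; so \<open>q (disp g - disp h)\<close> obeys the same bounds. Hence every completion of a
  translation-invariant space \<open>W\<close> of bounded functions that contains the \<open>disp g\<close> carries an action by
  affine isometries, for which \<open>g \<mapsto> disp g\<close> is the orbit of \<open>0\<close> (\<open>equivariant_in_completion\<close>).

  For the first assertion \<open>W\<close> is the span of the \<open>disp g\<close>, a separable space, which embeds into the
  prescribed type of points by its distances to a countable dense set. Finite representability
  rests on the fact that on finitely many functions a mean is nearly a convex combination of point
  evaluations: cut \<open>\<Gamma>\<close> into finitely many pieces on which the relevant norms are nearly constant, and
  give a point of each piece the mean of the piece as its weight. The values at these points, scaled by the \<open>p\<close>-th roots of
  the weights, form the sequence in \<open>\<ell>\<^sub>p(X)\<close> (\<open>average_approx_finite\<close>); a basis of a finite-dimensional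
  subspace turns this into a nearly isometric operator (\<open>finitely_representable_ell_p\<close>).

  For \<open>X = L\<^sub>p(\<mu>)\<close> the space \<open>W\<close> is chosen so large that its completion is all of \<open>L\<^sub>p([0,1])\<close>, except
  when all the \<open>disp g\<close> are null and a constant map into \<open>L\<^sub>p([0,1])\<close> will do. The values
  are regarded as functions on \<open>\<mu> \<otimes> [0,1]\<close>, the second factor making the outcome free of atoms. A
  convergent series with positive coefficients in the \<open>\<bar>disp g\<bar>\<close>, over all \<open>g\<close>, gives one weight
  \<open>\<rho>\<close> such that all \<open>disp g / \<rho>\<close> are bounded. Countably many level sets of these quotients, of their
  translates, and of the coordinate in \<open>[0,1]\<close> code each point of \<open>\<Gamma> \<times> \<mu> \<otimes> [0,1]\<close> by a sequence of bits.
  The space \<open>W\<close> is the \<open>q\<close>-closure of the products \<open>\<sigma>(code) \<rho>\<close>, where \<open>\<sigma>\<close> depends on finitely many bits;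
  it contains the \<open>disp g\<close>, and it is invariant although \<open>\<rho>\<close> is not, because the translate of \<open>\<rho>\<close> is a
  \<open>q\<close>-limit of bounded multiples of \<open>\<rho>\<close>. The mean of \<open>\<rho>\<^sup>p\<close> over the set of points whose code starts
  with a given word is a finitely additive mass on words, and it tends to \<open>0\<close> with the length of the word.
  Cutting \<open>[0,1]\<close> successively into intervals of these (normalised) masses gives each number a sequence
  of digits with the same law, so that \<open>\<sigma>(code) \<rho> \<mapsto> \<sigma>(digits)\<close> is isometric up to a constant factor. Its
  image is dense, since the intervals shrink to points (\<open>cylinders_dense\<close>).
\<close>

section \<open>Seminormed spaces and the normed spaces that they present\<close>

instantiation "fun" :: (type, real_vector) real_vector
begin

definition scaleR_fun :: "real \<Rightarrow> ('a \<Rightarrow> 'b) \<Rightarrow> 'a \<Rightarrow> 'b" where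
  "scaleR_fun r f = (\<lambda>x. r *\<^sub>R f x)"

instance
  by standard (auto simp: scaleR_fun_def fun_eq_iff algebra_simps)

end

lemma scaleR_fun_apply [simp]: "(r *\<^sub>R f) x = r *\<^sub>R f x"
  by (simp add: scaleR_fun_def)

lemma sum_fun_apply: "(\<Sum>i\<in>A. f i) x = (\<Sum>i\<in>A. f i x)"
  by (induction A rule: infinite_finite_induct) auto

text \<open>
  All constructions take place in seminormed subspaces of types of class \<^class>\<open>real_vector\<close>, where
  sums and linear combinations come with the type; the quotient by the null vectors is taken only
  at the very end.
\<close>

locale seminormed =
  fixes Z :: "'v::real_vector set" and N :: "'v \<Rightarrow> real"
  assumes subspace: "subspace Z"
    and N_scale: "x \<in> Z \<Longrightarrow> N (c *\<^sub>R x) = \<bar>c\<bar> * N x"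
    and N_triangle: "x \<in> Z \<Longrightarrow> y \<in> Z \<Longrightarrow> N (x + y) \<le> N x + N y"
begin

lemma mem_0: "0 \<in> Z"
  using subspace by (rule subspace_0)

lemma mem_add: "x \<in> Z \<Longrightarrow> y \<in> Z \<Longrightarrow> x + y \<in> Z"
  using subspace by (rule subspace_add)

lemma mem_diff: "x \<in> Z \<Longrightarrow> y \<in> Z \<Longrightarrow> x - y \<in> Z"
  using subspace by (rule subspace_diff)

lemma mem_scale: "x \<in> Z \<Longrightarrow> c *\<^sub>R x \<in> Z"
  using subspace by (rule subspace_scale)

lemma mem_sum: "(\<And>i. i \<in> A \<Longrightarrow> f i \<in> Z) \<Longrightarrow> sum f A \<in> Z"
  using subspace by (rule subspace_sum)

lemma N_0: "N 0 = 0"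
  using N_scale[OF mem_0, of 0] by simp

lemma N_minus: "x \<in> Z \<Longrightarrow> N (- x) = N x"
  using N_scale[of x "-1"] by simp

lemma N_nonneg: "x \<in> Z \<Longrightarrow> 0 \<le> N x"
  using N_triangle[of x "- x"] N_minus[of x] subspace_neg[OF subspace] N_0 by simp

lemma N_commute: "x \<in> Z \<Longrightarrow> y \<in> Z \<Longrightarrow> N (x - y) = N (y - x)"
  using N_minus[of "x - y"] mem_diff by simp

lemma N_diff_triangle:
  "x \<in> Z \<Longrightarrow> y \<in> Z \<Longrightarrow> z \<in> Z \<Longrightarrow> N (x - z) \<le> N (x - y) + N (y - z)"
  using N_triangle[of "x - y" "y - z"] mem_diff by simp

lemma abs_N_diff_le: "x \<in> Z \<Longrightarrow> y \<in> Z \<Longrightarrow> \<bar>N x - N y\<bar> \<le> N (x - y)"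
  using N_triangle[of "x - y" y] N_triangle[of "y - x" x] N_commute[of x y] mem_diff by fastforce

lemma N_sum: "(\<And>i. i \<in> A \<Longrightarrow> f i \<in> Z) \<Longrightarrow> N (sum f A) \<le> (\<Sum>i\<in>A. N (f i))"
proof (induction A rule: infinite_finite_induct)
  case (insert x F)
  then show ?case
    using N_triangle[of "f x" "sum f F"] mem_sum[of F f] by fastforce
qed (auto simp: N_0)

lemma seminormed_subspace: "subspace W \<Longrightarrow> W \<subseteq> Z \<Longrightarrow> seminormed W N"
  by (unfold_locales) (auto intro: N_scale N_triangle)

lemma subspace_closure:
  assumes I: "subspace I" and A: "A ` I \<subseteq> Z"
    and add: "\<And>x y. x \<in> I \<Longrightarrow> y \<in> I \<Longrightarrow> A (x + y) = A x + A y"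
    and scale: "\<And>c x. x \<in> I \<Longrightarrow> A (c *\<^sub>R x) = c *\<^sub>R A x"
  shows "subspace {z \<in> Z. \<forall>e>0. \<exists>i\<in>I. N (z - A i) < e}"
proof (rule subspaceI)
  have A0: "A 0 = 0"
    using scale[OF subspace_0[OF I], of 0] by simp
  show "0 \<in> {z \<in> Z. \<forall>e>0. \<exists>i\<in>I. N (z - A i) < e}"
    using subspace_0[OF I] by (auto simp: mem_0 intro!: bexI[of _ 0] simp: A0 N_0)
next
  fix x y assume x: "x \<in> {z \<in> Z. \<forall>e>0. \<exists>i\<in>I. N (z - A i) < e}"
    and y: "y \<in> {z \<in> Z. \<forall>e>0. \<exists>i\<in>I. N (z - A i) < e}"
  have "\<exists>i\<in>I. N (x + y - A i) < e" if "e > 0" for e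
  proof -
    obtain i where i: "i \<in> I" "N (x - A i) < e / 2"
      using x half_gt_zero[OF \<open>e > 0\<close>] by blast
    obtain j where j: "j \<in> I" "N (y - A j) < e / 2"
      using y half_gt_zero[OF \<open>e > 0\<close>] by blast
    have "N (x + y - A (i + j)) = N ((x - A i) + (y - A j))"
      using i j by (simp add: add algebra_simps)
    also have "\<dots> \<le> N (x - A i) + N (y - A j)"
      using x y A i j by (intro N_triangle mem_diff) auto
    also have "\<dots> < e" using i j by simp
    finally show ?thesis using subspace_add[OF I i(1) j(1)] by blast
  qed
  then show "x + y \<in> {z \<in> Z. \<forall>e>0. \<exists>i\<in>I. N (z - A i) < e}"
    using x y by (auto intro: mem_add)
next
  fix c x assume x: "x \<in> {z \<in> Z. \<forall>e>0. \<exists>i\<in>I. N (z - A i) < e}"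
  have "\<exists>i\<in>I. N (c *\<^sub>R x - A i) < e" if "e > 0" for e
  proof -
    have "e / (\<bar>c\<bar> + 1) > 0" using that by simp
    then obtain i where i: "i \<in> I" "N (x - A i) < e / (\<bar>c\<bar> + 1)"
      using x by blast
    have Ai: "x - A i \<in> Z" using x A i by (intro mem_diff) auto
    have "N (c *\<^sub>R x - A (c *\<^sub>R i)) = N (c *\<^sub>R (x - A i))"
      using i by (simp add: scale algebra_simps)
    also have "\<dots> = \<bar>c\<bar> * N (x - A i)" by (rule N_scale[OF Ai])
    also have "\<dots> \<le> (\<bar>c\<bar> + 1) * N (x - A i)" using N_nonneg[OF Ai] by (simp add: distrib_right)
    also have "\<dots> < e" using i by (simp add: field_simps)
    finally show ?thesis using subspace_scale[OF I i(1)] by blast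
  qed
  then show "c *\<^sub>R x \<in> {z \<in> Z. \<forall>e>0. \<exists>i\<in>I. N (z - A i) < e}"
    using x by (auto intro: mem_scale)
qed

end

definition cauchy_in :: "('v::real_vector \<Rightarrow> real) \<Rightarrow> (nat \<Rightarrow> 'v) \<Rightarrow> bool" where
  "cauchy_in N s \<longleftrightarrow> (\<forall>e>0. \<exists>M. \<forall>m\<ge>M. \<forall>n\<ge>M. N (s m - s n) < e)"

lemma cauchy_inE:
  assumes "cauchy_in N s" and "e > 0"
  obtains M where "\<And>m n. m \<ge> M \<Longrightarrow> n \<ge> M \<Longrightarrow> N (s m - s n) < e"
  using assms unfolding cauchy_in_def by metis

definition complete_in :: "'v::real_vector set \<Rightarrow> ('v \<Rightarrow> real) \<Rightarrow> bool" where
  "complete_in Z N \<longleftrightarrow>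
     (\<forall>s. range s \<subseteq> Z \<longrightarrow> cauchy_in N s \<longrightarrow> (\<exists>l\<in>Z. (\<lambda>n. N (s n - l)) \<longlonglongrightarrow> 0))"

text \<open>
  The link between the two levels: proofs take place in the seminormed space \<open>Z\<close>, statements are about the
  normed space \<open>Y\<close>, the quotient of \<open>Z\<close> by its null vectors.
\<close>

definition presents :: "'v::real_vector set \<Rightarrow> ('v \<Rightarrow> real) \<Rightarrow> ('v \<Rightarrow> 'a) \<Rightarrow> 'a nspace \<Rightarrow> bool" where
  "presents Z N \<kappa> Y \<longleftrightarrow> \<kappa> ` Z = vcarrier Y \<and>
     (\<forall>x\<in>Z. \<forall>y\<in>Z. \<kappa> x = \<kappa> y \<longleftrightarrow> N (x - y) = 0) \<and>
     (\<forall>x\<in>Z. \<forall>y\<in>Z. \<kappa> (x + y) = vadd Y (\<kappa> x) (\<kappa> y)) \<and>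
     (\<forall>c. \<forall>x\<in>Z. \<kappa> (c *\<^sub>R x) = vscale Y c (\<kappa> x)) \<and>
     \<kappa> 0 = vzero Y \<and> (\<forall>x\<in>Z. vnorm Y (\<kappa> x) = N x)"

lemma presentsD:
  assumes "presents Z N \<kappa> Y"
  shows "vcarrier Y = \<kappa> ` Z"
    and "\<And>x y. x \<in> Z \<Longrightarrow> y \<in> Z \<Longrightarrow> \<kappa> x = \<kappa> y \<longleftrightarrow> N (x - y) = 0"
    and "\<And>x y. x \<in> Z \<Longrightarrow> y \<in> Z \<Longrightarrow> vadd Y (\<kappa> x) (\<kappa> y) = \<kappa> (x + y)"
    and "\<And>c x. x \<in> Z \<Longrightarrow> vscale Y c (\<kappa> x) = \<kappa> (c *\<^sub>R x)"
    and "vzero Y = \<kappa> 0"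
    and "\<And>x. x \<in> Z \<Longrightarrow> vnorm Y (\<kappa> x) = N x"
  using assms by (auto simp: presents_def)

text \<open>
  The normed space structure that the values of \<open>\<kappa>\<close> inherit. Taking \<open>\<kappa>\<close> with values in an arbitrary
  type allows the points of the quotient to be placed in a type that is given in advance.
\<close>

definition image_space :: "'v::real_vector set \<Rightarrow> ('v \<Rightarrow> real) \<Rightarrow> ('v \<Rightarrow> 'a) \<Rightarrow> 'a nspace" where
  "image_space Z N \<kappa> = \<lparr>vcarrier = \<kappa> ` Z,
     vadd = (\<lambda>a b. \<kappa> (inv_into Z \<kappa> a + inv_into Z \<kappa> b)), vzero = \<kappa> 0,
     vscale = (\<lambda>c a. \<kappa> (c *\<^sub>R inv_into Z \<kappa> a)), vnorm = (\<lambda>a. N (inv_into Z \<kappa> a))\<rparr>"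

context seminormed
begin

lemma presents_image_space:
  assumes \<kappa>: "\<And>x y. x \<in> Z \<Longrightarrow> y \<in> Z \<Longrightarrow> \<kappa> x = \<kappa> y \<longleftrightarrow> N (x - y) = 0"
  shows "presents Z N \<kappa> (image_space Z N \<kappa>)"
proof -
  let ?r = "\<lambda>x. inv_into Z \<kappa> (\<kappa> x)"
  have r: "?r x \<in> Z" "N (?r x - x) = 0" if "x \<in> Z" for x
  proof -
    show rZ: "?r x \<in> Z" using that by (simp add: inv_into_into)
    have "\<kappa> (?r x) = \<kappa> x" using that by (simp add: f_inv_into_f)
    then show "N (?r x - x) = 0" using \<kappa>[OF rZ that] by simp
  qed
  have "\<kappa> (x + y) = \<kappa> (?r x + ?r y)" if "x \<in> Z" "y \<in> Z" for x y
  proof -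
    have "N (?r x + ?r y - (x + y)) \<le> N (?r x - x) + N (?r y - y)"
      using N_triangle[of "?r x - x" "?r y - y"] that r mem_diff by (simp add: algebra_simps)
    then have "N (?r x + ?r y - (x + y)) = 0"
      using N_nonneg[OF mem_diff[OF mem_add[OF r(1) r(1)] mem_add], of x y x y] r that by simp
    then show ?thesis
      using \<kappa>[OF mem_add[OF r(1) r(1)] mem_add, of x y x y] that by simp
  qed
  moreover have "\<kappa> (c *\<^sub>R x) = \<kappa> (c *\<^sub>R ?r x)" if "x \<in> Z" for c x
  proof -
    have "N (c *\<^sub>R ?r x - c *\<^sub>R x) = 0"
      using N_scale[OF mem_diff[OF r(1) that], of x c] r(2)[OF that] that
      by (simp add: scaleR_diff_right)
    then show ?thesis using \<kappa>[OF mem_scale[OF r(1)] mem_scale[OF that], of x c c] that by simp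
  qed
  moreover have "N (?r x) = N x" if "x \<in> Z" for x
    using abs_N_diff_le[OF r(1)[OF that] that] r(2)[OF that] by simp
  ultimately show ?thesis
    unfolding presents_def image_space_def nspace.simps
    by (intro conjI ballI allI refl) (assumption | rule \<kappa> | blast)+
qed

lemma presents_vdiff:
  assumes "presents Z N \<kappa> Y" "x \<in> Z" "y \<in> Z"
  shows "vdiff Y (\<kappa> x) (\<kappa> y) = \<kappa> (x - y)"
  using assms presentsD(3,4)[OF assms(1)] mem_scale[of y "-1"] by (simp add: vdiff_def)

lemma presents_normed_space:
  assumes "presents Z N \<kappa> Y"
  shows "normed_space Y"
proof -
  note P = presentsD[OF assms]
  have "comm_group \<lparr>carrier = vcarrier Y, mult = vadd Y, one = vzero Y\<rparr>"
  proof (rule comm_groupI)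
    fix x assume "x \<in> carrier \<lparr>carrier = vcarrier Y, mult = vadd Y, one = vzero Y\<rparr>"
    then obtain u where "u \<in> Z" "x = \<kappa> u" by (auto simp: P(1))
    then show "\<exists>y\<in>carrier \<lparr>carrier = vcarrier Y, mult = vadd Y, one = vzero Y\<rparr>.
        y \<otimes>\<^bsub>\<lparr>carrier = vcarrier Y, mult = vadd Y, one = vzero Y\<rparr>\<^esub> x =
        \<one>\<^bsub>\<lparr>carrier = vcarrier Y, mult = vadd Y, one = vzero Y\<rparr>\<^esub>"
      using P(3)[of "- u" u] subspace_neg[OF subspace, of u]
      by (auto simp: P(1,5) intro!: bexI[of _ "- u"])
  qed (auto simp: P(1) P(3) P(5) mem_add mem_0 algebra_simps)
  moreover have "N x = 0 \<longleftrightarrow> \<kappa> x = \<kappa> 0" if "x \<in> Z" for x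
    using P(2)[of x 0] that mem_0 by simp
  ultimately show ?thesis
    unfolding normed_space_def
    by (simp add: P(1,3-6) mem_add mem_scale mem_0 N_nonneg N_scale N_triangle algebra_simps)
qed

lemma presents_banach_space:
  fixes Y :: "'a nspace"
  assumes pres: "presents Z N \<kappa> Y" and "complete_in Z N"
  shows "banach_space Y"
  unfolding banach_space_def
proof (intro conjI allI impI)
  note P = presentsD[OF pres]
  show "normed_space Y" by (rule presents_normed_space[OF pres])
  fix s :: "nat \<Rightarrow> 'a"
  assume s: "range s \<subseteq> vcarrier Y"
    and cauchy: "\<forall>e>0. \<exists>M. \<forall>m\<ge>M. \<forall>n\<ge>M. vnorm Y (vdiff Y (s m) (s n)) < e"
  have "\<forall>n. \<exists>z\<in>Z. s n = \<kappa> z" using s by (auto simp: P(1))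
  then obtain t where t: "\<And>n. t n \<in> Z" "\<And>n. s n = \<kappa> (t n)" by metis
  have dist: "vnorm Y (vdiff Y (s n) (\<kappa> l)) = N (t n - l)" if "l \<in> Z" for n l
    using t that presents_vdiff[OF pres] by (simp add: P(6) mem_diff)
  have "vnorm Y (vdiff Y (s m) (s n)) = N (t m - t n)" for m n
    using dist[of "t n" m] t by simp
  then have "cauchy_in N t" using cauchy by (simp add: cauchy_in_def)
  moreover have "range t \<subseteq> Z" using t(1) by auto
  ultimately obtain l where "l \<in> Z" "(\<lambda>n. N (t n - l)) \<longlonglongrightarrow> 0"
    using assms(2) unfolding complete_in_def by blast
  then show "\<exists>l\<in>vcarrier Y. (\<lambda>n. vnorm Y (vdiff Y (s n) l)) \<longlonglongrightarrow> 0"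
    by (auto simp: P(1) dist)
qed

text \<open>
  A linear isometric action \<open>P\<close> and a cocycle \<open>B\<close> for it define the affine action
  \<open>\<tau> g x = P g x + B g\<close>, and \<open>B\<close> is the orbit map of the origin.
\<close>

lemma presents_equivariant:
  fixes G :: "('g, 'b) monoid_scheme" and \<kappa> :: "'v \<Rightarrow> 'a"
  assumes pres: "presents Z N \<kappa> Y" and G: "group G"
    and PZ: "\<And>g x. g \<in> carrier G \<Longrightarrow> x \<in> Z \<Longrightarrow> P g x \<in> Z"
    and P_add: "\<And>g x y. g \<in> carrier G \<Longrightarrow> x \<in> Z \<Longrightarrow> y \<in> Z \<Longrightarrow> P g (x + y) = P g x + P g y"
    and P_scale: "\<And>g c x. g \<in> carrier G \<Longrightarrow> x \<in> Z \<Longrightarrow> P g (c *\<^sub>R x) = c *\<^sub>R P g x"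
    and P_N: "\<And>g x. g \<in> carrier G \<Longrightarrow> x \<in> Z \<Longrightarrow> N (P g x) = N x"
    and P_one: "\<And>x. x \<in> Z \<Longrightarrow> P \<one>\<^bsub>G\<^esub> x = x"
    and P_mult: "\<And>g h x. g \<in> carrier G \<Longrightarrow> h \<in> carrier G \<Longrightarrow> x \<in> Z \<Longrightarrow>
                   P (g \<otimes>\<^bsub>G\<^esub> h) x = P g (P h x)"
    and BZ: "\<And>g. g \<in> carrier G \<Longrightarrow> B g \<in> Z"
    and cocycle: "\<And>g h. g \<in> carrier G \<Longrightarrow> h \<in> carrier G \<Longrightarrow> B (g \<otimes>\<^bsub>G\<^esub> h) = P g (B h) + B g"
  shows "equivariant G Y (\<lambda>g. \<kappa> (B g))"
proof -
  interpret G: group G by (rule G)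
  note K = presentsD[OF pres]
  define r where "r = inv_into Z \<kappa>"
  have rZ: "r (\<kappa> x) \<in> Z" "N (r (\<kappa> x) - x) = 0" if "x \<in> Z" for x
  proof -
    show rZ: "r (\<kappa> x) \<in> Z" using that by (simp add: inv_into_into r_def)
    have "\<kappa> (r (\<kappa> x)) = \<kappa> x" using that by (simp add: f_inv_into_f r_def)
    then show "N (r (\<kappa> x) - x) = 0" using K(2)[OF rZ that] by simp
  qed
  have P_diff: "P g (x - y) = P g x - P g y" if "g \<in> carrier G" "x \<in> Z" "y \<in> Z" for g x y
    using P_add[of g "x - y" y] that mem_diff by simp
  have P_cong: "\<kappa> (P g x) = \<kappa> (P g y)" if "g \<in> carrier G" "x \<in> Z" "y \<in> Z" "N (x - y) = 0" for g x y
    using K(2)[of "P g x" "P g y"] P_diff[of g x y] P_N[of g "x - y"] that PZ mem_diff by simp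
  define L where "L g y = \<kappa> (P g (r y))" for g y
  have L: "L g (\<kappa> x) = \<kappa> (P g x)" if "g \<in> carrier G" "x \<in> Z" for g x
    unfolding L_def by (rule P_cong) (use that rZ in auto)
  define \<tau> where "\<tau> g = restrict (\<lambda>y. vadd Y (L g y) (\<kappa> (B g))) (vcarrier Y)" for g
  have \<tau>: "\<tau> g (\<kappa> x) = \<kappa> (P g x + B g)" if "g \<in> carrier G" "x \<in> Z" for g x
    using that by (simp add: \<tau>_def K(1,3) L PZ BZ)
  \<comment> \<open>The cocycle identity at the unit reads \<open>B 1 = B 1 + B 1\<close>.\<close>
  have B_one: "B \<one>\<^bsub>G\<^esub> = 0"
    using cocycle[of "\<one>\<^bsub>G\<^esub>" "\<one>\<^bsub>G\<^esub>"] P_one BZ by simp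
  have \<tau>_mult: "\<tau> (g \<otimes>\<^bsub>G\<^esub> h) y = \<tau> g (\<tau> h y)"
    if "g \<in> carrier G" "h \<in> carrier G" "y \<in> vcarrier Y" for g h y
    using that by (auto simp: K(1) \<tau> PZ BZ mem_add P_mult cocycle P_add add_ac)
  have \<tau>_one: "\<tau> \<one>\<^bsub>G\<^esub> y = y" if "y \<in> vcarrier Y" for y
    using that by (auto simp: K(1) \<tau> P_one B_one)
  have \<tau>_mem: "\<tau> g y \<in> vcarrier Y" if "g \<in> carrier G" "y \<in> vcarrier Y" for g y
    using that by (auto simp: K(1) \<tau> PZ BZ mem_add)
  have bij: "\<tau> g \<in> Bij (vcarrier Y)" if g: "g \<in> carrier G" for g
  proof -
    have "bij_betw (\<tau> g) (vcarrier Y) (vcarrier Y)"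
    proof (rule bij_betw_byWitness[where f' = "\<tau> (inv\<^bsub>G\<^esub> g)"])
      show "\<forall>a\<in>vcarrier Y. \<tau> (inv\<^bsub>G\<^esub> g) (\<tau> g a) = a"
        using \<tau>_mult[of "inv\<^bsub>G\<^esub> g" g] g \<tau>_one by simp
      show "\<forall>a\<in>vcarrier Y. \<tau> g (\<tau> (inv\<^bsub>G\<^esub> g) a) = a"
        using \<tau>_mult[of g "inv\<^bsub>G\<^esub> g"] g \<tau>_one by simp
    qed (use \<tau>_mem g in auto)
    then show ?thesis by (auto simp: Bij_def \<tau>_def)
  qed
  have "group_action G (vcarrier Y) \<tau>"
    unfolding group_action_def group_hom_def group_hom_axioms_def
  proof (intro conjI)
    show "\<tau> \<in> hom G (BijGroup (vcarrier Y))"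
    proof (rule homI)
      fix g h assume gh: "g \<in> carrier G" "h \<in> carrier G"
      have "\<tau> (g \<otimes>\<^bsub>G\<^esub> h) = compose (vcarrier Y) (\<tau> g) (\<tau> h)"
      proof
        fix y show "\<tau> (g \<otimes>\<^bsub>G\<^esub> h) y = compose (vcarrier Y) (\<tau> g) (\<tau> h) y"
          using \<tau>_mult[OF gh] by (cases "y \<in> vcarrier Y") (auto simp: compose_def \<tau>_def)
      qed
      then show "\<tau> (g \<otimes>\<^bsub>G\<^esub> h) = \<tau> g \<otimes>\<^bsub>BijGroup (vcarrier Y)\<^esub> \<tau> h"
        using bij gh by (simp add: BijGroup_def)
    qed (use bij in \<open>simp add: BijGroup_def\<close>)
  qed (use G group_BijGroup in auto)
  moreover have "affine_isometry Y (\<tau> g)" if g: "g \<in> carrier G" for g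
    unfolding affine_isometry_def
  proof (intro conjI)
    have "linear_between Y (vcarrier Y) Y (L g)"
      using g by (auto simp: linear_between_def K(1) K(3) K(4) L PZ mem_add mem_scale P_add P_scale)
    moreover have "\<forall>x\<in>vcarrier Y. \<tau> g x = vadd Y (L g x) (\<kappa> (B g))"
      by (simp add: \<tau>_def)
    ultimately show "\<exists>L. \<exists>b\<in>vcarrier Y. linear_between Y (vcarrier Y) Y L \<and>
        (\<forall>x\<in>vcarrier Y. \<tau> g x = vadd Y (L x) b)"
      using BZ[OF g] K(1) by blast
    show "\<forall>x\<in>vcarrier Y. \<forall>y\<in>vcarrier Y. vnorm Y (vdiff Y (\<tau> g x) (\<tau> g y)) = vnorm Y (vdiff Y x y)"
    proof (intro ballI)
      fix x y assume "x \<in> vcarrier Y" "y \<in> vcarrier Y"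
      then obtain u v where uv: "u \<in> Z" "v \<in> Z" "x = \<kappa> u" "y = \<kappa> v" by (auto simp: K(1))
      have "vdiff Y (\<tau> g x) (\<tau> g y) = \<kappa> (P g (u - v))"
        using uv g by (simp add: \<tau> presents_vdiff[OF pres] PZ BZ mem_add P_diff)
      then show "vnorm Y (vdiff Y (\<tau> g x) (\<tau> g y)) = vnorm Y (vdiff Y x y)"
        using uv g by (simp add: presents_vdiff[OF pres] K(6) PZ mem_diff P_N)
    qed
  qed
  moreover have "\<kappa> (B g) = \<tau> g (\<kappa> 0)" if "g \<in> carrier G" for g
  proof -
    have "P g 0 = 0" using P_scale[OF that mem_0, of 0] by simp
    then show ?thesis using that \<tau>[OF that mem_0] by simp
  qed
  ultimately show ?thesis
    unfolding equivariant_def using K(1) mem_0 by blast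
qed

end

section \<open>Completion by Cauchy sequences\<close>

text \<open>
  The completion has the Cauchy sequences themselves as vectors. Linear isometries act on them entry
  by entry, so that actions and cocycles carry over without any passage to classes.
\<close>

definition cauchy_seqs :: "'v::real_vector set \<Rightarrow> ('v \<Rightarrow> real) \<Rightarrow> (nat \<Rightarrow> 'v) set" where
  "cauchy_seqs W N = {s. range s \<subseteq> W \<and> cauchy_in N s}"

definition lim_norm :: "('v::real_vector \<Rightarrow> real) \<Rightarrow> (nat \<Rightarrow> 'v) \<Rightarrow> real" where
  "lim_norm N s = lim (\<lambda>n. N (s n))"

lemma lim_norm_const [simp]: "lim_norm N (\<lambda>n. w) = N w"
  by (simp add: lim_norm_def)

context seminormed
begin

lemma cauchy_in_comparison:
  assumes "cauchy_in N s" and "range s \<subseteq> Z" and "0 \<le> C"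
    and "\<And>m n. M (t m - t n) \<le> C * N (s m - s n)"
  shows "cauchy_in M t"
  unfolding cauchy_in_def
proof (intro allI impI)
  fix e :: real assume "e > 0"
  then have "e / (C + 1) > 0" using assms(3) by simp
  then obtain K where K: "\<And>m n. m \<ge> K \<Longrightarrow> n \<ge> K \<Longrightarrow> N (s m - s n) < e / (C + 1)"
    by (rule cauchy_inE[OF assms(1)]) (rule that)
  have "M (t m - t n) < e" if "m \<ge> K" "n \<ge> K" for m n
  proof -
    have "0 \<le> N (s m - s n)" using assms(2) by (intro N_nonneg mem_diff) auto
    then have "C * N (s m - s n) \<le> (C + 1) * N (s m - s n)" by (simp add: distrib_right)
    also have "\<dots> < e" using K[OF that] assms(3) by (simp add: field_simps)
    finally show ?thesis using assms(4)[of m n] by simp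
  qed
  then show "\<exists>M'. \<forall>m\<ge>M'. \<forall>n\<ge>M'. M (t m - t n) < e" by blast
qed

lemma cauchy_in_sum:
  assumes "cauchy_in N s" "range s \<subseteq> Z" "cauchy_in N t" "range t \<subseteq> Z"
    and "\<And>m n. M (u m - u n) \<le> N (s m - s n) + N (t m - t n)"
  shows "cauchy_in M u"
  unfolding cauchy_in_def
proof (intro allI impI)
  fix e :: real assume "e > 0"
  then have e: "e / 2 > 0" by simp
  obtain K where K: "\<And>m n. m \<ge> K \<Longrightarrow> n \<ge> K \<Longrightarrow> N (s m - s n) < e / 2"
    by (rule cauchy_inE[OF assms(1) e]) (rule that)
  obtain K' where K': "\<And>m n. m \<ge> K' \<Longrightarrow> n \<ge> K' \<Longrightarrow> N (t m - t n) < e / 2"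
    by (rule cauchy_inE[OF assms(3) e]) (rule that)
  have "M (u m - u n) < e" if "m \<ge> max K K'" "n \<ge> max K K'" for m n
    using K[of m n] K'[of m n] assms(5)[of m n] that by simp
  then show "\<exists>M'. \<forall>m\<ge>M'. \<forall>n\<ge>M'. M (u m - u n) < e" by blast
qed

lemma const_in_cauchy_seqs: "w \<in> Z \<Longrightarrow> (\<lambda>n. w) \<in> cauchy_seqs Z N"
  by (auto simp: cauchy_seqs_def cauchy_in_def N_0)

lemma lim_norm_tendsto:
  assumes "s \<in> cauchy_seqs Z N"
  shows "(\<lambda>n. N (s n)) \<longlonglongrightarrow> lim_norm N s"
proof -
  have s: "range s \<subseteq> Z" "cauchy_in N s" using assms by (auto simp: cauchy_seqs_def)
  have "Cauchy (\<lambda>n. N (s n))"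
    unfolding Cauchy_def
  proof (intro allI impI)
    fix e :: real assume "e > 0"
    then obtain M where "\<And>m n. m \<ge> M \<Longrightarrow> n \<ge> M \<Longrightarrow> N (s m - s n) < e"
      by (rule cauchy_inE[OF s(2)]) (rule that)
    moreover have "dist (N (s m)) (N (s n)) \<le> N (s m - s n)" for m n
      using abs_N_diff_le[of "s m" "s n"] s(1) by (auto simp: dist_real_def)
    ultimately show "\<exists>M. \<forall>m\<ge>M. \<forall>n\<ge>M. dist (N (s m)) (N (s n)) < e"
      by (meson le_less_trans)
  qed
  then show ?thesis
    unfolding lim_norm_def by (simp add: Cauchy_convergent_iff convergent_LIMSEQ_iff)
qed

lemma seminormed_completion: "seminormed (cauchy_seqs Z N) (lim_norm N)"
proof
  show "subspace (cauchy_seqs Z N)"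
  proof (rule subspaceI)
    show "0 \<in> cauchy_seqs Z N"
      using const_in_cauchy_seqs[OF mem_0] by (simp add: zero_fun_def)
  next
    fix s t assume st: "s \<in> cauchy_seqs Z N" "t \<in> cauchy_seqs Z N"
    then have r: "range s \<subseteq> Z" "range t \<subseteq> Z" and c: "cauchy_in N s" "cauchy_in N t"
      by (auto simp: cauchy_seqs_def)
    have "N ((s + t) m - (s + t) n) \<le> N (s m - s n) + N (t m - t n)" for m n
      using N_triangle[of "s m - s n" "t m - t n"] r mem_diff by (simp add: algebra_simps range_subsetD)
    then have "cauchy_in N (s + t)"
      by (rule cauchy_in_sum[OF c(1) r(1) c(2) r(2)])
    then show "s + t \<in> cauchy_seqs Z N"
      using r by (auto simp: cauchy_seqs_def intro!: mem_add)
  next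
    fix c :: real and s assume "s \<in> cauchy_seqs Z N"
    then have r: "range s \<subseteq> Z" and cs: "cauchy_in N s" by (auto simp: cauchy_seqs_def)
    have "N ((c *\<^sub>R s) m - (c *\<^sub>R s) n) \<le> \<bar>c\<bar> * N (s m - s n)" for m n
      using N_scale[of "s m - s n" c] r mem_diff by (simp add: algebra_simps range_subsetD)
    then have "cauchy_in N (c *\<^sub>R s)"
      by (rule cauchy_in_comparison[OF cs r abs_ge_zero])
    then show "c *\<^sub>R s \<in> cauchy_seqs Z N"
      using r by (auto simp: cauchy_seqs_def intro!: mem_scale)
  qed
next
  fix s and c :: real assume s: "s \<in> cauchy_seqs Z N"
  then have "s n \<in> Z" for n by (auto simp: cauchy_seqs_def)
  then have "(\<lambda>n. N ((c *\<^sub>R s) n)) \<longlonglongrightarrow> \<bar>c\<bar> * lim_norm N s"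
    by (simp add: N_scale tendsto_mult_left lim_norm_tendsto[OF s])
  then show "lim_norm N (c *\<^sub>R s) = \<bar>c\<bar> * lim_norm N s"
    unfolding lim_norm_def by (rule limI)
next
  fix s t assume st: "s \<in> cauchy_seqs Z N" "t \<in> cauchy_seqs Z N"
  then have r: "range s \<subseteq> Z" "range t \<subseteq> Z" and c: "cauchy_in N s" "cauchy_in N t"
    by (auto simp: cauchy_seqs_def)
  have "N ((s + t) m - (s + t) n) \<le> N (s m - s n) + N (t m - t n)" for m n
    using N_triangle[of "s m - s n" "t m - t n"] r mem_diff by (simp add: algebra_simps range_subsetD)
  then have "cauchy_in N (s + t)"
    by (rule cauchy_in_sum[OF c(1) r(1) c(2) r(2)])
  then have "s + t \<in> cauchy_seqs Z N"
    using r by (auto simp: cauchy_seqs_def intro!: mem_add)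
  then show "lim_norm N (s + t) \<le> lim_norm N s + lim_norm N t"
    using r by (intro LIMSEQ_le[OF lim_norm_tendsto tendsto_add[OF lim_norm_tendsto lim_norm_tendsto]])
      (auto simp: st intro!: N_triangle exI[of _ 0] intro: range_subsetD)
qed

lemma completion_approx:
  assumes s: "s \<in> cauchy_seqs Z N" and e: "e > 0"
  shows "\<exists>n. lim_norm N (s - (\<lambda>k. s n)) < e"
proof -
  interpret C: seminormed "cauchy_seqs Z N" "lim_norm N" by (rule seminormed_completion)
  have "cauchy_in N s" using s by (simp add: cauchy_seqs_def)
  moreover have "e / 2 > 0" using e by simp
  ultimately obtain M where M: "\<And>m n. m \<ge> M \<Longrightarrow> n \<ge> M \<Longrightarrow> N (s m - s n) < e / 2"
    by (rule cauchy_inE) (rule that)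
  have "s M \<in> Z" using s by (auto simp: cauchy_seqs_def)
  then have "(\<lambda>n. N ((s - (\<lambda>k. s M)) n)) \<longlonglongrightarrow> lim_norm N (s - (\<lambda>k. s M))"
    using s by (intro lim_norm_tendsto C.mem_diff const_in_cauchy_seqs)
  then have "lim_norm N (s - (\<lambda>k. s M)) \<le> e / 2"
  proof (rule LIMSEQ_le_const2)
    show "\<exists>K. \<forall>n\<ge>K. N ((s - (\<lambda>k. s M)) n) \<le> e / 2"
      using M by (intro exI[of _ M]) (simp add: less_imp_le)
  qed
  then show ?thesis using e by (intro exI[of _ M]) simp
qed

lemma complete_completion: "complete_in (cauchy_seqs Z N) (lim_norm N)"
  unfolding complete_in_def
proof (intro allI impI)
  interpret C: seminormed "cauchy_seqs Z N" "lim_norm N" by (rule seminormed_completion)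
  fix S :: "nat \<Rightarrow> nat \<Rightarrow> 'v"
  assume "range S \<subseteq> cauchy_seqs Z N" and S_cauchy: "cauchy_in (lim_norm N) S"
  then have S: "S k \<in> cauchy_seqs Z N" for k by auto
  \<comment> \<open>Replacing the \<open>k\<close>-th sequence by a vector at distance below \<open>1/(k+1)\<close> yields the limit.\<close>
  have "\<exists>w\<in>Z. lim_norm N (S k - (\<lambda>n. w)) < inverse (real (Suc k))" for k
    using completion_approx[OF S, of "inverse (real (Suc k))" k] S[of k]
    by (fastforce simp: cauchy_seqs_def)
  then obtain d where d: "\<And>k. d k \<in> Z"
      "\<And>k. lim_norm N (S k - (\<lambda>n. d k)) < inverse (real (Suc k))"
    by metis
  let ?c = "\<lambda>k. (\<lambda>n. d k) :: nat \<Rightarrow> 'v"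
  have c: "?c k \<in> cauchy_seqs Z N" for k using d by (intro const_in_cauchy_seqs)
  have small: "\<exists>K. \<forall>k\<ge>K. inverse (real (Suc k)) < e" if "e > 0" for e :: real
  proof -
    obtain K where K: "inverse (real (Suc K)) < e" using reals_Archimedean[OF \<open>e > 0\<close>] by blast
    have "inverse (real (Suc k)) < e" if "k \<ge> K" for k
      using le_imp_inverse_le[of "real (Suc K)" "real (Suc k)"] K that by linarith
    then show ?thesis by blast
  qed
  have diff: "N (d m - d n) \<le> inverse (real (Suc m)) + lim_norm N (S m - S n) + inverse (real (Suc n))"
    for m n
  proof -
    have "N (d m - d n) = lim_norm N (?c m - ?c n)"
    proof -
      have "?c m - ?c n = (\<lambda>k. d m - d n)" by (simp add: fun_eq_iff)
      then show ?thesis by simp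
    qed
    also have "\<dots> \<le> lim_norm N (?c m - S m) + lim_norm N (S m - ?c n)"
      by (intro C.N_diff_triangle c S)
    also have "lim_norm N (S m - ?c n) \<le> lim_norm N (S m - S n) + lim_norm N (S n - ?c n)"
      by (intro C.N_diff_triangle c S)
    finally show ?thesis
      using d(2)[of m] d(2)[of n] C.N_commute[OF c S, of m m] by linarith
  qed
  have "cauchy_in N d"
    unfolding cauchy_in_def
  proof (intro allI impI)
    fix e :: real assume "e > 0"
    then have e: "e / 3 > 0" by simp
    obtain K where K: "\<And>k. k \<ge> K \<Longrightarrow> inverse (real (Suc k)) < e / 3" using small[OF e] by blast
    obtain L where L: "\<And>m n. m \<ge> L \<Longrightarrow> n \<ge> L \<Longrightarrow> lim_norm N (S m - S n) < e / 3"
      by (rule cauchy_inE[OF S_cauchy e]) (rule that)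
    have "N (d m - d n) < e" if "m \<ge> max K L" "n \<ge> max K L" for m n
      using diff[of m n] K[of m] K[of n] L[of m n] that by simp
    then show "\<exists>M. \<forall>m\<ge>M. \<forall>n\<ge>M. N (d m - d n) < e" by blast
  qed
  then have dC: "d \<in> cauchy_seqs Z N" using d by (auto simp: cauchy_seqs_def)
  have "(\<lambda>n. lim_norm N (S n - d)) \<longlonglongrightarrow> 0"
    unfolding LIMSEQ_iff
  proof (intro allI impI)
    fix e :: real assume "e > 0"
    then have e: "e / 3 > 0" by simp
    obtain K where K: "\<And>k. k \<ge> K \<Longrightarrow> inverse (real (Suc k)) < e / 3" using small[OF e] by blast
    obtain L where L: "\<And>m n. m \<ge> L \<Longrightarrow> n \<ge> L \<Longrightarrow> N (d m - d n) < e / 3"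
      by (rule cauchy_inE[OF \<open>cauchy_in N d\<close> e]) (rule that)
    have "norm (lim_norm N (S k - d) - 0) < e" if k: "k \<ge> max K L" for k
    proof -
      have "(\<lambda>n. N ((?c k - d) n)) \<longlonglongrightarrow> lim_norm N (?c k - d)"
        by (intro lim_norm_tendsto C.mem_diff c dC)
      then have "lim_norm N (?c k - d) \<le> e / 3"
        by (rule LIMSEQ_le_const2) (use L k in \<open>force intro!: exI[of _ L] less_imp_le\<close>)
      moreover have "lim_norm N (S k - d) \<le> lim_norm N (S k - ?c k) + lim_norm N (?c k - d)"
        by (intro C.N_diff_triangle c S dC)
      moreover have "0 \<le> lim_norm N (S k - d)" by (intro C.N_nonneg C.mem_diff S dC)
      ultimately show ?thesis using d(2)[of k] K[of k] k by simp
    qed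
    then show "\<exists>no. \<forall>n\<ge>no. norm (lim_norm N (S n - d) - 0) < e" by blast
  qed
  then show "\<exists>l\<in>cauchy_seqs Z N. (\<lambda>n. lim_norm N (S n - l)) \<longlonglongrightarrow> 0"
    using dC by blast
qed

end

section \<open>Convexity inequalities for powers\<close>

text \<open>
  Convexity of \<open>t \<mapsto> t\<^sup>p\<close> at the point \<open>(u + v) / (a + b)\<close>, which is the convex combination of \<open>u / a\<close>
  and \<open>v / b\<close> with weights \<open>a / (a + b)\<close> and \<open>b / (a + b)\<close>.
\<close>

lemma powr_add_le_weighted:
  fixes a b u v p :: real
  assumes p: "1 \<le> p" and ab: "0 < a" "0 < b" and uv: "0 \<le> u" "0 \<le> v"
  shows "(u + v) powr p \<le> (a + b) powr (p - 1) * (a powr (1 - p) * u powr p + b powr (1 - p) * v powr p)"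
proof -
  have small: "w powr p \<le> (c + d) powr (p - 1) * (c powr (1 - p) * w powr p)"
    if "0 < c" "0 < d" for c d w :: real
  proof -
    have "1 = c powr (p - 1) * c powr (1 - p)" using that by (simp add: powr_add[symmetric])
    also have "\<dots> \<le> (c + d) powr (p - 1) * c powr (1 - p)"
      using that p by (intro mult_right_mono powr_mono2) auto
    finally have "1 * w powr p \<le> (c + d) powr (p - 1) * c powr (1 - p) * w powr p"
      by (rule mult_right_mono) simp
    then show ?thesis by (simp add: mult_ac)
  qed
  consider "u = 0" | "v = 0" | "0 < u" "0 < v" using uv by fastforce
  then show ?thesis
  proof cases
    case 1
    then show ?thesis using small[of b a v] ab p by (simp add: add.commute)
  next
    case 2
    then show ?thesis using small[of a b u] ab p by simp
  next
    case 3
    define s t where "s = a / (a + b)" and "t = b / (a + b)"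
    have st: "0 \<le> s" "0 \<le> t" "s + t = 1" using ab by (auto simp: s_def t_def add_divide_distrib[symmetric])
    then have s_eq: "s = 1 - t" by simp
    have eq: "s * (u / a) + t * (v / b) = (u + v) / (a + b)"
      using ab by (simp add: s_def t_def add_divide_distrib)
    have "(s * (u / a) + t * (v / b)) powr p \<le> s * (u / a) powr p + t * (v / b) powr p"
      using convex_onD[OF powr_convex[OF p], of t "u / a" "v / b"] st 3 ab
      unfolding s_eq by simp
    then have "(a + b) powr p * ((u + v) / (a + b)) powr p
        \<le> (a + b) powr p * (s * (u / a) powr p + t * (v / b) powr p)"
      unfolding eq by (intro mult_left_mono) auto
    also have "\<dots> = (a + b) powr (p - 1) * (a powr (1 - p) * u powr p + b powr (1 - p) * v powr p)"
    proof -
      have *: "(a + b) powr p * (c / (a + b) * (w / c) powr p)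
          = (a + b) powr (p - 1) * (c powr (1 - p) * w powr p)" if "0 < c" "0 < w" for c w
        using that ab by (simp add: powr_divide powr_diff)
      show ?thesis using *[of a u] *[of b v] ab 3 by (simp add: s_def t_def distrib_left)
    qed
    also have "(a + b) powr p * ((u + v) / (a + b)) powr p = (u + v) powr p"
      using ab 3 by (simp add: powr_divide)
    finally show ?thesis .
  qed
qed

text \<open>
  Minkowski's inequality for an arbitrary positive functional: applied to the \<open>p\<close>-th powers of \<open>u\<close>, \<open>v\<close>
  and \<open>u + v\<close>, the functional satisfies the hypothesis by the previous lemma, and the choice
  \<open>a = A\<^sup>1\<^sup>/\<^sup>p\<close>, \<open>b = B\<^sup>1\<^sup>/\<^sup>p\<close> makes the right-hand side \<open>(a + b)\<^sup>p\<close>. This serves means as well as integrals.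
\<close>

lemma minkowski_from_weighted:
  fixes A B C p :: real
  assumes p: "1 \<le> p" and nn: "0 \<le> A" "0 \<le> B" "0 \<le> C"
    and le: "\<And>a b. 0 < a \<Longrightarrow> 0 < b \<Longrightarrow>
      C \<le> (a + b) powr (p - 1) * (a powr (1 - p) * A + b powr (1 - p) * B)"
  shows "C powr (1 / p) \<le> A powr (1 / p) + B powr (1 / p)"
proof (rule field_le_epsilon)
  fix e :: real assume "0 < e"
  \<comment> \<open>The summand \<open>e / 2\<close> keeps both weights positive when \<open>A\<close> or \<open>B\<close> vanishes.\<close>
  define a b where "a = A powr (1 / p) + e / 2" and "b = B powr (1 / p) + e / 2"
  have ab: "0 < a" "0 < b" using \<open>0 < e\<close> by (auto simp: a_def b_def add_nonneg_pos)
  have bound: "c powr (1 - p) * D \<le> c" if c: "0 < c" "D powr (1 / p) \<le> c" and D: "0 \<le> D" for c D :: real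
  proof -
    have "D = (D powr (1 / p)) powr p" using D p by (simp add: powr_powr)
    also have "\<dots> \<le> c powr p" using c p by (intro powr_mono2) auto
    finally have "c powr (1 - p) * D \<le> c powr (1 - p) * c powr p"
      by (intro mult_left_mono) auto
    also have "\<dots> = c" using c by (simp add: powr_add[symmetric])
    finally show ?thesis .
  qed
  have "C \<le> (a + b) powr (p - 1) * (a powr (1 - p) * A + b powr (1 - p) * B)"
    by (rule le[OF ab])
  also have "\<dots> \<le> (a + b) powr (p - 1) * (a + b)"
    using bound[of a A] bound[of b B] ab nn \<open>0 < e\<close>
    by (intro mult_left_mono add_mono) (auto simp: a_def b_def)
  also have "\<dots> = (a + b) powr p" using ab by (simp add: powr_diff)
  finally have "C powr (1 / p) \<le> ((a + b) powr p) powr (1 / p)"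
    using nn p by (intro powr_mono2) auto
  also have "\<dots> = a + b" using ab p by (simp add: powr_powr)
  finally show "C powr (1 / p) \<le> A powr (1 / p) + B powr (1 / p) + e"
    by (simp add: a_def b_def)
qed

section \<open>Invariant means\<close>

locale mean_group = group G for G :: "('g, 'b) monoid_scheme" (structure) +
  fixes m :: "('g \<Rightarrow> real) \<Rightarrow> real"
  assumes left_invariant_mean: "left_invariant_mean G m"
begin

lemma bounded_funs_iff: "f \<in> bounded_funs G \<longleftrightarrow> (\<exists>K. \<forall>x\<in>carrier G. \<bar>f x\<bar> \<le> K)"
  by (auto simp: bounded_funs_def bounded_iff)

lemma bounded_funsI: "(\<And>x. x \<in> carrier G \<Longrightarrow> \<bar>f x\<bar> \<le> K) \<Longrightarrow> f \<in> bounded_funs G"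
  by (auto simp: bounded_funs_iff)

lemma mean_linear:
  "f \<in> bounded_funs G \<Longrightarrow> h \<in> bounded_funs G \<Longrightarrow> m (\<lambda>x. a * f x + b * h x) = a * m f + b * m h"
  using left_invariant_mean by (auto simp: left_invariant_mean_def)

lemma mean_nonneg: "f \<in> bounded_funs G \<Longrightarrow> (\<And>x. x \<in> carrier G \<Longrightarrow> 0 \<le> f x) \<Longrightarrow> 0 \<le> m f"
  using left_invariant_mean by (auto simp: left_invariant_mean_def)

lemma mean_translate:
  "f \<in> bounded_funs G \<Longrightarrow> g \<in> carrier G \<Longrightarrow> m (\<lambda>x. f (g \<otimes> x)) = m f"
  using left_invariant_mean by (auto simp: left_invariant_mean_def)

lemma mean_add:
  "f \<in> bounded_funs G \<Longrightarrow> h \<in> bounded_funs G \<Longrightarrow> m (\<lambda>x. f x + h x) = m f + m h"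
  using mean_linear[of f h 1 1] by simp

lemma mean_diff:
  "f \<in> bounded_funs G \<Longrightarrow> h \<in> bounded_funs G \<Longrightarrow> m (\<lambda>x. f x - h x) = m f - m h"
  using mean_linear[of f h 1 "-1"] by simp

lemma mean_scale: "f \<in> bounded_funs G \<Longrightarrow> m (\<lambda>x. a * f x) = a * m f"
  using mean_linear[of f f a 0] by simp

lemma const_bounded_funs: "(\<lambda>x. c) \<in> bounded_funs G"
  by (rule bounded_funsI) (rule order_refl)

lemma mean_const: "m (\<lambda>x. c) = c"
  using mean_scale[OF const_bounded_funs, of c 1] left_invariant_mean
  by (simp add: left_invariant_mean_def)

lemma bounded_funs_scale: "f \<in> bounded_funs G \<Longrightarrow> (\<lambda>x. c * f x) \<in> bounded_funs G"
  unfolding bounded_funs_iff by (metis abs_ge_zero abs_mult mult_left_mono)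

lemma bounded_funs_add:
  "f \<in> bounded_funs G \<Longrightarrow> h \<in> bounded_funs G \<Longrightarrow> (\<lambda>x. f x + h x) \<in> bounded_funs G"
  unfolding bounded_funs_iff by (meson abs_triangle_ineq add_mono order_trans)

lemma bounded_funs_diff:
  "f \<in> bounded_funs G \<Longrightarrow> h \<in> bounded_funs G \<Longrightarrow> (\<lambda>x. f x - h x) \<in> bounded_funs G"
  using bounded_funs_add[OF _ bounded_funs_scale, of f h "-1"] by simp

lemma bounded_funs_sum:
  "(\<And>i. i \<in> I \<Longrightarrow> f i \<in> bounded_funs G) \<Longrightarrow> (\<lambda>x. \<Sum>i\<in>I. f i x) \<in> bounded_funs G"
  by (induction I rule: infinite_finite_induct) (auto intro: bounded_funs_add const_bounded_funs)

lemma mean_sum: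
  "(\<And>i. i \<in> I \<Longrightarrow> f i \<in> bounded_funs G) \<Longrightarrow> m (\<lambda>x. \<Sum>i\<in>I. f i x) = (\<Sum>i\<in>I. m (f i))"
  by (induction I rule: infinite_finite_induct)
    (auto simp: mean_const mean_add bounded_funs_sum)

lemma mean_mono:
  assumes "f \<in> bounded_funs G" "h \<in> bounded_funs G" "\<And>x. x \<in> carrier G \<Longrightarrow> f x \<le> h x"
  shows "m f \<le> m h"
  using mean_nonneg[OF bounded_funs_diff[OF assms(2,1)]] assms mean_diff[OF assms(2,1)] by simp

lemma mean_cong:
  assumes "f \<in> bounded_funs G" "\<And>x. x \<in> carrier G \<Longrightarrow> f x = h x"
  shows "m f = m h"
proof -
  have "h \<in> bounded_funs G" using assms by (auto simp: bounded_funs_iff)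
  then show ?thesis using assms by (intro antisym mean_mono) auto
qed

lemma mean_le: "f \<in> bounded_funs G \<Longrightarrow> (\<And>x. x \<in> carrier G \<Longrightarrow> f x \<le> c) \<Longrightarrow> m f \<le> c"
  using mean_mono[OF _ const_bounded_funs, of f c] mean_const by simp

lemma mean_ge: "f \<in> bounded_funs G \<Longrightarrow> (\<And>x. x \<in> carrier G \<Longrightarrow> c \<le> f x) \<Longrightarrow> c \<le> m f"
  using mean_mono[OF const_bounded_funs, of f c] mean_const by simp

end

section \<open>Averaged seminorms and the displacement cocycle\<close>

text \<open>
  The seminorm \<open>n\<close> plays the role of the norm of \<open>X\<close>; it is the norm of a Banach space or the
  \<open>L\<^sub>p\<close> seminorm on functions.
\<close>

locale averaged = mean_group G m + U: seminormed U n
  for G :: "('g, 'b) monoid_scheme" (structure) and m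
    and U :: "'u::real_vector set" and n :: "'u \<Rightarrow> real" +
  fixes p :: real
  assumes p: "1 \<le> p"
begin

text \<open>
  Functions vanish outside the carrier so that translations form an action on the nose.
\<close>

definition V :: "('g \<Rightarrow> 'u) set" where
  "V = {F. (\<forall>x. x \<notin> carrier G \<longrightarrow> F x = 0) \<and> (\<forall>x\<in>carrier G. F x \<in> U) \<and>
           (\<exists>K. \<forall>x\<in>carrier G. n (F x) \<le> K)}"

definition q :: "('g \<Rightarrow> 'u) \<Rightarrow> real" where
  "q F = m (\<lambda>x. n (F x) powr p) powr (1 / p)"

definition translate :: "'g \<Rightarrow> ('g \<Rightarrow> 'u) \<Rightarrow> 'g \<Rightarrow> 'u" where
  "translate g F x = (if x \<in> carrier G then F (inv g \<otimes> x) else 0)"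

lemma VI:
  assumes "\<And>x. x \<notin> carrier G \<Longrightarrow> F x = 0" "\<And>x. x \<in> carrier G \<Longrightarrow> F x \<in> U"
    "\<And>x. x \<in> carrier G \<Longrightarrow> n (F x) \<le> K"
  shows "F \<in> V"
  using assms by (auto simp: V_def)

lemma VD:
  assumes "F \<in> V"
  shows "x \<notin> carrier G \<Longrightarrow> F x = 0" "x \<in> carrier G \<Longrightarrow> F x \<in> U"
    "\<exists>K. \<forall>x\<in>carrier G. n (F x) \<le> K"
  using assms by (auto simp: V_def)

lemma V_bound:
  assumes "F \<in> V" obtains K where "0 \<le> K" "\<And>x. x \<in> carrier G \<Longrightarrow> n (F x) \<le> K"
proof -
  obtain K where "\<forall>x\<in>carrier G. n (F x) \<le> K" using assms by (auto simp: V_def)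
  then show ?thesis by (intro that[of "max 0 K"]) (auto simp: le_max_iff_disj)
qed

lemma powr_bounded:
  assumes "F \<in> V" shows "(\<lambda>x. n (F x) powr p) \<in> bounded_funs G"
proof -
  obtain K where K: "0 \<le> K" "\<And>x. x \<in> carrier G \<Longrightarrow> n (F x) \<le> K" using V_bound[OF assms] by blast
  show ?thesis
    using K p by (intro bounded_funsI[of _ "K powr p"])
      (auto intro!: powr_mono2 U.N_nonneg VD(2)[OF assms])
qed

lemma subspace_V: "subspace V"
proof (rule subspaceI)
  show "0 \<in> V" by (rule VI[of _ 0]) (auto simp: U.mem_0 U.N_0)
next
  fix F H assume FH: "F \<in> V" "H \<in> V"
  obtain K where K: "0 \<le> K" "\<And>x. x \<in> carrier G \<Longrightarrow> n (F x) \<le> K" using V_bound[OF FH(1)] by blast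
  obtain L where L: "0 \<le> L" "\<And>x. x \<in> carrier G \<Longrightarrow> n (H x) \<le> L" using V_bound[OF FH(2)] by blast
  show "F + H \<in> V"
  proof (rule VI[of _ "K + L"])
    fix x assume x: "x \<in> carrier G"
    show "n ((F + H) x) \<le> K + L"
      using U.N_triangle[OF VD(2)[OF FH(1) x] VD(2)[OF FH(2) x]] K(2)[OF x] L(2)[OF x] by simp
  qed (use FH in \<open>auto simp: VD intro: U.mem_add\<close>)
next
  fix c F assume F: "F \<in> V"
  obtain K where K: "0 \<le> K" "\<And>x. x \<in> carrier G \<Longrightarrow> n (F x) \<le> K" using V_bound[OF F] by blast
  show "c *\<^sub>R F \<in> V"
  proof (rule VI[of _ "\<bar>c\<bar> * K"])
    fix x assume x: "x \<in> carrier G"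
    show "n ((c *\<^sub>R F) x) \<le> \<bar>c\<bar> * K"
      using U.N_scale[OF VD(2)[OF F x]] K(2)[OF x] by (simp add: mult_left_mono)
  qed (use F in \<open>auto simp: VD intro: U.mem_scale\<close>)
qed

sublocale V: seminormed V q
proof
  show "subspace V" by (rule subspace_V)
next
  fix F c assume F: "F \<in> V"
  have "m (\<lambda>x. n ((c *\<^sub>R F) x) powr p) = m (\<lambda>x. \<bar>c\<bar> powr p * n (F x) powr p)"
    using powr_bounded[of "c *\<^sub>R F"] subspace_scale[OF subspace_V F]
    by (intro mean_cong) (auto simp: U.N_scale VD[OF F] powr_mult U.N_nonneg)
  then show "q (c *\<^sub>R F) = \<bar>c\<bar> * q F"
    using p mean_nonneg[OF powr_bounded[OF F]]
    by (simp add: q_def mean_scale[OF powr_bounded[OF F]] powr_mult powr_powr)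
next
  fix F H assume FH: "F \<in> V" "H \<in> V"
  note FHV = subspace_add[OF subspace_V FH]
  show "q (F + H) \<le> q F + q H"
    unfolding q_def
  proof (rule minkowski_from_weighted[OF p])
    fix a b :: real assume ab: "0 < a" "0 < b"
    have "m (\<lambda>x. n ((F + H) x) powr p) \<le>
        m (\<lambda>x. (a + b) powr (p - 1) * (a powr (1 - p) * n (F x) powr p + b powr (1 - p) * n (H x) powr p))"
    proof (rule mean_mono[OF powr_bounded[OF FHV]])
      fix x assume x: "x \<in> carrier G"
      have mem: "F x \<in> U" "H x \<in> U" using FH x by (auto simp: VD)
      have "n ((F + H) x) powr p \<le> (n (F x) + n (H x)) powr p"
        using mem p by (intro powr_mono2) (auto intro: U.N_triangle U.N_nonneg U.mem_add)
      also have "\<dots> \<le> (a + b) powr (p - 1) *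
          (a powr (1 - p) * n (F x) powr p + b powr (1 - p) * n (H x) powr p)"
        using mem p ab by (intro powr_add_le_weighted) (auto intro: U.N_nonneg)
      finally show "n ((F + H) x) powr p \<le> (a + b) powr (p - 1) *
          (a powr (1 - p) * n (F x) powr p + b powr (1 - p) * n (H x) powr p)" .
    qed (intro bounded_funs_scale bounded_funs_add powr_bounded FH)
    also have "\<dots> = (a + b) powr (p - 1) *
        (a powr (1 - p) * m (\<lambda>x. n (F x) powr p) + b powr (1 - p) * m (\<lambda>x. n (H x) powr p))"
      by (subst mean_scale)
        (auto intro!: bounded_funs_scale bounded_funs_add powr_bounded FH simp: mean_linear powr_bounded FH)
    finally show "m (\<lambda>x. n ((F + H) x) powr p) \<le> (a + b) powr (p - 1) *
        (a powr (1 - p) * m (\<lambda>x. n (F x) powr p) + b powr (1 - p) * m (\<lambda>x. n (H x) powr p))" .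
  qed (intro mean_nonneg powr_bounded FH FHV powr_ge_zero)+
qed

lemma q_le:
  assumes F: "F \<in> V" and K: "\<And>x. x \<in> carrier G \<Longrightarrow> n (F x) \<le> K" "0 \<le> K"
  shows "q F \<le> K"
proof -
  have "m (\<lambda>x. n (F x) powr p) \<le> K powr p"
    using K p by (intro mean_le powr_bounded F powr_mono2) (auto intro: U.N_nonneg VD(2)[OF F])
  then have "q F \<le> (K powr p) powr (1 / p)"
    unfolding q_def using p mean_nonneg[OF powr_bounded[OF F]] by (intro powr_mono2) auto
  then show ?thesis using K p by (simp add: powr_powr)
qed

lemma q_ge:
  assumes F: "F \<in> V" and K: "\<And>x. x \<in> carrier G \<Longrightarrow> K \<le> n (F x)" "0 \<le> K"
  shows "K \<le> q F"
proof -
  have "K powr p \<le> m (\<lambda>x. n (F x) powr p)"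
    using K p by (intro mean_ge powr_bounded F powr_mono2) auto
  then have "(K powr p) powr (1 / p) \<le> q F"
    unfolding q_def using p by (intro powr_mono2) auto
  then show ?thesis using K p by (simp add: powr_powr)
qed

lemma translate_V:
  assumes "F \<in> V" and g: "g \<in> carrier G" shows "translate g F \<in> V"
proof -
  obtain K where K: "0 \<le> K" "\<And>x. x \<in> carrier G \<Longrightarrow> n (F x) \<le> K" using V_bound[OF assms(1)] by blast
  show ?thesis
    using K g by (intro VI[of _ K]) (auto simp: translate_def intro: VD(2)[OF assms(1)])
qed

lemma translate_add: "translate g (F + H) = translate g F + translate g H"
  by (auto simp: translate_def fun_eq_iff)

lemma translate_diff: "translate g (F - H) = translate g F - translate g H"
  by (auto simp: translate_def fun_eq_iff)

lemma translate_scale: "translate g (c *\<^sub>R F) = c *\<^sub>R translate g F"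
  by (auto simp: translate_def fun_eq_iff)

lemma q_translate:
  assumes F: "F \<in> V" and g: "g \<in> carrier G" shows "q (translate g F) = q F"
proof -
  have "m (\<lambda>x. n (translate g F x) powr p) = m (\<lambda>x. n (F (inv g \<otimes> x)) powr p)"
    using powr_bounded[OF translate_V[OF F g]] by (rule mean_cong) (simp add: translate_def)
  also have "\<dots> = m (\<lambda>x. n (F x) powr p)"
    using mean_translate[OF powr_bounded[OF F], of "inv g"] g by simp
  finally show ?thesis by (simp add: q_def)
qed

lemma translate_one: "F \<in> V \<Longrightarrow> translate \<one> F = F"
  by (auto simp: translate_def fun_eq_iff VD)

lemma translate_mult:
  "g \<in> carrier G \<Longrightarrow> h \<in> carrier G \<Longrightarrow> translate (g \<otimes> h) F = translate g (translate h F)"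
  by (auto simp: translate_def fun_eq_iff inv_mult_group m_assoc)

end

text \<open>
  The bound on displacements is uniform in the base point \<open>x\<close>: this is what left-invariance of the metric
  provides.
\<close>

locale averaged_displacement = averaged G m U n p
  for G :: "('g, 'b) monoid_scheme" (structure) and m
    and U :: "'u::real_vector set" and n :: "'u \<Rightarrow> real" and p :: real +
  fixes f :: "'g \<Rightarrow> 'u" and K :: "'g \<Rightarrow> real"
  assumes f_mem: "\<And>g. g \<in> carrier G \<Longrightarrow> f g \<in> U"
    and displacement_bound: "\<And>x g. x \<in> carrier G \<Longrightarrow> g \<in> carrier G \<Longrightarrow>
          n (f (inv x \<otimes> g) - f (inv x)) \<le> K g"
begin

definition disp :: "'g \<Rightarrow> 'g \<Rightarrow> 'u" where
  "disp g x = (if x \<in> carrier G then f (inv x \<otimes> g) - f (inv x) else 0)"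

lemma disp_V: "g \<in> carrier G \<Longrightarrow> disp g \<in> V"
  by (rule VI[of _ "K g"]) (auto simp: disp_def intro!: U.mem_diff f_mem displacement_bound)

lemma n_disp_le: "g \<in> carrier G \<Longrightarrow> x \<in> carrier G \<Longrightarrow> n (disp g x) \<le> K g"
  by (simp add: disp_def displacement_bound)

text \<open>
  The cocycle identity for \<open>disp\<close>.
\<close>

lemma translate_disp:
  assumes "g \<in> carrier G" "h \<in> carrier G"
  shows "translate g (disp h) = disp (g \<otimes> h) - disp g"
  using assms by (auto simp: translate_def disp_def fun_eq_iff inv_mult_group m_assoc)

text \<open>
  Any invariant space \<open>W\<close> that contains the displacements may be completed, and any presentation of the
  completion may serve as the target. This freedom is used twice: a small \<open>W\<close> gives a separable
  target, a large one gives \<open>L\<^sub>p([0,1])\<close>.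
\<close>

theorem equivariant_in_completion:
  assumes W: "subspace W" "W \<subseteq> V" and inv: "\<And>g F. g \<in> carrier G \<Longrightarrow> F \<in> W \<Longrightarrow> translate g F \<in> W"
    and disp: "\<And>g. g \<in> carrier G \<Longrightarrow> disp g \<in> W"
    and pres: "presents (cauchy_seqs W q) (lim_norm q) \<kappa> Y"
  shows "banach_space Y" and "equivariant G Y (\<lambda>g. \<kappa> (\<lambda>i. disp g))"
    and "\<And>g h. g \<in> carrier G \<Longrightarrow> h \<in> carrier G \<Longrightarrow>
      vnorm Y (vdiff Y (\<kappa> (\<lambda>i. disp g)) (\<kappa> (\<lambda>i. disp h))) = q (disp g - disp h)"
proof -
  interpret W: seminormed W q by (rule V.seminormed_subspace[OF W])
  interpret C: seminormed "cauchy_seqs W q" "lim_norm q" by (rule W.seminormed_completion)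
  show "banach_space Y" by (rule C.presents_banach_space[OF pres W.complete_completion])
  have const: "(\<lambda>i. disp g) \<in> cauchy_seqs W q" if "g \<in> carrier G" for g
    using that by (intro W.const_in_cauchy_seqs disp)
  show "vnorm Y (vdiff Y (\<kappa> (\<lambda>i. disp g)) (\<kappa> (\<lambda>i. disp h))) = q (disp g - disp h)"
    if "g \<in> carrier G" "h \<in> carrier G" for g h
  proof -
    have "(\<lambda>i. disp g) - (\<lambda>i. disp h) = (\<lambda>i :: nat. disp g - disp h)" by (simp add: fun_eq_iff)
    then show ?thesis
      using C.presents_vdiff[OF pres const const] presentsD(6)[OF pres C.mem_diff[OF const const], of g h] that
      by (simp only: lim_norm_const)
  qed
  let ?P = "\<lambda>g (s :: nat \<Rightarrow> 'g \<Rightarrow> 'u) i. translate g (s i)"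
  have mem: "s i \<in> V" "s i \<in> W" if "s \<in> cauchy_seqs W q" for s i
    using that W by (auto simp: cauchy_seqs_def)
  show "equivariant G Y (\<lambda>g. \<kappa> (\<lambda>i. disp g))"
  proof (rule C.presents_equivariant[OF pres, where P = ?P])
    show "group G" by (rule is_group)
  next
    fix g s assume g: "g \<in> carrier G" and s: "s \<in> cauchy_seqs W q"
    have qd: "q (translate g (s i) - translate g (s j)) = q (s i - s j)" for i j
      using q_translate[OF V.mem_diff g] mem[OF s] by (simp add: translate_diff[symmetric])
    then show "?P g s \<in> cauchy_seqs W q"
      using s inv[OF g] by (auto simp: cauchy_seqs_def cauchy_in_def)
    show "lim_norm q (?P g s) = lim_norm q s"
      using q_translate[OF mem(1)[OF s] g] by (simp add: lim_norm_def)
  qed (auto simp: translate_add translate_scale translate_mult translate_one translate_disp mem const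
      fun_eq_iff)
qed

lemma q_disp_bounds:
  assumes gh: "g \<in> carrier G" "h \<in> carrier G"
    and lower: "\<And>x. x \<in> carrier G \<Longrightarrow> a \<le> n (f (x \<otimes> g) - f (x \<otimes> h))"
    and upper: "\<And>x. x \<in> carrier G \<Longrightarrow> n (f (x \<otimes> g) - f (x \<otimes> h)) \<le> b"
    and "0 \<le> a" "0 \<le> b"
  shows "a \<le> q (disp g - disp h)" and "q (disp g - disp h) \<le> b"
proof -
  have *: "(disp g - disp h) x = f (inv x \<otimes> g) - f (inv x \<otimes> h)" if "x \<in> carrier G" for x
    using that by (simp add: disp_def)
  have mem: "disp g - disp h \<in> V" by (intro V.mem_diff disp_V gh)
  show "a \<le> q (disp g - disp h)"
    using lower assms(5) by (intro q_ge mem) (auto simp: * simp del: minus_apply)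
  show "q (disp g - disp h) \<le> b"
    using upper assms(6) by (intro q_le mem) (auto simp: * simp del: minus_apply)
qed

end

section \<open>The Banach spaces of p-integrable functions\<close>

definition Lp_norm :: "real \<Rightarrow> 'm measure \<Rightarrow> ('m \<Rightarrow> real) \<Rightarrow> real" where
  "Lp_norm p M f = (\<integral>x. \<bar>f x\<bar> powr p \<partial>M) powr (1 / p)"

lemma Lp_funsD:
  assumes "f \<in> Lp_funs p M"
  shows "f \<in> borel_measurable M" "integrable M (\<lambda>x. \<bar>f x\<bar> powr p)"
  using assms by (auto simp: Lp_funs_def)

lemma Lp_norm_powr: "1 \<le> p \<Longrightarrow> Lp_norm p M f powr p = (\<integral>x. \<bar>f x\<bar> powr p \<partial>M)"
  by (simp add: Lp_norm_def powr_powr)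

lemma Lp_norm_nonneg: "0 \<le> Lp_norm p M f"
  by (simp add: Lp_norm_def)

lemma nn_integral_Lp:
  assumes "1 \<le> p" "f \<in> Lp_funs p M"
  shows "(\<integral>\<^sup>+x. ennreal (\<bar>f x\<bar> powr p) \<partial>M) = ennreal (Lp_norm p M f powr p)"
  using assms by (simp add: Lp_norm_powr nn_integral_eq_integral Lp_funsD)

text \<open>
  Bounding the extended integral yields integrability and the norm estimate at once.
\<close>

lemma Lp_funsI_nn_integral:
  assumes p: "1 \<le> p" and [measurable]: "f \<in> borel_measurable M" and C: "0 \<le> C"
    and le: "(\<integral>\<^sup>+x. ennreal (\<bar>f x\<bar> powr p) \<partial>M) \<le> ennreal (C powr p)"
  shows "f \<in> Lp_funs p M" and "Lp_norm p M f \<le> C"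
proof -
  have int: "integrable M (\<lambda>x. \<bar>f x\<bar> powr p)"
    using le_less_trans[OF le ennreal_less_top] by (intro integrableI_bounded) auto
  then show f: "f \<in> Lp_funs p M" by (simp add: Lp_funs_def)
  have "Lp_norm p M f powr p \<le> C powr p"
    using le nn_integral_Lp[OF p f] by simp
  then show "Lp_norm p M f \<le> C"
    using powr_less_mono2[of p C "Lp_norm p M f"] p C by fastforce
qed

lemma Lp_dominated:
  assumes p: "1 \<le> p" and f: "f \<in> borel_measurable M" and g: "g \<in> Lp_funs p M"
    and le: "AE x in M. \<bar>f x\<bar> \<le> \<bar>g x\<bar>"
  shows "f \<in> Lp_funs p M" and "Lp_norm p M f \<le> Lp_norm p M g"
proof -
  have "(\<integral>\<^sup>+x. ennreal (\<bar>f x\<bar> powr p) \<partial>M) \<le> (\<integral>\<^sup>+x. ennreal (\<bar>g x\<bar> powr p) \<partial>M)"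
  proof (rule nn_integral_mono_AE)
    show "AE x in M. ennreal (\<bar>f x\<bar> powr p) \<le> ennreal (\<bar>g x\<bar> powr p)"
      using le by eventually_elim (use p in \<open>auto intro!: ennreal_leI powr_mono2\<close>)
  qed
  also have "\<dots> = ennreal (Lp_norm p M g powr p)" by (rule nn_integral_Lp[OF p g])
  finally show "f \<in> Lp_funs p M" "Lp_norm p M f \<le> Lp_norm p M g"
    using Lp_funsI_nn_integral[OF p f Lp_norm_nonneg] by auto
qed

lemma Lp_norm_cong_AE:
  assumes "f \<in> borel_measurable M" "g \<in> borel_measurable M" and "AE x in M. f x = g x"
  shows "Lp_norm p M f = Lp_norm p M g"
proof -
  have "(\<integral>x. \<bar>f x\<bar> powr p \<partial>M) = (\<integral>x. \<bar>g x\<bar> powr p \<partial>M)"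
  proof (rule integral_cong_AE)
    show "AE x in M. \<bar>f x\<bar> powr p = \<bar>g x\<bar> powr p"
      using assms(3) by eventually_elim simp
  qed (use assms(1,2) in measurable)
  then show ?thesis by (simp add: Lp_norm_def)
qed

lemma Lp_norm_eq_0_iff:
  assumes p: "1 \<le> p" and f: "f \<in> Lp_funs p M"
  shows "Lp_norm p M f = 0 \<longleftrightarrow> (AE x in M. f x = 0)"
  using integral_nonneg_eq_0_iff_AE[OF Lp_funsD(2)[OF f]] by (simp add: Lp_norm_def)

lemma Lp_norm_abs: "Lp_norm p M (\<lambda>x. \<bar>f x\<bar>) = Lp_norm p M f"
  by (simp add: Lp_norm_def)

lemma Lp_funs_abs: "f \<in> Lp_funs p M \<Longrightarrow> (\<lambda>x. \<bar>f x\<bar>) \<in> Lp_funs p M"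
  by (auto simp: Lp_funs_def)

lemma seminormed_Lp:
  assumes p: "1 \<le> p"
  shows "seminormed (Lp_funs p M) (Lp_norm p M)"
proof
  have add: "f + g \<in> Lp_funs p M" if fg: "f \<in> Lp_funs p M" "g \<in> Lp_funs p M" for f g
  proof -
    note [measurable] = fg[THEN Lp_funsD(1)]
    have "integrable M (\<lambda>x. \<bar>(f + g) x\<bar> powr p)"
    proof (rule Bochner_Integration.integrable_bound)
      show "integrable M (\<lambda>x. 2 powr (p - 1) * (\<bar>f x\<bar> powr p + \<bar>g x\<bar> powr p))"
        using fg[THEN Lp_funsD(2)] by auto
      have "\<bar>f x + g x\<bar> powr p \<le> 2 powr (p - 1) * (\<bar>f x\<bar> powr p + \<bar>g x\<bar> powr p)" for x
      proof -
        have "\<bar>f x + g x\<bar> powr p \<le> (\<bar>f x\<bar> + \<bar>g x\<bar>) powr p"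
          using p by (intro powr_mono2) auto
        also have "\<dots> \<le> 2 powr (p - 1) * (\<bar>f x\<bar> powr p + \<bar>g x\<bar> powr p)"
          using powr_add_le_weighted[OF p, of 1 1 "\<bar>f x\<bar>" "\<bar>g x\<bar>"] by simp
        finally show ?thesis .
      qed
      then show "AE x in M. norm (\<bar>(f + g) x\<bar> powr p)
          \<le> norm (2 powr (p - 1) * (\<bar>f x\<bar> powr p + \<bar>g x\<bar> powr p))"
        by (intro AE_I2) simp
    qed auto
    moreover have "f + g \<in> borel_measurable M" by (simp add: plus_fun_def)
    ultimately show ?thesis by (simp add: Lp_funs_def)
  qed
  show "subspace (Lp_funs p M)"
  proof (rule subspaceI)
    show "0 \<in> Lp_funs p M" using p by (simp add: Lp_funs_def zero_fun_def)
  next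
    fix c f assume f: "f \<in> Lp_funs p M"
    then have "c *\<^sub>R f \<in> borel_measurable M" by (auto simp: scaleR_fun_def Lp_funs_def)
    then show "c *\<^sub>R f \<in> Lp_funs p M"
      using f by (simp add: Lp_funs_def abs_mult powr_mult)
  qed (rule add)
  show "Lp_norm p M (c *\<^sub>R f) = \<bar>c\<bar> * Lp_norm p M f" if "f \<in> Lp_funs p M" for c f
    using p by (simp add: Lp_norm_def abs_mult powr_mult powr_powr)
  show "Lp_norm p M (f + g) \<le> Lp_norm p M f + Lp_norm p M g"
    if fg: "f \<in> Lp_funs p M" "g \<in> Lp_funs p M" for f g
    unfolding Lp_norm_def
  proof (rule minkowski_from_weighted[OF p])
    fix a b :: real assume ab: "0 < a" "0 < b"
    have int: "integrable M (\<lambda>x. a powr (1 - p) * \<bar>f x\<bar> powr p + b powr (1 - p) * \<bar>g x\<bar> powr p)"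
      using fg[THEN Lp_funsD(2)] by auto
    have "(\<integral>x. \<bar>(f + g) x\<bar> powr p \<partial>M) \<le>
        (\<integral>x. (a + b) powr (p - 1) * (a powr (1 - p) * \<bar>f x\<bar> powr p + b powr (1 - p) * \<bar>g x\<bar> powr p) \<partial>M)"
    proof (rule integral_mono)
      fix x
      have "\<bar>(f + g) x\<bar> powr p \<le> (\<bar>f x\<bar> + \<bar>g x\<bar>) powr p"
        using p by (intro powr_mono2) auto
      also have "\<dots> \<le> (a + b) powr (p - 1) *
          (a powr (1 - p) * \<bar>f x\<bar> powr p + b powr (1 - p) * \<bar>g x\<bar> powr p)"
        using p ab by (intro powr_add_le_weighted) auto
      finally show "\<bar>(f + g) x\<bar> powr p \<le> (a + b) powr (p - 1) *
          (a powr (1 - p) * \<bar>f x\<bar> powr p + b powr (1 - p) * \<bar>g x\<bar> powr p)" .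
    qed (use int Lp_funsD(2)[OF add[OF fg]] in auto)
    also have "\<dots> = (a + b) powr (p - 1) *
        (a powr (1 - p) * (\<integral>x. \<bar>f x\<bar> powr p \<partial>M) + b powr (1 - p) * (\<integral>x. \<bar>g x\<bar> powr p \<partial>M))"
      using fg[THEN Lp_funsD(2)] by simp
    finally show "(\<integral>x. \<bar>(f + g) x\<bar> powr p \<partial>M) \<le> (a + b) powr (p - 1) *
        (a powr (1 - p) * (\<integral>x. \<bar>f x\<bar> powr p \<partial>M) + b powr (1 - p) * (\<integral>x. \<bar>g x\<bar> powr p \<partial>M))" .
  qed auto
qed

text \<open>
  The almost-everywhere classes are a presentation of the seminormed space of functions, so all
  statements about \<open>L\<^sub>p\<close> can be proved for functions.
\<close>

lemma presents_Lp:
  assumes p: "1 \<le> p"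
  shows "presents (Lp_funs p M) (Lp_norm p M) (Lp_class p M) (Lp p M)"
proof -
  interpret seminormed "Lp_funs p M" "Lp_norm p M" by (rule seminormed_Lp[OF p])
  have rep: "Lp_rep (Lp_class p M f) \<in> Lp_funs p M" "AE x in M. Lp_rep (Lp_class p M f) x = f x"
    if "f \<in> Lp_funs p M" for f
  proof -
    have "f \<in> Lp_class p M f" using that by (simp add: Lp_class_def)
    then have "Lp_rep (Lp_class p M f) \<in> Lp_class p M f" unfolding Lp_rep_def by (rule someI[of "\<lambda>h. h \<in> Lp_class p M f"])
    then show "Lp_rep (Lp_class p M f) \<in> Lp_funs p M" "AE x in M. Lp_rep (Lp_class p M f) x = f x"
      by (auto simp: Lp_class_def)
  qed
  have cong: "Lp_class p M f = Lp_class p M g" if "AE x in M. f x = g x" for f g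
  proof -
    have "(AE x in M. h x = f x) \<longleftrightarrow> (AE x in M. h x = g x)" for h
    proof
      assume "AE x in M. h x = f x"
      then show "AE x in M. h x = g x" using that by eventually_elim simp
    next
      assume "AE x in M. h x = g x"
      then show "AE x in M. h x = f x" using that by eventually_elim simp
    qed
    then show ?thesis by (simp add: Lp_class_def)
  qed
  have iff: "Lp_class p M f = Lp_class p M g \<longleftrightarrow> Lp_norm p M (f - g) = 0"
    if "f \<in> Lp_funs p M" "g \<in> Lp_funs p M" for f g
  proof
    assume "Lp_class p M f = Lp_class p M g"
    moreover have "f \<in> Lp_class p M f" using that by (simp add: Lp_class_def)
    ultimately have "AE x in M. f x = g x" by (simp add: Lp_class_def)
    then have "AE x in M. (f - g) x = 0" by (auto elim!: AE_mp intro!: AE_I2)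
    then show "Lp_norm p M (f - g) = 0" using Lp_norm_eq_0_iff[OF p mem_diff[OF that]] by simp
  next
    assume "Lp_norm p M (f - g) = 0"
    then have "AE x in M. (f - g) x = 0" using Lp_norm_eq_0_iff[OF p mem_diff[OF that]] by simp
    then show "Lp_class p M f = Lp_class p M g" by (intro cong) (auto elim!: AE_mp intro!: AE_I2)
  qed
  have vadd: "vadd (Lp p M) (Lp_class p M f) (Lp_class p M g) = Lp_class p M (f + g)"
    if "f \<in> Lp_funs p M" "g \<in> Lp_funs p M" for f g
  proof -
    have "AE x in M. Lp_rep (Lp_class p M f) x + Lp_rep (Lp_class p M g) x = (f + g) x"
      using rep(2)[OF that(1)] rep(2)[OF that(2)] by eventually_elim simp
    then show ?thesis by (simp add: Lp_def cong)
  qed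
  have vscale: "vscale (Lp p M) c (Lp_class p M f) = Lp_class p M (c *\<^sub>R f)"
    if "f \<in> Lp_funs p M" for c f
  proof -
    have "AE x in M. c * Lp_rep (Lp_class p M f) x = (c *\<^sub>R f) x"
      using rep(2)[OF that] by eventually_elim simp
    then show ?thesis by (simp add: Lp_def cong)
  qed
  have vnorm: "vnorm (Lp p M) (Lp_class p M f) = Lp_norm p M f" if "f \<in> Lp_funs p M" for f
    using Lp_norm_cong_AE[OF Lp_funsD(1)[OF rep(1)[OF that]] Lp_funsD(1)[OF that] rep(2)[OF that], of p]
    by (simp add: Lp_def Lp_norm_def)
  have "vcarrier (Lp p M) = Lp_class p M ` Lp_funs p M" "vzero (Lp p M) = Lp_class p M 0"
    by (simp_all add: Lp_def zero_fun_def)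
  then show ?thesis
    unfolding presents_def using iff vadd vscale vnorm by auto
qed

text \<open>
  The core of the Riesz--Fischer theorem: the partial sums of \<open>\<Sum> \<bar>u k\<bar>\<close> increase and have bounded
  norms by Minkowski's inequality, so monotone convergence makes their supremum finite almost everywhere.
\<close>

lemma Lp_suminf_abs:
  assumes p: "1 \<le> p" and u: "\<And>k. u k \<in> Lp_funs p M" and sum: "summable (\<lambda>k. Lp_norm p M (u k))"
  shows "AE x in M. summable (\<lambda>k. \<bar>u k x\<bar>)"
    and "(\<lambda>x. \<Sum>k. \<bar>u k x\<bar>) \<in> Lp_funs p M"
    and "Lp_norm p M (\<lambda>x. \<Sum>k. \<bar>u k x\<bar>) \<le> (\<Sum>k. Lp_norm p M (u k))"
proof -
  interpret seminormed "Lp_funs p M" "Lp_norm p M" by (rule seminormed_Lp[OF p])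
  note [measurable] = u[THEN Lp_funsD(1)]
  define S where "S = (\<Sum>k. Lp_norm p M (u k))"
  have S: "0 \<le> S" unfolding S_def using sum by (intro suminf_nonneg) (auto simp: Lp_norm_nonneg)
  define H where "H n = (\<Sum>k<n. (\<lambda>x. \<bar>u k x\<bar>))" for n
  have H_eq: "H n x = (\<Sum>k<n. \<bar>u k x\<bar>)" for n x by (simp add: H_def sum_fun_apply)
  have H_mem: "H n \<in> Lp_funs p M" for n
    unfolding H_def using u by (intro mem_sum Lp_funs_abs)
  note [measurable] = H_mem[THEN Lp_funsD(1)]
  have H_nonneg: "0 \<le> H n x" for n x by (simp add: H_eq sum_nonneg)
  have H_norm: "Lp_norm p M (H n) \<le> S" for n
  proof -
    have "Lp_norm p M (H n) \<le> (\<Sum>k<n. Lp_norm p M (\<lambda>x. \<bar>u k x\<bar>))"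
      unfolding H_def using u by (intro N_sum Lp_funs_abs)
    also have "\<dots> \<le> S"
      unfolding S_def Lp_norm_abs using sum by (intro sum_le_suminf) (auto simp: Lp_norm_nonneg)
    finally show ?thesis .
  qed
  define Hinf where "Hinf x = (SUP n. ennreal (H n x powr p))" for x
  have "(\<integral>\<^sup>+x. Hinf x \<partial>M) = (SUP n. \<integral>\<^sup>+x. ennreal (H n x powr p) \<partial>M)"
    unfolding Hinf_def
  proof (rule nn_integral_monotone_convergence_SUP)
    show "incseq (\<lambda>n x. ennreal (H n x powr p))"
      using p by (auto simp: incseq_def le_fun_def H_eq intro!: ennreal_leI powr_mono2 sum_mono2 sum_nonneg)
  qed simp
  also have "\<dots> \<le> ennreal (S powr p)"
  proof (rule SUP_least)
    fix n
    have "(\<integral>\<^sup>+x. ennreal (H n x powr p) \<partial>M) = ennreal (Lp_norm p M (H n) powr p)"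
      using nn_integral_Lp[OF p H_mem[of n]] by (simp add: abs_of_nonneg[OF H_nonneg])
    also have "\<dots> \<le> ennreal (S powr p)"
      using H_norm[of n] p by (intro ennreal_leI powr_mono2) (auto simp: Lp_norm_nonneg)
    finally show "(\<integral>\<^sup>+x. ennreal (H n x powr p) \<partial>M) \<le> ennreal (S powr p)" .
  qed
  finally have Hinf_int: "(\<integral>\<^sup>+x. Hinf x \<partial>M) \<le> ennreal (S powr p)" .
  have "Hinf \<in> borel_measurable M" unfolding Hinf_def by measurable
  then have fin: "AE x in M. Hinf x \<noteq> \<infinity>"
    using Hinf_int by (intro nn_integral_PInf_AE) (auto simp: top_unique)
  have summable: "summable (\<lambda>k. \<bar>u k x\<bar>)" if "Hinf x \<noteq> \<infinity>" for x
  proof (rule summableI_nonneg_bounded)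
    fix n
    have "ennreal (H n x powr p) \<le> Hinf x" unfolding Hinf_def by (rule SUP_upper) simp
    then have "H n x powr p \<le> enn2real (Hinf x)"
      using that by (metis enn2real_ennreal enn2real_mono infinity_ennreal_def powr_ge_zero top.not_eq_extremum)
    then have "(H n x powr p) powr (1 / p) \<le> enn2real (Hinf x) powr (1 / p)"
      using p by (intro powr_mono2) auto
    then show "(\<Sum>k<n. \<bar>u k x\<bar>) \<le> enn2real (Hinf x) powr (1 / p)"
      using p H_nonneg[of n x] by (simp add: powr_powr H_eq)
  qed simp
  show "AE x in M. summable (\<lambda>k. \<bar>u k x\<bar>)"
    using fin by eventually_elim (rule summable)
  let ?h = "\<lambda>x. \<Sum>k. \<bar>u k x\<bar>"
  have h_meas: "?h \<in> borel_measurable M" by measurable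
  have "AE x in M. ennreal (\<bar>?h x\<bar> powr p) \<le> Hinf x"
    using fin
  proof eventually_elim
    case (elim x)
    then have sx: "summable (\<lambda>k. \<bar>u k x\<bar>)" by (rule summable)
    then have "(\<lambda>n. H n x) \<longlonglongrightarrow> ?h x" unfolding H_eq by (rule summable_LIMSEQ)
    moreover have h0: "0 \<le> ?h x" using sx by (intro suminf_nonneg) auto
    ultimately have "(\<lambda>n. ennreal (H n x powr p)) \<longlonglongrightarrow> ennreal (?h x powr p)"
      using p by (intro tendsto_ennrealI tendsto_powr') (auto simp: H_nonneg)
    then have "ennreal (?h x powr p) \<le> Hinf x"
      by (rule LIMSEQ_le_const2) (auto simp: Hinf_def intro!: SUP_upper exI[of _ 0])
    then show ?case using h0 by simp
  qed
  then have "(\<integral>\<^sup>+x. ennreal (\<bar>?h x\<bar> powr p) \<partial>M) \<le> (\<integral>\<^sup>+x. Hinf x \<partial>M)"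
    by (rule nn_integral_mono_AE)
  then have "(\<integral>\<^sup>+x. ennreal (\<bar>?h x\<bar> powr p) \<partial>M) \<le> ennreal (S powr p)"
    using Hinf_int by (rule order_trans)
  from Lp_funsI_nn_integral[OF p h_meas S this]
  show "?h \<in> Lp_funs p M" "Lp_norm p M ?h \<le> (\<Sum>k. Lp_norm p M (u k))" by (simp_all add: S_def)
qed

lemma Lp_suminf_tail:
  assumes p: "1 \<le> p" and u: "\<And>k. u k \<in> Lp_funs p M" and sum: "summable (\<lambda>k. Lp_norm p M (u k))"
  shows "(\<lambda>x. \<Sum>k. u k x) \<in> Lp_funs p M"
    and "Lp_norm p M ((\<lambda>x. \<Sum>k. u k x) - (\<Sum>k<n. u k)) \<le> (\<Sum>k. Lp_norm p M (u (k + n)))"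
proof -
  interpret seminormed "Lp_funs p M" "Lp_norm p M" by (rule seminormed_Lp[OF p])
  note [measurable] = u[THEN Lp_funsD(1)]
  note A = Lp_suminf_abs[OF p u sum]
  have meas: "(\<lambda>x. \<Sum>k. u k x) \<in> borel_measurable M" by measurable
  have "AE x in M. \<bar>\<Sum>k. u k x\<bar> \<le> \<bar>\<Sum>k. \<bar>u k x\<bar>\<bar>"
    using A(1)
  proof eventually_elim
    case (elim x)
    then show ?case using summable_rabs[of "\<lambda>k. u k x"] by linarith
  qed
  from Lp_dominated(1)[OF p meas A(2) this] show mem: "(\<lambda>x. \<Sum>k. u k x) \<in> Lp_funs p M" .
  have sum': "summable (\<lambda>k. Lp_norm p M (u (k + n)))" using sum by (rule summable_ignore_initial_segment)
  note B = Lp_suminf_abs[OF p, of "\<lambda>k. u (k + n)", OF u sum']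
  have "AE x in M. \<bar>((\<lambda>x. \<Sum>k. u k x) - (\<Sum>k<n. u k)) x\<bar> \<le> \<bar>\<Sum>k. \<bar>u (k + n) x\<bar>\<bar>"
    using A(1) B(1)
  proof eventually_elim
    case (elim x)
    have "summable (\<lambda>k. u k x)" using elim(1) by (rule summable_rabs_cancel)
    then have "((\<lambda>x. \<Sum>k. u k x) - (\<Sum>k<n. u k)) x = (\<Sum>k. u (k + n) x)"
      using suminf_minus_initial_segment[of "\<lambda>k. u k x" n] by (simp add: sum_fun_apply)
    then show ?case using summable_rabs[OF elim(2)] by linarith
  qed
  from Lp_dominated(2)[OF p Lp_funsD(1)[OF mem_diff[OF mem mem_sum]] B(2) this]
  have "Lp_norm p M ((\<lambda>x. \<Sum>k. u k x) - (\<Sum>k<n. u k)) \<le> Lp_norm p M (\<lambda>x. \<Sum>k. \<bar>u (k + n) x\<bar>)"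
    using u by blast
  with B(3) show "Lp_norm p M ((\<lambda>x. \<Sum>k. u k x) - (\<Sum>k<n. u k)) \<le> (\<Sum>k. Lp_norm p M (u (k + n)))"
    by linarith
qed

lemma complete_Lp:
  assumes p: "1 \<le> p"
  shows "complete_in (Lp_funs p M) (Lp_norm p M)"
  unfolding complete_in_def
proof (intro allI impI)
  interpret seminormed "Lp_funs p M" "Lp_norm p M" by (rule seminormed_Lp[OF p])
  fix f :: "nat \<Rightarrow> 'a \<Rightarrow> real"
  assume "range f \<subseteq> Lp_funs p M" and cauchy: "cauchy_in (Lp_norm p M) f"
  then have f: "f n \<in> Lp_funs p M" for n by auto
  have "\<exists>K. \<forall>m\<ge>K. \<forall>n\<ge>K. Lp_norm p M (f m - f n) < (1 / 2) ^ k" for k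
    using cauchy unfolding cauchy_in_def by simp
  then obtain K where K: "\<And>k m n. m \<ge> K k \<Longrightarrow> n \<ge> K k \<Longrightarrow> Lp_norm p M (f m - f n) < (1 / 2) ^ k"
    by metis
  \<comment> \<open>A subsequence along which consecutive distances are below \<open>2\<^sup>-\<^sup>k\<close>.\<close>
  define r where "r k = (\<Sum>j\<le>k. K j)" for k
  have r: "K k \<le> r k" "r k \<le> r (Suc k)" for k
    unfolding r_def by (auto intro: member_le_sum)
  define u where "u k = f (r (Suc k)) - f (r k)" for k
  have u_mem: "u k \<in> Lp_funs p M" for k unfolding u_def by (intro mem_diff f)
  have u_le: "Lp_norm p M (u k) \<le> (1 / 2) ^ k" for k
    using K[of k "r (Suc k)" "r k"] r[of k] by (simp add: u_def less_imp_le)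
  have geo: "summable (\<lambda>k. (1 / 2 :: real) ^ k)" by (rule summable_geometric) simp
  have sum: "summable (\<lambda>k. Lp_norm p M (u k))"
    by (rule summable_comparison_test'[OF geo, of 0]) (simp add: u_le Lp_norm_nonneg)
  note tail = Lp_suminf_tail[OF p u_mem sum]
  have tail_le: "(\<Sum>k. Lp_norm p M (u (k + n))) \<le> 2 * (1 / 2) ^ n" for n
  proof -
    have "(\<Sum>k. Lp_norm p M (u (k + n))) \<le> (\<Sum>k. (1 / 2) ^ n * (1 / 2) ^ k)"
    proof (rule suminf_le)
      show "Lp_norm p M (u (k + n)) \<le> (1 / 2) ^ n * (1 / 2) ^ k" for k
        using u_le[of "k + n"] by (simp add: power_add mult.commute)
    qed (use sum geo in \<open>auto intro: summable_ignore_initial_segment\<close>)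
    also have "\<dots> = 2 * (1 / 2) ^ n"
      using geo by (subst suminf_mult) (auto simp: suminf_geometric)
    finally show ?thesis .
  qed
  define l where "l = f (r 0) + (\<lambda>x. \<Sum>k. u k x)"
  have l_mem: "l \<in> Lp_funs p M" unfolding l_def by (intro mem_add f tail(1))
  have telescope: "(\<Sum>k<n. u k) = f (r n) - f (r 0)" for n
    by (induction n) (auto simp: u_def)
  have near: "Lp_norm p M (f (r n) - l) \<le> 2 * (1 / 2) ^ n" for n
  proof -
    have "l - f (r n) = (\<lambda>x. \<Sum>k. u k x) - (\<Sum>k<n. u k)"
      by (simp add: l_def telescope)
    then show ?thesis
      using tail(2)[of n] tail_le[of n] N_commute[OF f l_mem, of "r n"] by simp
  qed
  have "(\<lambda>n. Lp_norm p M (f n - l)) \<longlonglongrightarrow> 0"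
    unfolding LIMSEQ_iff
  proof (intro allI impI)
    fix e :: real assume "0 < e"
    then have "0 < e / 3" by simp
    then obtain k where k: "(1 / 2 :: real) ^ k < e / 3"
      using real_arch_pow_inv[of "e / 3" "1 / 2"] by auto
    have "norm (Lp_norm p M (f n - l) - 0) < e" if "n \<ge> r k" for n
    proof -
      have "Lp_norm p M (f n - l) \<le> Lp_norm p M (f n - f (r k)) + Lp_norm p M (f (r k) - l)"
        by (intro N_diff_triangle f l_mem)
      also have "\<dots> < e"
        using K[of k n "r k"] r(1)[of k] that near[of k] k by simp
      finally show ?thesis by (simp add: Lp_norm_nonneg)
    qed
    then show "\<exists>no. \<forall>n\<ge>no. norm (Lp_norm p M (f n - l) - 0) < e" by blast
  qed
  then show "\<exists>l\<in>Lp_funs p M. (\<lambda>n. Lp_norm p M (f n - l)) \<longlonglongrightarrow> 0"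
    using l_mem by blast
qed

section \<open>Separable spaces as spaces of points\<close>

lemma (in seminormed) countable_dense_in_span:
  assumes B: "countable B" "B \<subseteq> Z"
  shows "\<exists>D. countable D \<and> D \<noteq> {} \<and> D \<subseteq> span B \<and> (\<forall>w\<in>span B. \<forall>e>0. \<exists>d\<in>D. N (w - d) < e)"
proof (intro exI conjI ballI)
  let ?c = "\<lambda>xs. \<Sum>(r, b)\<leftarrow>xs. r *\<^sub>R b"
  let ?D = "?c ` lists (\<rat> \<times> B)"
  show "countable ?D" using B countable_rat by (intro countable_image countable_lists) auto
  show "?D \<noteq> {}" by auto
  have sub: "?c xs \<in> span B" if "xs \<in> lists (\<rat> \<times> B)" for xs
    using that by (induction xs) (auto intro!: span_add span_scale simp: span_zero intro: span_base)
  then show "?D \<subseteq> span B" by blast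
  have span: "span B \<subseteq> Z" using B(2) subspace by (rule span_minimal)
  fix w assume "w \<in> span B"
  then have "w \<in> Z \<and> (\<forall>e>0. \<exists>d\<in>?D. N (w - d) < e)"
  proof (induction rule: span_induct_alt)
    case base
    then show ?case by (auto simp: N_0 mem_0 intro!: bexI[of _ "[]"])
  next
    case (step c b w)
    show ?case
    proof (intro allI impI conjI)
      show "c *\<^sub>R b + w \<in> Z" using step B(2) by (intro mem_add mem_scale) auto
      fix e :: real assume "0 < e"
      then have "0 < e / 2" by simp
      then obtain xs where xs: "xs \<in> lists (\<rat> \<times> B)" "N (w - ?c xs) < e / 2" using step.IH by blast
      have bZ: "b \<in> Z" using step(1) B by auto
      have "0 < e / (2 * (N b + 1))" using \<open>0 < e\<close> N_nonneg[OF bZ] by simp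
      then obtain r where r: "r \<in> \<rat>" "\<bar>c - r\<bar> < e / (2 * (N b + 1))"
        using Rats_dense_in_real[of c "c + e / (2 * (N b + 1))"] by (auto simp: abs_real_def)
      have wZ: "w - ?c xs \<in> Z" using step.IH sub[OF xs(1)] span by (intro mem_diff) auto
      have "c *\<^sub>R b + w - ?c ((r, b) # xs) = (c - r) *\<^sub>R b + (w - ?c xs)"
        by (simp add: algebra_simps)
      then have "N (c *\<^sub>R b + w - ?c ((r, b) # xs)) \<le> N ((c - r) *\<^sub>R b) + N (w - ?c xs)"
        using bZ wZ by (simp only:) (intro N_triangle mem_scale)
      also have "N ((c - r) *\<^sub>R b) = \<bar>c - r\<bar> * N b" by (rule N_scale[OF bZ])
      also have "\<dots> \<le> e / (2 * (N b + 1)) * (N b + 1)"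
        using r N_nonneg[OF bZ] by (intro mult_mono) auto
      also have "\<dots> = e / 2" using N_nonneg[OF bZ] by (simp add: field_simps)
      finally have "N (c *\<^sub>R b + w - ?c ((r, b) # xs)) < e" using xs by simp
      moreover have "(r, b) # xs \<in> lists (\<rat> \<times> B)" using r xs step(1) by auto
      ultimately show "\<exists>d\<in>?D. N (c *\<^sub>R b + w - d) < e" by blast
    qed
  qed
  then show "\<forall>e>0. \<exists>d\<in>?D. N (w - d) < e" by blast
qed

text \<open>
  A separable space embeds into the type of points by sending a vector to its distances to a countable
  dense set: vectors with the same distances are arbitrarily close to a common point. The singleton
  only serves to turn a function into a point.
\<close>

lemma (in seminormed) presents_as_points:
  assumes D: "countable D" "D \<noteq> {}" "D \<subseteq> Z" and dense: "\<And>z e. z \<in> Z \<Longrightarrow> 0 < e \<Longrightarrow> \<exists>d\<in>D. N (z - d) < e"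
  shows "\<exists>(\<kappa> :: 'v \<Rightarrow> point) Y. presents Z N \<kappa> Y"
proof -
  define d where "d j = from_nat_into D j" for j
  have d: "d j \<in> Z" for j using from_nat_into[OF D(2)] D(3) by (auto simp: d_def)
  define \<kappa> :: "'v \<Rightarrow> point" where "\<kappa> z = {\<lambda>t. N (z - d (nat \<lfloor>t\<rfloor>))}" for z
  have "\<kappa> x = \<kappa> y \<longleftrightarrow> N (x - y) = 0" if xy: "x \<in> Z" "y \<in> Z" for x y
  proof
    assume eq: "\<kappa> x = \<kappa> y"
    have dist: "N (x - d j) = N (y - d j)" for j
      using eq[unfolded \<kappa>_def singleton_inject fun_eq_iff] by (auto dest!: spec[of _ "real j"] simp: \<kappa>_def fun_eq_iff)
    have "N (x - y) \<le> e" if "0 < e" for e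
    proof -
      obtain z where z: "z \<in> D" "N (x - z) < e / 2" using dense[OF xy(1) half_gt_zero[OF \<open>0 < e\<close>]] by blast
      then obtain j where j: "z = d j" using from_nat_into_surj[OF D(1)] unfolding d_def by metis
      have "N (x - y) \<le> N (x - d j) + N (d j - y)" by (intro N_diff_triangle xy d)
      then show ?thesis using z j dist[of j] N_commute[OF d xy(2), of j] by simp
    qed
    then have "N (x - y) \<le> 0" by (rule field_le_epsilon[of _ 0, simplified])
    then show "N (x - y) = 0" using N_nonneg[OF mem_diff[OF xy]] by simp
  next
    assume "N (x - y) = 0"
    moreover have "\<bar>N (x - d j) - N (y - d j)\<bar> \<le> N (x - y)" for j
      using abs_N_diff_le[OF mem_diff[OF xy(1) d] mem_diff[OF xy(2) d], of j j] by simp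
    ultimately have "N (x - d j) = N (y - d j)" for j by (metis abs_le_zero_iff right_minus_eq)
    then show "\<kappa> x = \<kappa> y" by (simp add: \<kappa>_def)
  qed
  then show ?thesis using presents_image_space by blast
qed

section \<open>Finite representability in sequence spaces\<close>

lemma finite_support_ell_p:
  fixes x :: "nat \<Rightarrow> 'x::real_normed_vector"
  assumes "\<And>i. i \<ge> L \<Longrightarrow> x i = 0"
  shows "x \<in> vcarrier (ell_p p)" and "vnorm (ell_p p) x = (\<Sum>i<L. norm (x i) powr p) powr (1 / p)"
proof -
  have "(\<lambda>i. norm (x i) powr p) sums (\<Sum>i<L. norm (x i) powr p)"
    using assms by (intro sums_finite) auto
  then show "x \<in> vcarrier (ell_p p)" "vnorm (ell_p p) x = (\<Sum>i<L. norm (x i) powr p) powr (1 / p)"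
    by (auto simp: ell_p_def sums_iff)
qed

text \<open>
  Compactness of the cube \<open>[-1,1]\<^sup>A\<close>, for finite \<open>A\<close>.
\<close>

lemma finite_family_convergent_subseq:
  fixes c :: "nat \<Rightarrow> 'i \<Rightarrow> real"
  assumes "finite A" and "\<And>k b. b \<in> A \<Longrightarrow> \<bar>c k b\<bar> \<le> 1"
  shows "\<exists>r d. strict_mono r \<and> (\<forall>b\<in>A. (\<lambda>k. c (r k) b) \<longlonglongrightarrow> d b)"
  using assms
proof (induction A)
  case empty
  show ?case using strict_mono_id by auto
next
  case (insert a A)
  then obtain r d where r: "strict_mono r" "\<forall>b\<in>A. (\<lambda>k. c (r k) b) \<longlonglongrightarrow> d b" by blast
  have "\<forall>k. c (r k) a \<in> {-1..1}" using insert.prems[of a] by (auto simp: abs_le_iff)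
  then obtain l s where s: "strict_mono s" "((\<lambda>k. c (r k) a) \<circ> s) \<longlonglongrightarrow> l"
    using compact_Icc[of "-1 :: real" 1] unfolding compact_def by metis
  have "(\<lambda>k. c (r (s k)) b) \<longlonglongrightarrow> (d(a := l)) b" if "b \<in> insert a A" for b
  proof (cases "b = a")
    case True
    then show ?thesis using s(2) by (simp add: o_def)
  next
    case False
    then have "((\<lambda>k. c (r k) b) \<circ> s) \<longlonglongrightarrow> d b"
      using r(2) that s(1) by (intro LIMSEQ_subseq_LIMSEQ) auto
    then show ?thesis using False by (simp add: o_def)
  qed
  moreover have "strict_mono (\<lambda>k. r (s k))"
    using strict_mono_o[OF r(1) s(1)] by (simp add: o_def)
  ultimately show ?case by blast
qed

context seminormed
begin

text \<open>
  On the compact boundary of the unit cube of coefficients, a continuous function without zeros is bounded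
  away from \<open>0\<close>.
\<close>

lemma combination_lower_bound:
  assumes A: "finite A" "A \<subseteq> Z"
    and indep: "\<And>c. N (\<Sum>b\<in>A. c b *\<^sub>R b) = 0 \<Longrightarrow> (\<forall>b\<in>A. c b = 0)"
  shows "\<exists>\<eta>>0. \<forall>c. (\<forall>b\<in>A. \<bar>c b\<bar> \<le> 1) \<longrightarrow> (\<exists>b\<in>A. \<bar>c b\<bar> = 1) \<longrightarrow> \<eta> \<le> N (\<Sum>b\<in>A. c b *\<^sub>R b)"
proof (rule ccontr)
  assume contra: "\<not> ?thesis"
  have "\<exists>c. (\<forall>b\<in>A. \<bar>c b\<bar> \<le> 1) \<and> (\<exists>b\<in>A. \<bar>c b\<bar> = 1) \<and> N (\<Sum>b\<in>A. c b *\<^sub>R b) < inverse (real (Suc k))"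
    for k
  proof -
    have "inverse (real (Suc k)) > 0" by simp
    then show ?thesis using contra by (meson not_less)
  qed
  then obtain c where c: "\<And>k b. b \<in> A \<Longrightarrow> \<bar>c k b\<bar> \<le> 1" "\<And>k. \<exists>b\<in>A. \<bar>c k b\<bar> = 1"
      "\<And>k. N (\<Sum>b\<in>A. c k b *\<^sub>R b) < inverse (real (Suc k))"
    by metis
  obtain r d where r: "strict_mono r" and d: "\<And>b. b \<in> A \<Longrightarrow> (\<lambda>k. c (r k) b) \<longlonglongrightarrow> d b"
    using finite_family_convergent_subseq[OF A(1), of c] c(1) by blast
  have mem: "(\<Sum>b\<in>A. e b *\<^sub>R b) \<in> Z" for e using A by (intro mem_sum mem_scale) auto
  have bound: "N (\<Sum>b\<in>A. d b *\<^sub>R b) \<le> inverse (real (Suc (r k))) + (\<Sum>b\<in>A. \<bar>d b - c (r k) b\<bar> * N b)" for k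
  proof -
    have eq: "(\<Sum>b\<in>A. d b *\<^sub>R b) - (\<Sum>b\<in>A. c (r k) b *\<^sub>R b) = (\<Sum>b\<in>A. (d b - c (r k) b) *\<^sub>R b)"
      by (simp add: scaleR_diff_left sum_subtractf)
    have "N (\<Sum>b\<in>A. (d b - c (r k) b) *\<^sub>R b) \<le> (\<Sum>b\<in>A. N ((d b - c (r k) b) *\<^sub>R b))"
      using A by (intro N_sum mem_scale) auto
    also have "\<dots> = (\<Sum>b\<in>A. \<bar>d b - c (r k) b\<bar> * N b)"
      using A by (intro sum.cong refl N_scale) auto
    finally show ?thesis
      using abs_N_diff_le[OF mem mem, of d "c (r k)"] c(3)[of "r k"] unfolding eq by linarith
  qed
  have "(\<lambda>k. inverse (real (Suc (r k))) + (\<Sum>b\<in>A. \<bar>d b - c (r k) b\<bar> * N b)) \<longlonglongrightarrow>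
      0 + (\<Sum>b\<in>A. \<bar>d b - d b\<bar> * N b)"
  proof (intro tendsto_add tendsto_sum tendsto_mult tendsto_rabs tendsto_diff tendsto_const d)
    show "(\<lambda>k. inverse (real (Suc (r k)))) \<longlonglongrightarrow> 0"
      using LIMSEQ_subseq_LIMSEQ[OF LIMSEQ_inverse_real_of_nat r] by (simp add: o_def)
  qed
  then have "N (\<Sum>b\<in>A. d b *\<^sub>R b) \<le> 0 + (\<Sum>b\<in>A. \<bar>d b - d b\<bar> * N b)"
    by (rule LIMSEQ_le_const) (use bound in auto)
  then have "N (\<Sum>b\<in>A. d b *\<^sub>R b) = 0" using N_nonneg[OF mem[of d]] by simp
  then have d0: "d b = 0" if "b \<in> A" for b using indep that by blast
  have "(\<lambda>k. \<Sum>b\<in>A. \<bar>c (r k) b\<bar>) \<longlonglongrightarrow> (\<Sum>b\<in>A. \<bar>d b\<bar>)"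
    by (intro tendsto_sum tendsto_rabs d)
  moreover have "1 \<le> (\<Sum>b\<in>A. \<bar>c (r k) b\<bar>)" for k
  proof -
    obtain b where "b \<in> A" "\<bar>c (r k) b\<bar> = 1" using c(2) by blast
    then show ?thesis using member_le_sum[of b A "\<lambda>b. \<bar>c (r k) b\<bar>"] A(1) by simp
  qed
  ultimately have "1 \<le> (\<Sum>b\<in>A. \<bar>d b\<bar>)" by (intro LIMSEQ_le_const) auto
  then show False using d0 by simp
qed

text \<open>
  A spanning set of least cardinality has only trivial null combinations, since otherwise one of its
  members could be dropped.
\<close>

lemma finite_dim_basis:
  assumes pres: "presents Z N \<kappa> Y" and F: "finite_dim_subspace Y F"
  shows "\<exists>A. finite A \<and> A \<subseteq> Z \<and> F \<subseteq> range (\<lambda>c. \<kappa> (\<Sum>b\<in>A. c b *\<^sub>R b)) \<and>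
           (\<forall>c. N (\<Sum>b\<in>A. c b *\<^sub>R b) = 0 \<longrightarrow> (\<forall>b\<in>A. c b = 0))"
proof -
  note K = presentsD[OF pres]
  define good where "good A \<longleftrightarrow> finite A \<and> A \<subseteq> Z \<and> F \<subseteq> range (\<lambda>c. \<kappa> (\<Sum>b\<in>A. c b *\<^sub>R b))" for A
  have mem: "(\<Sum>b\<in>A. c b *\<^sub>R b) \<in> Z" if "A \<subseteq> Z" for A c
    using that by (intro mem_sum mem_scale) auto
  have "\<exists>A. good A"
  proof -
    obtain B where B: "finite B" "B \<subseteq> vcarrier Y" "F = vspan Y B"
      using F by (auto simp: finite_dim_subspace_def)
    define A where "A = inv_into Z \<kappa> ` B"
    have inv: "inv_into Z \<kappa> y \<in> Z" "\<kappa> (inv_into Z \<kappa> y) = y" if "y \<in> B" for y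
      using that B(2) K(1) by (auto intro: inv_into_into f_inv_into_f)
    have A: "finite A" "A \<subseteq> Z" using B inv by (auto simp: A_def)
    let ?E = "range (\<lambda>c. \<kappa> (\<Sum>b\<in>A. c b *\<^sub>R b))"
    have "vsubspace Y ?E"
      unfolding vsubspace_def
    proof (intro conjI ballI allI)
      show "?E \<subseteq> vcarrier Y" using mem[OF A(2)] by (auto simp: K(1))
      show "vzero Y \<in> ?E" by (auto simp: K(5) intro!: image_eqI[of _ _ "\<lambda>b. 0"])
    next
      fix x y assume "x \<in> ?E" "y \<in> ?E"
      then obtain c d where cd: "x = \<kappa> (\<Sum>b\<in>A. c b *\<^sub>R b)" "y = \<kappa> (\<Sum>b\<in>A. d b *\<^sub>R b)" by auto
      have "vadd Y x y = \<kappa> (\<Sum>b\<in>A. (c b + d b) *\<^sub>R b)"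
        unfolding cd by (simp add: K(3) mem[OF A(2)] scaleR_add_left sum.distrib)
      then show "vadd Y x y \<in> ?E" by auto
    next
      fix a x assume "x \<in> ?E"
      then obtain c where c: "x = \<kappa> (\<Sum>b\<in>A. c b *\<^sub>R b)" by auto
      have "vscale Y a x = \<kappa> (\<Sum>b\<in>A. (a * c b) *\<^sub>R b)"
        unfolding c by (simp add: K(4) mem[OF A(2)] scaleR_sum_right)
      then show "vscale Y a x \<in> ?E" by auto
    qed
    moreover have "B \<subseteq> ?E"
    proof
      fix y assume y: "y \<in> B"
      have "(\<Sum>b\<in>A. (if b = inv_into Z \<kappa> y then 1 else 0) *\<^sub>R b) = inv_into Z \<kappa> y"
      proof -
        have "(\<Sum>b\<in>A. (if b = inv_into Z \<kappa> y then 1 else 0) *\<^sub>R b) =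
            (\<Sum>b\<in>A. if b = inv_into Z \<kappa> y then b else 0)"
          by (intro sum.cong) auto
        then show ?thesis using y A(1) by (simp add: A_def)
      qed
      then show "y \<in> ?E" using inv(2)[OF y]
        by (intro range_eqI[of _ _ "\<lambda>b. if b = inv_into Z \<kappa> y then 1 else 0"]) simp
    qed
    ultimately have "F \<subseteq> ?E" unfolding B(3) vspan_def by blast
    then show ?thesis using A by (auto simp: good_def)
  qed
  then obtain A where A: "good A" and min: "\<And>A'. good A' \<Longrightarrow> card A \<le> card A'"
    using ex_has_least_nat[of good _ card] by blast
  have "\<forall>b\<in>A. c b = 0" if null: "N (\<Sum>b\<in>A. c b *\<^sub>R b) = 0" for c
  proof (rule ccontr)
    assume "\<not> (\<forall>b\<in>A. c b = 0)"
    then obtain a where a: "a \<in> A" "c a \<noteq> 0" by blast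
    have fin: "finite A" and AZ: "A \<subseteq> Z" and FA: "F \<subseteq> range (\<lambda>c. \<kappa> (\<Sum>b\<in>A. c b *\<^sub>R b))"
      using A by (auto simp: good_def)
    have "\<kappa> (\<Sum>b\<in>A. d b *\<^sub>R b) = \<kappa> (\<Sum>b\<in>A - {a}. (d b - d a / c a * c b) *\<^sub>R b)" for d
    proof -
      have drop: "(\<Sum>b\<in>A. (d b - d a / c a * c b) *\<^sub>R b) = (\<Sum>b\<in>A - {a}. (d b - d a / c a * c b) *\<^sub>R b)"
        using a fin by (subst sum.remove[of _ a]) auto
      have "(\<Sum>b\<in>A. d b *\<^sub>R b) - (\<Sum>b\<in>A - {a}. (d b - d a / c a * c b) *\<^sub>R b)
          = (d a / c a) *\<^sub>R (\<Sum>b\<in>A. c b *\<^sub>R b)"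
        unfolding drop[symmetric] by (simp add: scaleR_diff_left sum_subtractf scaleR_sum_right)
      then have "N ((\<Sum>b\<in>A. d b *\<^sub>R b) - (\<Sum>b\<in>A - {a}. (d b - d a / c a * c b) *\<^sub>R b)) = 0"
        using N_scale[OF mem[OF AZ], of "d a / c a" c] null by simp
      moreover have "A - {a} \<subseteq> Z" using AZ by auto
      ultimately show ?thesis 
        using K(2)[OF mem[OF AZ, of d] mem[of "A - {a}" "\<lambda>b. d b - d a / c a * c b"]] by simp
    qed
    then have "range (\<lambda>c. \<kappa> (\<Sum>b\<in>A. c b *\<^sub>R b)) \<subseteq> range (\<lambda>c. \<kappa> (\<Sum>b\<in>A - {a}. c b *\<^sub>R b))"
      by (intro subsetI) auto
    then have "good (A - {a})" using fin AZ FA by (auto simp: good_def)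
    from min[OF this] show False using a(1) fin by (metis card_Diff1_less not_le)
  qed
  then show ?thesis using A by (auto simp: good_def)
qed

text \<open>
  It suffices to imitate finitely many vectors: a uniform error \<open>\<theta> \<eta>\<close> on the unit cube of coefficients is a
  relative error \<open>\<theta>\<close> on its boundary, where the norm is at least \<open>\<eta>\<close>, and homogeneity extends this to
  all combinations. Images of finite support keep questions of convergence away.
\<close>

theorem finitely_representable_ell_p:
  fixes Y :: "'a nspace"
  assumes pres: "presents Z N \<kappa> Y"
    and approx: "\<And>B \<delta>. finite B \<Longrightarrow> B \<subseteq> Z \<Longrightarrow> 0 < \<delta> \<Longrightarrow>
      \<exists>(\<phi> :: 'v \<Rightarrow> nat \<Rightarrow> 'x::real_normed_vector) L. (\<forall>b\<in>B. \<forall>i\<ge>L. \<phi> b i = 0) \<and>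
        (\<forall>c. (\<forall>b\<in>B. \<bar>c b\<bar> \<le> 1) \<longrightarrow>
          \<bar>vnorm (ell_p p) (\<Sum>b\<in>B. c b *\<^sub>R \<phi> b) - N (\<Sum>b\<in>B. c b *\<^sub>R b)\<bar> \<le> \<delta>)"
    and p: "1 \<le> p"
  shows "finitely_representable Y (ell_p p :: (nat \<Rightarrow> 'x) nspace)"
  unfolding finitely_representable_def
proof (intro allI impI)
  note K = presentsD[OF pres]
  fix \<epsilon> :: real and F assume \<epsilon>: "0 < \<epsilon>" and F: "finite_dim_subspace Y F"
  obtain A where A: "finite A" "A \<subseteq> Z" and FA: "F \<subseteq> range (\<lambda>c. \<kappa> (\<Sum>b\<in>A. c b *\<^sub>R b))"
    and indep: "\<And>c. N (\<Sum>b\<in>A. c b *\<^sub>R b) = 0 \<Longrightarrow> (\<forall>b\<in>A. c b = 0)"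
    using finite_dim_basis[OF pres F] by blast
  let ?c = "\<lambda>c. \<Sum>b\<in>A. c b *\<^sub>R b"
  have mem: "?c c \<in> Z" for c using A by (intro mem_sum mem_scale) auto
  obtain \<eta> where \<eta>: "0 < \<eta>"
      "\<And>c. (\<And>b. b \<in> A \<Longrightarrow> \<bar>c b\<bar> \<le> 1) \<Longrightarrow> (\<exists>b\<in>A. \<bar>c b\<bar> = 1) \<Longrightarrow> \<eta> \<le> N (?c c)"
    using combination_lower_bound[OF A indep] by blast
  \<comment> \<open>Chosen such that \<open>(1 + \<theta>) / (1 - \<theta>) = 1 + \<epsilon>\<close>; the factor \<open>s = 1 / (1 - \<theta>)\<close> makes the lower bound exact.\<close>
  define \<theta> where "\<theta> = \<epsilon> / (2 + \<epsilon>)"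
  define s where "s = (2 + \<epsilon>) / 2"
  have \<theta>: "0 < \<theta>" and s: "0 < s" "s * (1 - \<theta>) = 1" "s * (1 + \<theta>) = 1 + \<epsilon>"
    using \<epsilon> by (auto simp: \<theta>_def s_def field_simps)
  have "0 < \<theta> * \<eta>" using \<theta> \<eta>(1) by simp
  from approx[OF A this] obtain \<phi> :: "'v \<Rightarrow> nat \<Rightarrow> 'x" and L
    where \<phi>: "\<forall>b\<in>A. \<forall>i\<ge>L. \<phi> b i = 0"
      and \<phi>_approx: "\<forall>c. (\<forall>b\<in>A. \<bar>c b\<bar> \<le> 1) \<longrightarrow>
        \<bar>vnorm (ell_p p) (\<Sum>b\<in>A. c b *\<^sub>R \<phi> b) - N (?c c)\<bar> \<le> \<theta> * \<eta>"
    by (elim exE conjE)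
  let ?f = "\<lambda>c. \<Sum>b\<in>A. c b *\<^sub>R \<phi> b"
  have f0: "?f c i = 0" if "i \<ge> L" for c i using \<phi> that by (simp add: sum_fun_apply)
  define T where "T y = s *\<^sub>R ?f (SOME c. y = \<kappa> (?c c))" for y
  have T: "T (\<kappa> (?c c)) = s *\<^sub>R ?f c" for c
  proof -
    let ?d = "SOME d. \<kappa> (?c c) = \<kappa> (?c d)"
    have "\<kappa> (?c c) = \<kappa> (?c ?d)" by (rule someI[of "\<lambda>d. \<kappa> (?c c) = \<kappa> (?c d)"]) simp
    then have "N (?c c - ?c ?d) = 0" using K(2)[OF mem mem] by blast
    then have "N (?c (\<lambda>b. c b - ?d b)) = 0" by (simp add: scaleR_diff_left sum_subtractf)
    then have "c b = ?d b" if "b \<in> A" for b using indep[of "\<lambda>b. c b - ?d b"] that by simp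
    then have "?f c = ?f ?d" by (intro sum.cong) auto
    then show ?thesis by (simp add: T_def)
  qed
  have scale: "vnorm (ell_p p) (a *\<^sub>R x) = \<bar>a\<bar> * vnorm (ell_p p) x"
    if x: "\<And>i. i \<ge> L \<Longrightarrow> x i = 0" for a and x :: "nat \<Rightarrow> 'x"
  proof -
    have "(\<Sum>i<L. norm ((a *\<^sub>R x) i) powr p) = \<bar>a\<bar> powr p * (\<Sum>i<L. norm (x i) powr p)"
      by (simp add: powr_mult sum_distrib_left)
    then show ?thesis
      using finite_support_ell_p(2)[of L x p] finite_support_ell_p(2)[of L "a *\<^sub>R x" p] x p
      by (simp add: powr_mult powr_powr sum_nonneg)
  qed
  have norm_T: "N (?c c) \<le> vnorm (ell_p p) (s *\<^sub>R ?f c) \<and>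
      vnorm (ell_p p) (s *\<^sub>R ?f c) \<le> (1 + \<epsilon>) * N (?c c)" for c
  proof (cases "\<forall>b\<in>A. c b = 0")
    case True
    then have "?f c = 0" "?c c = 0" by simp_all
    then show ?thesis using scale[of "0 :: nat \<Rightarrow> 'x" 0] by (simp add: N_0)
  next
    case False
    then have "A \<noteq> {}" by auto
    define M where "M = Max ((\<lambda>b. \<bar>c b\<bar>) ` A)"
    have M_ge: "\<bar>c b\<bar> \<le> M" if "b \<in> A" for b using that A(1) by (simp add: M_def)
    have "M \<in> (\<lambda>b. \<bar>c b\<bar>) ` A" unfolding M_def using A(1) \<open>A \<noteq> {}\<close> by (intro Max_in) auto
    then obtain a where a: "a \<in> A" "M = \<bar>c a\<bar>" by blast
    have M: "0 < M" using False M_ge by (force simp: not_le intro: less_le_trans)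
    define c' where "c' b = c b / M" for b
    have c': "\<bar>c' b\<bar> \<le> 1" if "b \<in> A" for b using M_ge[OF that] M by (simp add: c'_def field_simps)
    have "\<bar>c' a\<bar> = 1" using a M by (simp add: c'_def)
    then have "\<eta> \<le> N (?c c')" using a(1) c' by (intro \<eta>(2)) auto
    then have "\<theta> * \<eta> \<le> \<theta> * N (?c c')" using \<theta> by simp
    moreover have "\<bar>vnorm (ell_p p) (?f c') - N (?c c')\<bar> \<le> \<theta> * \<eta>"
      by (rule \<phi>_approx[rule_format, of c']) (rule c')
    ultimately have "\<bar>vnorm (ell_p p) (?f c') - N (?c c')\<bar> \<le> \<theta> * N (?c c')" by linarith
    then have lo: "(1 - \<theta>) * N (?c c') \<le> vnorm (ell_p p) (?f c')"
      and hi: "vnorm (ell_p p) (?f c') \<le> (1 + \<theta>) * N (?c c')"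
      by (simp_all add: algebra_simps)
    have "s * ((1 - \<theta>) * N (?c c')) \<le> s * vnorm (ell_p p) (?f c')"
      using lo s(1) by (intro mult_left_mono) auto
    then have lo': "N (?c c') \<le> s * vnorm (ell_p p) (?f c')"
      by (simp add: mult.assoc[symmetric] s(2))
    have "s * vnorm (ell_p p) (?f c') \<le> s * ((1 + \<theta>) * N (?c c'))"
      using hi s(1) by (intro mult_left_mono) auto
    then have hi': "s * vnorm (ell_p p) (?f c') \<le> (1 + \<epsilon>) * N (?c c')"
      by (simp add: mult.assoc[symmetric] s(3))
    have fc: "?f c = M *\<^sub>R ?f c'" and cc: "?c c = M *\<^sub>R ?c c'"
      using M by (simp_all add: c'_def scaleR_sum_right)
    have "vnorm (ell_p p) (s *\<^sub>R ?f c) = M * (s * vnorm (ell_p p) (?f c'))"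
      unfolding fc using s M f0 by (simp add: scale mult.commute scaleR_scaleR del: scaleR_fun_apply)
    moreover have "N (?c c) = M * N (?c c')" unfolding cc using M by (simp add: N_scale mem)
    ultimately show ?thesis
      using mult_left_mono[OF lo', of M] mult_left_mono[OF hi', of M] M by (simp add: mult_ac)
  qed
  show "\<exists>T. linear_between Y F (ell_p p :: (nat \<Rightarrow> 'x) nspace) T \<and>
      (\<forall>x\<in>F. vnorm Y x \<le> vnorm (ell_p p) (T x) \<and> vnorm (ell_p p) (T x) \<le> (1 + \<epsilon>) * vnorm Y x)"
  proof (intro exI[of _ T] conjI ballI)
    have rep: "\<exists>c. x = \<kappa> (?c c)" if "x \<in> F" for x using FA that by auto
    show "linear_between Y F (ell_p p) T"
      unfolding linear_between_def
    proof (intro conjI funcsetI ballI allI)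
      fix x assume "x \<in> F"
      then obtain c where c: "x = \<kappa> (?c c)" using rep by blast
      show "T x \<in> vcarrier (ell_p p)"
        unfolding c T by (rule finite_support_ell_p(1)[of L]) (use f0 in simp)
      fix a
      have "T (vscale Y a x) = T (\<kappa> (?c (\<lambda>b. a * c b)))"
        unfolding c by (simp add: K(4) mem scaleR_sum_right)
      also have "\<dots> = a *\<^sub>R T x" unfolding c T by (simp add: scaleR_sum_right mult_ac)
      finally show "T (vscale Y a x) = vscale (ell_p p) a (T x)" by (simp add: ell_p_def fun_eq_iff)
    next
      fix x y assume "x \<in> F" "y \<in> F"
      then obtain c d where cd: "x = \<kappa> (?c c)" "y = \<kappa> (?c d)" using rep by blast
      have "T (vadd Y x y) = T (\<kappa> (?c (\<lambda>b. c b + d b)))"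
        unfolding cd by (simp add: K(3) mem scaleR_add_left sum.distrib)
      also have "\<dots> = T x + T y" unfolding cd T by (simp add: scaleR_add_left scaleR_add_right sum.distrib)
      finally show "T (vadd Y x y) = vadd (ell_p p) (T x) (T y)" by (simp add: ell_p_def fun_eq_iff)
    qed
    fix x assume "x \<in> F"
    then obtain c where c: "x = \<kappa> (?c c)" using rep by blast
    show "vnorm Y x \<le> vnorm (ell_p p) (T x)" "vnorm (ell_p p) (T x) \<le> (1 + \<epsilon>) * vnorm Y x"
      unfolding c T K(6)[OF mem] using norm_T[of c] by auto
  qed
qed

end

section \<open>Replacing an invariant mean by finitely many points\<close>

context mean_group
begin

text \<open>
  The scalar case, used to compare \<open>p\<close>-means of two norm functions.
\<close>

lemma averaged_real: "1 \<le> p \<Longrightarrow> averaged G m (UNIV :: real set) abs p"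
  by unfold_locales (auto simp: abs_mult)

end

locale averaged_vectors = averaged G m "UNIV :: 'x::banach set" norm p
  for G :: "('g, 'b) monoid_scheme" (structure) and m and p :: real
begin

text \<open>
  Cut the group into finitely many pieces on each of which all the functions
  \<open>x \<mapsto> \<parallel>\<Sum> c i w i x\<parallel>\<close>, with coefficients in the unit cube, vary by at most \<open>\<delta>\<close>. Replacing each function by its
  value at a chosen point of the piece changes its \<open>p\<close>-mean by at most \<open>\<delta>\<close>, and the \<open>p\<close>-mean of a function
  that is constant on the pieces is the norm of a finite sequence.
\<close>

lemma average_approx_finite:
  fixes w :: "'i \<Rightarrow> 'g \<Rightarrow> 'x"
  assumes I: "finite I" and w: "\<forall>i\<in>I. w i \<in> V" and \<delta>: "0 < \<delta>"
  shows "\<exists>(\<phi> :: 'i \<Rightarrow> nat \<Rightarrow> 'x) L. (\<forall>i\<in>I. \<forall>j\<ge>L. \<phi> i j = 0) \<and>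
           (\<forall>c. (\<forall>i\<in>I. \<bar>c i\<bar> \<le> 1) \<longrightarrow>
              \<bar>vnorm (ell_p p) (\<Sum>i\<in>I. c i *\<^sub>R \<phi> i) - q (\<Sum>i\<in>I. c i *\<^sub>R w i)\<bar> \<le> \<delta>)"
proof -
  interpret R: averaged G m "UNIV :: real set" abs p by (rule averaged_real[OF p])
  have "\<forall>i\<in>I. \<exists>K\<ge>0. \<forall>x\<in>carrier G. norm (w i x) \<le> K" using V_bound w by metis
  then obtain KK where KK: "\<And>i. i \<in> I \<Longrightarrow> 0 \<le> KK i"
      "\<And>i x. i \<in> I \<Longrightarrow> x \<in> carrier G \<Longrightarrow> norm (w i x) \<le> KK i"
    by metis
  define C where "C = (\<Sum>i\<in>I. KK i)"
  have C0: "0 \<le> C" unfolding C_def using KK by (intro sum_nonneg)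
  have sum_C: "(\<Sum>i\<in>I. norm (w i x)) \<le> C" if "x \<in> carrier G" for x
    unfolding C_def using KK that by (intro sum_mono) auto
  define Nf where "Nf c x = norm (\<Sum>i\<in>I. c i *\<^sub>R w i x)" for c x
  have lip: "\<bar>Nf c x - Nf d x\<bar> \<le> e * C"
    if "x \<in> carrier G" "\<And>i. i \<in> I \<Longrightarrow> \<bar>c i - d i\<bar> \<le> e" "0 \<le> e" for c d x e
  proof -
    have "\<bar>Nf c x - Nf d x\<bar> \<le> norm ((\<Sum>i\<in>I. c i *\<^sub>R w i x) - (\<Sum>i\<in>I. d i *\<^sub>R w i x))"
      unfolding Nf_def by (rule norm_triangle_ineq3)
    also have "\<dots> = norm (\<Sum>i\<in>I. (c i - d i) *\<^sub>R w i x)"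
      by (simp add: scaleR_diff_left sum_subtractf)
    also have "\<dots> \<le> (\<Sum>i\<in>I. norm ((c i - d i) *\<^sub>R w i x))" by (rule norm_sum)
    also have "\<dots> \<le> (\<Sum>i\<in>I. e * norm (w i x))"
      using that by (intro sum_mono) (auto intro: mult_right_mono)
    also have "\<dots> \<le> e * C"
      using sum_C[OF that(1)] that(3) by (simp add: sum_distrib_left[symmetric] mult_left_mono)
    finally show ?thesis .
  qed
  have Nf_nonneg: "0 \<le> Nf c x" for c x by (simp add: Nf_def)
  have Nf_le: "Nf c x \<le> C" if "x \<in> carrier G" "\<And>i. i \<in> I \<Longrightarrow> \<bar>c i\<bar> \<le> 1" for c x
    using lip[OF that(1), of c "\<lambda>i. 0" 1] that(2) by (simp add: Nf_def)
  define \<theta> where "\<theta> = \<delta> / 3"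
  have \<theta>: "0 < \<theta>" using \<delta> by (simp add: \<theta>_def)
  obtain J :: nat where J: "3 * C / \<delta> < real J" using reals_Archimedean2 by blast
  have "0 \<le> 3 * C / \<delta>" using C0 \<delta> by simp
  then have J0: "0 < J" using J by (metis le_less_trans of_nat_0_less_iff)
  have JC: "1 / real J * C \<le> \<theta>"
    using J J0 \<delta> by (simp add: \<theta>_def field_simps)
  \<comment> \<open>The norm functions depend on the coefficients in a Lipschitz way, so a finite grid suffices.\<close>
  define grid where "grid = (\<lambda>j. real_of_int j / real J) ` {- int J..int J}"
  define net where "net = PiE I (\<lambda>_. grid)"
  have fin_net: "finite net" unfolding net_def grid_def using I by (intro finite_PiE) auto
  have net_le: "\<bar>d i\<bar> \<le> 1" if "d \<in> net" "i \<in> I" for d i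
  proof -
    have "d i \<in> grid" using that by (auto simp: net_def)
    then obtain j where j: "j \<in> {- int J..int J}" "d i = real_of_int j / real J" by (auto simp: grid_def)
    then have "\<bar>real_of_int j\<bar> \<le> real J" by auto
    then show ?thesis using j J0 by (simp add: abs_divide)
  qed
  have net_ex: "\<exists>d\<in>net. \<forall>i\<in>I. \<bar>c i - d i\<bar> \<le> 1 / real J" if c: "\<forall>i\<in>I. \<bar>c i\<bar> \<le> 1" for c
  proof (intro bexI ballI)
    let ?d = "\<lambda>i\<in>I. real_of_int \<lfloor>c i * real J\<rfloor> / real J"
    have in_grid: "real_of_int \<lfloor>c i * real J\<rfloor> / real J \<in> grid" if "i \<in> I" for i
    proof -
      have "- 1 \<le> c i" "c i \<le> 1" using c that by (auto simp: abs_le_iff)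
      then have "- real J \<le> c i * real J" "c i * real J \<le> real J"
        using mult_right_mono[of "- 1" "c i" "real J"] mult_right_mono[of "c i" 1 "real J"] by auto
      then have "\<lfloor>c i * real J\<rfloor> \<in> {- int J..int J}"
        by (auto simp: le_floor_iff floor_le_iff)
      then show ?thesis unfolding grid_def by blast
    qed
    then show "?d \<in> net" by (auto simp: net_def)
    fix i assume i: "i \<in> I"
    have "c i - real_of_int \<lfloor>c i * real J\<rfloor> / real J = (c i * real J - real_of_int \<lfloor>c i * real J\<rfloor>) / real J"
      using J0 by (simp add: field_simps)
    moreover have "\<bar>c i * real J - real_of_int \<lfloor>c i * real J\<rfloor>\<bar> \<le> 1" by linarith
    ultimately show "\<bar>c i - ?d i\<bar> \<le> 1 / real J"
      using i J0 by (simp add: abs_divide divide_right_mono)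
  qed
  \<comment> \<open>Points with the same key have nearly the same norms for all coefficients of the grid.\<close>
  define key where "key x = (\<lambda>d\<in>net. \<lfloor>Nf d x / \<theta>\<rfloor>)" for x
  define Keys where "Keys = key ` carrier G"
  have fin_Keys: "finite Keys"
  proof (rule finite_subset)
    show "Keys \<subseteq> PiE net (\<lambda>_. {0..\<lfloor>C / \<theta>\<rfloor>})"
      unfolding Keys_def key_def using \<theta> Nf_nonneg Nf_le net_le
      by (auto intro!: floor_mono divide_right_mono)
    show "finite (PiE net (\<lambda>_. {0..\<lfloor>C / \<theta>\<rfloor>}))" using fin_net by (intro finite_PiE) auto
  qed
  have osc: "\<bar>Nf c x - Nf c y\<bar> \<le> \<delta>"
    if xy: "x \<in> carrier G" "y \<in> carrier G" "key x = key y" and c: "\<forall>i\<in>I. \<bar>c i\<bar> \<le> 1" for c x y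
  proof -
    obtain d where d: "d \<in> net" "\<forall>i\<in>I. \<bar>c i - d i\<bar> \<le> 1 / real J" using net_ex[OF c] by blast
    have close: "\<bar>Nf c z - Nf d z\<bar> \<le> \<theta>" if "z \<in> carrier G" for z
      using lip[OF that, of c d "1 / real J"] d(2) JC by fastforce
    have "\<bar>Nf d x - Nf d y\<bar> \<le> \<theta>"
    proof -
      have "\<lfloor>Nf d x / \<theta>\<rfloor> = \<lfloor>Nf d y / \<theta>\<rfloor>"
        using fun_cong[OF xy(3), of d] d(1) by (simp add: key_def)
      then have "\<bar>Nf d x / \<theta> - Nf d y / \<theta>\<bar> \<le> 1" by linarith
      then show ?thesis using \<theta> by (simp add: diff_divide_distrib[symmetric] abs_divide)
    qed
    then show ?thesis using close[OF xy(1)] close[OF xy(2)] unfolding \<theta>_def by linarith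
  qed
  define rep where "rep k = inv_into (carrier G) key k" for k
  have rep: "rep k \<in> carrier G" "key (rep k) = k" if "k \<in> Keys" for k
    using that by (auto simp: Keys_def rep_def intro: inv_into_into f_inv_into_f)
  define wt where "wt k = m (\<lambda>x. if key x = k then 1 else 0)" for k
  have ind: "(\<lambda>x. if key x = k then 1 else 0) \<in> bounded_funs G" for k
    by (rule bounded_funsI[of _ 1]) auto
  have wt: "0 \<le> wt k" for k unfolding wt_def by (rule mean_nonneg[OF ind]) auto
  define L where "L = card Keys"
  obtain h where h: "bij_betw h {..<L} Keys"
    using ex_bij_betw_nat_finite[OF fin_Keys] by (auto simp: L_def atLeast0LessThan)
  define \<phi> :: "'i \<Rightarrow> nat \<Rightarrow> 'x"
    where "\<phi> i j = (if j < L then wt (h j) powr (1 / p) *\<^sub>R w i (rep (h j)) else 0)" for i j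
  have "\<bar>vnorm (ell_p p) (\<Sum>i\<in>I. c i *\<^sub>R \<phi> i) - q (\<Sum>i\<in>I. c i *\<^sub>R w i)\<bar> \<le> \<delta>"
    if c: "\<forall>i\<in>I. \<bar>c i\<bar> \<le> 1" for c
  proof -
    define u where "u x = (if x \<in> carrier G then Nf c x else 0)" for x
    define v where "v x = (if x \<in> carrier G then Nf c (rep (key x)) else 0)" for x
    have key_Keys: "key x \<in> Keys" if "x \<in> carrier G" for x using that by (simp add: Keys_def)
    have u_V: "u \<in> R.V" by (rule R.VI[of _ C]) (use Nf_le c in \<open>auto simp: u_def Nf_def\<close>)
    have v_V: "v \<in> R.V"
    proof (rule R.VI[of _ C])
      fix x assume "x \<in> carrier G"
      then show "\<bar>v x\<bar> \<le> C"
        using Nf_le[OF rep(1)[OF key_Keys], of x c] c Nf_nonneg by (simp add: v_def)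
    qed (auto simp: v_def)
    have "\<bar>R.q u - R.q v\<bar> \<le> R.q (u - v)" by (rule R.V.abs_N_diff_le[OF u_V v_V])
    also have "\<dots> \<le> \<delta>"
    proof (rule R.q_le[OF R.V.mem_diff[OF u_V v_V]])
      fix x assume x: "x \<in> carrier G"
      then show "\<bar>(u - v) x\<bar> \<le> \<delta>"
        using osc[OF x rep(1)[OF key_Keys[OF x]] rep(2)[OF key_Keys[OF x], symmetric] c]
        by (simp add: u_def v_def)
    qed (use \<delta> in simp)
    finally have uv: "\<bar>R.q u - R.q v\<bar> \<le> \<delta>" .
    have "q (\<Sum>i\<in>I. c i *\<^sub>R w i) = R.q u"
    proof -
      have "m (\<lambda>x. norm ((\<Sum>i\<in>I. c i *\<^sub>R w i) x) powr p) = m (\<lambda>x. \<bar>u x\<bar> powr p)"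
      proof (rule mean_cong[OF powr_bounded])
        show "(\<Sum>i\<in>I. c i *\<^sub>R w i) \<in> V" using w by (intro V.mem_sum V.mem_scale) auto
      qed (simp add: u_def Nf_def sum_fun_apply)
      then show ?thesis by (simp add: q_def R.q_def)
    qed
    moreover have "vnorm (ell_p p) (\<Sum>i\<in>I. c i *\<^sub>R \<phi> i) = R.q v"
    proof -
      have term_eq: "norm ((\<Sum>i\<in>I. c i *\<^sub>R \<phi> i) j) powr p = wt (h j) * Nf c (rep (h j)) powr p"
        if "j < L" for j
      proof -
        have "(\<Sum>i\<in>I. c i *\<^sub>R \<phi> i) j = wt (h j) powr (1 / p) *\<^sub>R (\<Sum>i\<in>I. c i *\<^sub>R w i (rep (h j)))"
          using that by (simp add: sum_fun_apply \<phi>_def scaleR_sum_right mult.commute)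
        then show ?thesis
          using p wt[of "h j"] by (simp add: powr_mult powr_powr Nf_def)
      qed
      have "(\<Sum>j<L. norm ((\<Sum>i\<in>I. c i *\<^sub>R \<phi> i) j) powr p) = (\<Sum>k\<in>Keys. wt k * Nf c (rep k) powr p)"
        using sum.reindex_bij_betw[OF h, of "\<lambda>k. wt k * Nf c (rep k) powr p"] by (simp add: term_eq)
      also have "\<dots> = (\<Sum>k\<in>Keys. m (\<lambda>x. Nf c (rep k) powr p * (if key x = k then 1 else 0)))"
        by (simp add: mean_scale[OF ind] wt_def mult.commute)
      also have "\<dots> = m (\<lambda>x. \<Sum>k\<in>Keys. Nf c (rep k) powr p * (if key x = k then 1 else 0))"
        by (rule mean_sum[symmetric]) (intro bounded_funs_scale ind)
      also have "\<dots> = m (\<lambda>x. \<bar>v x\<bar> powr p)"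
      proof (rule mean_cong)
        fix x assume x: "x \<in> carrier G"
        have "(\<Sum>k\<in>Keys. Nf c (rep k) powr p * (if key x = k then 1 else 0)) =
            (\<Sum>k\<in>Keys. if key x = k then Nf c (rep k) powr p else 0)"
          by (intro sum.cong) auto
        then show "(\<Sum>k\<in>Keys. Nf c (rep k) powr p * (if key x = k then 1 else 0)) = \<bar>v x\<bar> powr p"
          using fin_Keys key_Keys[OF x] x by (simp add: v_def Nf_nonneg)
      qed (intro bounded_funs_sum bounded_funs_scale ind)
      finally show ?thesis
        by (subst finite_support_ell_p(2)[of L]) (simp_all add: R.q_def sum_fun_apply \<phi>_def)
    qed
    ultimately show ?thesis using uv by linarith
  qed
  moreover have "\<forall>i\<in>I. \<forall>j\<ge>L. \<phi> i j = 0" by (simp add: \<phi>_def)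
  ultimately show ?thesis by blast
qed

text \<open>
  Cauchy sequences are first replaced by nearby constant ones.
\<close>

lemma completion_finitely_representable:
  fixes Y :: "'a nspace"
  assumes W: "subspace W" "W \<subseteq> V" and pres: "presents (cauchy_seqs W q) (lim_norm q) \<kappa> Y"
  shows "finitely_representable Y (ell_p p :: (nat \<Rightarrow> 'x) nspace)"
proof -
  interpret W: seminormed W q by (rule V.seminormed_subspace[OF W])
  interpret C: seminormed "cauchy_seqs W q" "lim_norm q" by (rule W.seminormed_completion)
  show ?thesis
  proof (rule C.finitely_representable_ell_p[OF pres _ p])
    fix B \<delta> assume B: "finite B" "B \<subseteq> cauchy_seqs W q" and \<delta>: "(0 :: real) < \<delta>"
    define e where "e = \<delta> / (2 * (real (card B) + 1))"
    have e: "0 < e" using \<delta> by (simp add: e_def)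
    have "\<exists>w\<in>W. lim_norm q (b - (\<lambda>k. w)) < e" if "b \<in> B" for b
      using W.completion_approx[of b e] e B that by (fastforce simp: cauchy_seqs_def)
    then obtain w where w: "\<And>b. b \<in> B \<Longrightarrow> w b \<in> W"
        "\<And>b. b \<in> B \<Longrightarrow> lim_norm q (b - (\<lambda>k. w b)) < e"
      by metis
    have wV: "\<forall>b\<in>B. w b \<in> V" using w W by blast
    have "0 < \<delta> / 2" using \<delta> by simp
    from average_approx_finite[OF B(1) wV this]
    obtain \<phi> :: "(nat \<Rightarrow> 'g \<Rightarrow> 'x) \<Rightarrow> nat \<Rightarrow> 'x" and L
      where \<phi>: "\<forall>b\<in>B. \<forall>i\<ge>L. \<phi> b i = 0"
      and approx: "\<forall>c. (\<forall>b\<in>B. \<bar>c b\<bar> \<le> 1) \<longrightarrow>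
        \<bar>vnorm (ell_p p) (\<Sum>b\<in>B. c b *\<^sub>R \<phi> b) - q (\<Sum>b\<in>B. c b *\<^sub>R w b)\<bar> \<le> \<delta> / 2"
      by (elim exE conjE)
    have "\<bar>vnorm (ell_p p) (\<Sum>b\<in>B. c b *\<^sub>R \<phi> b) - lim_norm q (\<Sum>b\<in>B. c b *\<^sub>R b)\<bar> \<le> \<delta>"
      if c: "\<forall>b\<in>B. \<bar>c b\<bar> \<le> 1" for c
    proof -
      have const: "(\<lambda>k. w b) \<in> cauchy_seqs W q" if "b \<in> B" for b
        by (intro W.const_in_cauchy_seqs w that)
      have bw: "b - (\<lambda>k. w b) \<in> cauchy_seqs W q" if "b \<in> B" for b
        using B that by (intro C.mem_diff const) auto
      have "lim_norm q (\<Sum>b\<in>B. c b *\<^sub>R (\<lambda>k. w b)) = q (\<Sum>b\<in>B. c b *\<^sub>R w b)"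
      proof -
        have "(\<Sum>b\<in>B. c b *\<^sub>R (\<lambda>k. w b)) = (\<lambda>k :: nat. \<Sum>b\<in>B. c b *\<^sub>R w b)"
          by (simp add: fun_eq_iff sum_fun_apply)
        then show ?thesis by simp
      qed
      moreover have "\<bar>lim_norm q (\<Sum>b\<in>B. c b *\<^sub>R b) - lim_norm q (\<Sum>b\<in>B. c b *\<^sub>R (\<lambda>k. w b))\<bar>
          \<le> lim_norm q (\<Sum>b\<in>B. c b *\<^sub>R (b - (\<lambda>k. w b)))"
        unfolding scaleR_diff_right sum_subtractf using B const by (intro C.abs_N_diff_le C.mem_sum C.mem_scale) auto
      moreover have "lim_norm q (\<Sum>b\<in>B. c b *\<^sub>R (b - (\<lambda>k. w b))) \<le> \<delta> / 2"
      proof -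
        have "lim_norm q (\<Sum>b\<in>B. c b *\<^sub>R (b - (\<lambda>k. w b))) \<le> (\<Sum>b\<in>B. lim_norm q (c b *\<^sub>R (b - (\<lambda>k. w b))))"
          by (intro C.N_sum C.mem_scale bw)
        also have "\<dots> \<le> (\<Sum>b\<in>B. e)"
        proof (rule sum_mono)
          fix b assume b: "b \<in> B"
          have "lim_norm q (c b *\<^sub>R (b - (\<lambda>k. w b))) = \<bar>c b\<bar> * lim_norm q (b - (\<lambda>k. w b))"
            by (rule C.N_scale[OF bw[OF b]])
          also have "\<dots> \<le> 1 * e"
            using c b w(2)[OF b] C.N_nonneg[OF bw[OF b]] by (intro mult_mono) auto
          finally show "lim_norm q (c b *\<^sub>R (b - (\<lambda>k. w b))) \<le> e" by simp
        qed
        also have "\<dots> \<le> \<delta> / 2" using \<delta> by (simp add: e_def field_simps)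
        finally show ?thesis .
      qed
      moreover have "\<bar>vnorm (ell_p p) (\<Sum>b\<in>B. c b *\<^sub>R \<phi> b) - q (\<Sum>b\<in>B. c b *\<^sub>R w b)\<bar> \<le> \<delta> / 2"
        using approx c by blast
      ultimately show ?thesis by linarith
    qed
    with \<phi> show "\<exists>(\<phi> :: (nat \<Rightarrow> 'g \<Rightarrow> 'x) \<Rightarrow> nat \<Rightarrow> 'x) L. (\<forall>b\<in>B. \<forall>i\<ge>L. \<phi> b i = 0) \<and>
        (\<forall>c. (\<forall>b\<in>B. \<bar>c b\<bar> \<le> 1) \<longrightarrow>
          \<bar>vnorm (ell_p p) (\<Sum>b\<in>B. c b *\<^sub>R \<phi> b) - lim_norm q (\<Sum>b\<in>B. c b *\<^sub>R b)\<bar> \<le> \<delta>)"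
      by blast
  qed
qed

end

text \<open>
  Translates of displacements are differences of displacements, so their span is invariant; it is
  separable because the group is countable.
\<close>

theorem (in averaged_displacement) equivariant_points:
  assumes G: "countable (carrier G)"
  shows "\<exists>W (\<kappa> :: (nat \<Rightarrow> 'g \<Rightarrow> 'u) \<Rightarrow> point) Y. subspace W \<and> W \<subseteq> V \<and>
    presents (cauchy_seqs W q) (lim_norm q) \<kappa> Y \<and> banach_space Y \<and>
    equivariant G Y (\<lambda>g. \<kappa> (\<lambda>i. disp g)) \<and>
    (\<forall>g\<in>carrier G. \<forall>h\<in>carrier G.
      vnorm Y (vdiff Y (\<kappa> (\<lambda>i. disp g)) (\<kappa> (\<lambda>i. disp h))) = q (disp g - disp h))"
proof -
  let ?B = "disp ` carrier G"
  define W where "W = span ?B"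
  have B: "?B \<subseteq> V" using disp_V by auto
  have W: "subspace W" "W \<subseteq> V"
    unfolding W_def using span_minimal[OF B subspace_V] by auto
  interpret W: seminormed W q by (rule V.seminormed_subspace[OF W])
  interpret C: seminormed "cauchy_seqs W q" "lim_norm q" by (rule W.seminormed_completion)
  have disp: "disp g \<in> W" if "g \<in> carrier G" for g unfolding W_def using that by (intro span_base) auto
  have inv: "translate g F \<in> W" if g: "g \<in> carrier G" and F: "F \<in> W" for g F
    using F unfolding W_def
  proof (induction rule: span_induct_alt)
    case base
    have "translate g 0 = 0" using translate_scale[of g 0 0] by simp
    then show ?case by (simp only: span_zero)
  next
    case (step c b w)
    then obtain h where h: "h \<in> carrier G" "b = disp h" by auto
    have "translate g b \<in> W"
      unfolding h(2) translate_disp[OF g h(1)] using g h by (intro W.mem_diff disp) auto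
    then show ?case
      using step unfolding translate_add translate_scale W_def by (intro span_add span_scale)
  qed
  obtain D where D: "countable D" "D \<noteq> {}" "D \<subseteq> W" "\<forall>w\<in>W. \<forall>e>0. \<exists>d\<in>D. q (w - d) < e"
    using V.countable_dense_in_span[OF countable_image[OF G] B, folded W_def] by (elim exE conjE)
  let ?D = "(\<lambda>d (i :: nat). d) ` D"
  have "\<exists>(\<kappa> :: (nat \<Rightarrow> 'g \<Rightarrow> 'u) \<Rightarrow> point) Y. presents (cauchy_seqs W q) (lim_norm q) \<kappa> Y"
  proof (rule C.presents_as_points)
    show "countable ?D" "?D \<noteq> {}" using D by auto
    show "?D \<subseteq> cauchy_seqs W q" using D W.const_in_cauchy_seqs by auto
    fix s :: "nat \<Rightarrow> 'g \<Rightarrow> 'u" and e :: real assume s: "s \<in> cauchy_seqs W q" and e: "0 < e"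
    obtain i where i: "lim_norm q (s - (\<lambda>k. s i)) < e / 2"
      using W.completion_approx[OF s, of "e / 2"] e by auto
    have si: "s i \<in> W" using s by (auto simp: cauchy_seqs_def)
    then obtain d where d: "d \<in> D" "q (s i - d) < e / 2" using D(4)[rule_format, of "s i" "e / 2"] e by auto
    have "lim_norm q (s - (\<lambda>k. d)) \<le> lim_norm q (s - (\<lambda>k. s i)) + lim_norm q ((\<lambda>k. s i) - (\<lambda>k. d))"
      using d D si by (intro C.N_diff_triangle s W.const_in_cauchy_seqs) auto
    moreover have "(\<lambda>k. s i) - (\<lambda>k. d) = (\<lambda>k :: nat. s i - d)" by (simp add: fun_eq_iff)
    ultimately have "lim_norm q (s - (\<lambda>k. d)) < e" using i d by simp
    then show "\<exists>d\<in>?D. lim_norm q (s - d) < e" using d(1) by blast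
  qed
  then obtain \<kappa> :: "(nat \<Rightarrow> 'g \<Rightarrow> 'u) \<Rightarrow> point" and Y
    where pres: "presents (cauchy_seqs W q) (lim_norm q) \<kappa> Y" by blast
  show ?thesis
    using W pres equivariant_in_completion[OF W inv disp pres] by blast
qed

section \<open>Transferring a presentation along dense isometric subspaces\<close>

text \<open>
  Two complete spaces with dense subspaces that are isometric images of the same space \<open>I\<close> have the same
  quotient. The maps \<open>A\<close> and \<open>B\<close> may identify vectors, so the correspondence of limits is
  a relation before the null vectors are divided out.
\<close>

lemma transfer_presentation:
  fixes Z1 :: "'u::real_vector set" and Z2 :: "'v::real_vector set" and Y :: "'a nspace"
    and A :: "'i::real_vector \<Rightarrow> 'u" and B :: "'i \<Rightarrow> 'v"
  assumes Z1: "seminormed Z1 N1" "complete_in Z1 N1" and Z2: "seminormed Z2 N2" "complete_in Z2 N2"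
    and I: "subspace I"
    and A: "\<And>i. i \<in> I \<Longrightarrow> A i \<in> Z1" "\<And>i j. i \<in> I \<Longrightarrow> j \<in> I \<Longrightarrow> A (i + j) = A i + A j"
      "\<And>c i. i \<in> I \<Longrightarrow> A (c *\<^sub>R i) = c *\<^sub>R A i"
    and B: "\<And>i. i \<in> I \<Longrightarrow> B i \<in> Z2" "\<And>i j. i \<in> I \<Longrightarrow> j \<in> I \<Longrightarrow> B (i + j) = B i + B j"
      "\<And>c i. i \<in> I \<Longrightarrow> B (c *\<^sub>R i) = c *\<^sub>R B i"
    and iso: "\<And>i. i \<in> I \<Longrightarrow> N1 (A i) = N2 (B i)"
    and dense1: "\<And>z e. z \<in> Z1 \<Longrightarrow> 0 < e \<Longrightarrow> \<exists>i\<in>I. N1 (z - A i) < e"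
    and dense2: "\<And>z e. z \<in> Z2 \<Longrightarrow> 0 < e \<Longrightarrow> \<exists>i\<in>I. N2 (z - B i) < e"
    and pres: "presents Z2 N2 \<kappa> Y"
  shows "\<exists>\<kappa>'. presents Z1 N1 \<kappa>' Y"
proof -
  interpret Z1: seminormed Z1 N1 by (rule Z1(1))
  interpret Z2: seminormed Z2 N2 by (rule Z2(1))
  note K = presentsD[OF pres]
  have A_diff: "A (i - j) = A i - A j" if "i \<in> I" "j \<in> I" for i j
    using A(2)[OF subspace_diff[OF I that] that(2)] by simp
  have B_diff: "B (i - j) = B i - B j" if "i \<in> I" "j \<in> I" for i j
    using B(2)[OF subspace_diff[OF I that] that(2)] by simp
  \<comment> \<open>Limits of \<open>A\<close> and \<open>B\<close> along a common sequence; symmetric in the two spaces.\<close>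
  define R where "R z1 z2 \<longleftrightarrow> z1 \<in> Z1 \<and> z2 \<in> Z2 \<and> (\<exists>s. (\<forall>n :: nat. s n \<in> I) \<and>
      (\<lambda>n. N1 (A (s n) - z1)) \<longlonglongrightarrow> 0 \<and> (\<lambda>n. N2 (B (s n) - z2)) \<longlonglongrightarrow> 0)" for z1 z2
  have RI: "R z1 z2" if "z1 \<in> Z1" "z2 \<in> Z2" "\<And>n. s n \<in> I"
      "(\<lambda>n. N1 (A (s n) - z1)) \<longlonglongrightarrow> 0" "(\<lambda>n. N2 (B (s n) - z2)) \<longlonglongrightarrow> 0" for z1 z2 s
    using that unfolding R_def by blast
  have null_seq: "(\<lambda>n. f n) \<longlonglongrightarrow> 0"
    if "\<And>n. 0 \<le> f n" "\<And>n. f n \<le> inverse (real (Suc n))" for f :: "nat \<Rightarrow> real"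
    by (rule real_tendsto_sandwich[OF _ _ tendsto_const LIMSEQ_inverse_real_of_nat]) (use that in auto)
  have cauchy_of_null: "cauchy_in N s" if Z: "seminormed Z N" and s: "\<And>n. s n \<in> Z" "z \<in> Z"
      and lim: "(\<lambda>n. N (s n - z)) \<longlonglongrightarrow> 0" for Z :: "'w::real_vector set" and N s z
  proof -
    interpret Z: seminormed Z N by (rule Z)
    show ?thesis
      unfolding cauchy_in_def
    proof (intro allI impI)
      fix e :: real assume "0 < e"
      then have "0 < e / 2" by simp
      then obtain M where M: "\<forall>n\<ge>M. N (s n - z) < e / 2"
        using order_tendstoD(2)[OF lim] unfolding eventually_sequentially by blast
      have "N (s m - s n) < e" if "m \<ge> M" "n \<ge> M" for m n
        using Z.N_diff_triangle[OF s(1) s(2) s(1), of m n] M[rule_format, OF that(1)] M[rule_format, OF that(2)]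
          Z.N_commute[OF s(1) s(2), of n] by linarith
      then show "\<exists>M. \<forall>m\<ge>M. \<forall>n\<ge>M. N (s m - s n) < e" by blast
    qed
  qed
  have total1: "\<exists>z2. R z1 z2" if z1: "z1 \<in> Z1" for z1
  proof -
    have "\<exists>i\<in>I. N1 (z1 - A i) < inverse (real (Suc n))" for n using dense1[OF z1] by simp
    then obtain s where s: "\<And>n. s n \<in> I" "\<And>n. N1 (z1 - A (s n)) < inverse (real (Suc n))" by metis
    have lim: "(\<lambda>n. N1 (A (s n) - z1)) \<longlonglongrightarrow> 0"
      using s by (intro null_seq) (auto simp: Z1.N_commute[OF A(1) z1] less_imp_le
          intro!: Z1.N_nonneg Z1.mem_diff z1 A(1))
    have "cauchy_in N1 (\<lambda>n. A (s n))" by (rule cauchy_of_null[OF Z1(1) A(1)[OF s(1)] z1 lim])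
    then have "cauchy_in N2 (\<lambda>n. B (s n))"
      using iso[OF subspace_diff[OF I s(1) s(1)]] s(1) by (simp add: cauchy_in_def A_diff B_diff)
    moreover have "range (\<lambda>n. B (s n)) \<subseteq> Z2" using s(1) B(1) by auto
    ultimately obtain z2 where z2: "z2 \<in> Z2" "(\<lambda>n. N2 (B (s n) - z2)) \<longlonglongrightarrow> 0"
      using Z2(2)[unfolded complete_in_def, rule_format, of "\<lambda>n. B (s n)"] by blast
    then show ?thesis using RI[OF z1 z2(1) s(1) lim z2(2)] by blast
  qed
  have total2: "\<exists>z1. R z1 z2" if z2: "z2 \<in> Z2" for z2
  proof -
    have "\<exists>i\<in>I. N2 (z2 - B i) < inverse (real (Suc n))" for n using dense2[OF z2] by simp
    then obtain s where s: "\<And>n. s n \<in> I" "\<And>n. N2 (z2 - B (s n)) < inverse (real (Suc n))" by metis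
    have lim: "(\<lambda>n. N2 (B (s n) - z2)) \<longlonglongrightarrow> 0"
      using s by (intro null_seq) (auto simp: Z2.N_commute[OF B(1) z2] less_imp_le
          intro!: Z2.N_nonneg Z2.mem_diff z2 B(1))
    have "cauchy_in N2 (\<lambda>n. B (s n))" by (rule cauchy_of_null[OF Z2(1) B(1)[OF s(1)] z2 lim])
    then have "cauchy_in N1 (\<lambda>n. A (s n))"
      using iso[OF subspace_diff[OF I s(1) s(1)]] s(1) by (simp add: cauchy_in_def A_diff B_diff)
    moreover have "range (\<lambda>n. A (s n)) \<subseteq> Z1" using s(1) A(1) by auto
    ultimately obtain z1 where z1: "z1 \<in> Z1" "(\<lambda>n. N1 (A (s n) - z1)) \<longlonglongrightarrow> 0"
      using Z1(2)[unfolded complete_in_def, rule_format, of "\<lambda>n. A (s n)"] by blast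
    then show ?thesis using RI[OF z1(1) z2 s(1) z1(2) lim] by blast
  qed
  have R_add: "R (z1 + w1) (z2 + w2)" if "R z1 z2" "R w1 w2" for z1 z2 w1 w2
  proof -
    obtain s where z: "z1 \<in> Z1" "z2 \<in> Z2" and s: "\<And>n :: nat. s n \<in> I"
        "(\<lambda>n. N1 (A (s n) - z1)) \<longlonglongrightarrow> 0" "(\<lambda>n. N2 (B (s n) - z2)) \<longlonglongrightarrow> 0"
      using \<open>R z1 z2\<close> unfolding R_def by blast
    obtain t where w: "w1 \<in> Z1" "w2 \<in> Z2" and t: "\<And>n :: nat. t n \<in> I"
        "(\<lambda>n. N1 (A (t n) - w1)) \<longlonglongrightarrow> 0" "(\<lambda>n. N2 (B (t n) - w2)) \<longlonglongrightarrow> 0"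
      using \<open>R w1 w2\<close> unfolding R_def by blast
    show ?thesis
    proof (rule RI[where s = "\<lambda>n. s n + t n"])
      have eqA: "A (s n + t n) - (z1 + w1) = (A (s n) - z1) + (A (t n) - w1)"
        and eqB: "B (s n + t n) - (z2 + w2) = (B (s n) - z2) + (B (t n) - w2)" for n
        using s t A B by simp_all
      have le: "N1 (A (s n + t n) - (z1 + w1)) \<le> N1 (A (s n) - z1) + N1 (A (t n) - w1)"
        "N2 (B (s n + t n) - (z2 + w2)) \<le> N2 (B (s n) - z2) + N2 (B (t n) - w2)" for n
        unfolding eqA eqB by (intro Z1.N_triangle Z2.N_triangle Z1.mem_diff Z2.mem_diff A B s t z w)+
      have lim: "(\<lambda>n. N1 (A (s n) - z1) + N1 (A (t n) - w1)) \<longlonglongrightarrow> 0"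
          "(\<lambda>n. N2 (B (s n) - z2) + N2 (B (t n) - w2)) \<longlonglongrightarrow> 0"
        using tendsto_add[OF s(2) t(2)] tendsto_add[OF s(3) t(3)] by simp_all
      have nonneg: "0 \<le> N1 (A (s n + t n) - (z1 + w1))" "0 \<le> N2 (B (s n + t n) - (z2 + w2))" for n
        by (intro Z1.N_nonneg Z2.N_nonneg Z1.mem_diff Z2.mem_diff Z1.mem_add Z2.mem_add A B
            subspace_add[OF I] s t z w)+
      show "(\<lambda>n. N1 (A (s n + t n) - (z1 + w1))) \<longlonglongrightarrow> 0"
        by (rule real_tendsto_sandwich[OF _ _ tendsto_const lim(1)])
          (intro always_eventually allI nonneg le)+
      show "(\<lambda>n. N2 (B (s n + t n) - (z2 + w2))) \<longlonglongrightarrow> 0"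
        by (rule real_tendsto_sandwich[OF _ _ tendsto_const lim(2)])
          (intro always_eventually allI nonneg le)+
    qed (intro Z1.mem_add Z2.mem_add z w subspace_add[OF I] s t)+
  qed
  have R_scale: "R (c *\<^sub>R z1) (c *\<^sub>R z2)" if "R z1 z2" for c z1 z2
  proof -
    obtain s where z: "z1 \<in> Z1" "z2 \<in> Z2" and s: "\<And>n :: nat. s n \<in> I"
        "(\<lambda>n. N1 (A (s n) - z1)) \<longlonglongrightarrow> 0" "(\<lambda>n. N2 (B (s n) - z2)) \<longlonglongrightarrow> 0"
      using \<open>R z1 z2\<close> unfolding R_def by blast
    have "N1 (A (c *\<^sub>R s n) - c *\<^sub>R z1) = \<bar>c\<bar> * N1 (A (s n) - z1)"
      and "N2 (B (c *\<^sub>R s n) - c *\<^sub>R z2) = \<bar>c\<bar> * N2 (B (s n) - z2)" for n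
      using Z1.N_scale[OF Z1.mem_diff[OF A(1)[OF s(1)] z(1)], of c n]
        Z2.N_scale[OF Z2.mem_diff[OF B(1)[OF s(1)] z(2)], of c n] A(3)[OF s(1)] B(3)[OF s(1)]
      by (simp_all add: scaleR_diff_right)
    then show ?thesis
      using tendsto_mult_right_zero[OF s(2), of "\<bar>c\<bar>"] tendsto_mult_right_zero[OF s(3), of "\<bar>c\<bar>"]
      by (intro RI[where s = "\<lambda>n. c *\<^sub>R s n"] Z1.mem_scale Z2.mem_scale z subspace_scale[OF I] s(1))
        simp_all
  qed
  have R_N: "N1 z1 = N2 z2" if "R z1 z2" for z1 z2
  proof -
    obtain s where z: "z1 \<in> Z1" "z2 \<in> Z2" and s: "\<And>n :: nat. s n \<in> I"
        "(\<lambda>n. N1 (A (s n) - z1)) \<longlonglongrightarrow> 0" "(\<lambda>n. N2 (B (s n) - z2)) \<longlonglongrightarrow> 0"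
      using \<open>R z1 z2\<close> unfolding R_def by blast
    have "(\<lambda>n. N1 (A (s n)) - N1 z1) \<longlonglongrightarrow> 0"
      by (rule Lim_null_comparison[OF _ s(2)]) (auto intro!: always_eventually Z1.abs_N_diff_le A(1) s(1) z)
    moreover have "(\<lambda>n. N1 (A (s n)) - N2 z2) \<longlonglongrightarrow> 0"
      unfolding iso[OF s(1)]
      by (rule Lim_null_comparison[OF _ s(3)]) (auto intro!: always_eventually Z2.abs_N_diff_le B(1) s(1) z)
    ultimately have "(\<lambda>n. N1 (A (s n))) \<longlonglongrightarrow> N1 z1" "(\<lambda>n. N1 (A (s n))) \<longlonglongrightarrow> N2 z2"
      by (auto simp: LIM_zero_iff)
    then show ?thesis by (rule LIMSEQ_unique)
  qed
  have R_mem: "z1 \<in> Z1" "z2 \<in> Z2" if "R z1 z2" for z1 z2 using that by (auto simp: R_def)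
  have R_diff: "R (z1 - w1) (z2 - w2)" if "R z1 z2" "R w1 w2" for z1 z2 w1 w2
    using R_add[OF that(1) R_scale[OF that(2), of "-1"]] by simp
  define \<kappa>' where "\<kappa>' z1 = \<kappa> (SOME z2. R z1 z2)" for z1
  have \<kappa>': "\<kappa>' z1 = \<kappa> z2" if "R z1 z2" for z1 z2
  proof -
    have some: "R z1 (SOME z2. R z1 z2)" by (rule someI[of "R z1"]) (rule that)
    have "N2 ((SOME z2. R z1 z2) - z2) = 0"
      using R_N[OF R_diff[OF some that]] by (simp add: Z1.N_0)
    then show ?thesis unfolding \<kappa>'_def using K(2)[OF R_mem(2)[OF some] R_mem(2)[OF that]] by blast
  qed
  have "presents Z1 N1 \<kappa>' Y"
    unfolding presents_def
  proof (intro conjI ballI allI)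
    show "\<kappa>' ` Z1 = vcarrier Y"
    proof (intro equalityI subsetI)
      fix y assume "y \<in> \<kappa>' ` Z1"
      then obtain z1 where z1: "z1 \<in> Z1" "y = \<kappa>' z1" by blast
      then obtain z2 where "R z1 z2" using total1 by blast
      then show "y \<in> vcarrier Y" using z1 \<kappa>' R_mem K(1) by auto
    next
      fix y assume "y \<in> vcarrier Y"
      then obtain z2 where z2: "z2 \<in> Z2" "y = \<kappa> z2" using K(1) by auto
      then obtain z1 where "R z1 z2" using total2 by blast
      then show "y \<in> \<kappa>' ` Z1" using z2(2) \<kappa>'[of z1 z2] R_mem(1)[of z1 z2]
        by (intro image_eqI[of _ _ z1]) simp_all
    qed
    show "\<kappa>' 0 = vzero Y"
    proof -
      obtain z2 where "R 0 z2" using total1[OF Z1.mem_0] by blast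
      then have "R 0 0" using R_scale[of 0 z2 0] by simp
      then show ?thesis using \<kappa>' K(5) by simp
    qed
  next
    fix x y assume "x \<in> Z1" "y \<in> Z1"
    then obtain x2 y2 where xy: "R x x2" "R y y2" using total1 by blast
    show "\<kappa>' (x + y) = vadd Y (\<kappa>' x) (\<kappa>' y)"
      using \<kappa>'[OF xy(1)] \<kappa>'[OF xy(2)] \<kappa>'[OF R_add[OF xy]] K(3) R_mem(2)[OF xy(1)] R_mem(2)[OF xy(2)]
      by simp
    show "(\<kappa>' x = \<kappa>' y) \<longleftrightarrow> (N1 (x - y) = 0)"
      using \<kappa>'[OF xy(1)] \<kappa>'[OF xy(2)] R_N[OF R_diff[OF xy]] K(2) R_mem(2)[OF xy(1)] R_mem(2)[OF xy(2)]
      by simp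
  next
    fix c x assume "x \<in> Z1"
    then obtain x2 where x: "R x x2" using total1 by blast
    show "\<kappa>' (c *\<^sub>R x) = vscale Y c (\<kappa>' x)"
      using \<kappa>'[OF x] \<kappa>'[OF R_scale[OF x]] K(4) R_mem(2)[OF x] by simp
  next
    fix x assume "x \<in> Z1"
    then obtain x2 where x: "R x x2" using total1 by blast
    show "vnorm Y (\<kappa>' x) = N1 x" using \<kappa>'[OF x] R_N[OF x] K(6) R_mem(2)[OF x] by simp
  qed
  then show ?thesis by blast
qed

section \<open>Functions of finitely many binary digits\<close>

text \<open>
  The first \<open>n\<close> digits, the latest one in front: splitting a cell then amounts to a list constructor.
\<close>

primrec pat :: "nat \<Rightarrow> (nat \<Rightarrow> bool) \<Rightarrow> bool list" where
  "pat 0 c = []"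
| "pat (Suc n) c = c n # pat n c"

lemma length_pat [simp]: "length (pat n c) = n"
  by (induction n) auto

lemma pat_eq_iff: "pat n c = pat n d \<longleftrightarrow> (\<forall>i<n. c i = d i)"
  by (induction n) (auto simp: less_Suc_eq)

lemma pat_surj: "\<exists>c. pat (length e) c = e"
proof (induction e)
  case (Cons b e)
  then obtain c where c: "pat (length e) c = e" by blast
  have "pat (length e) (c(length e := b)) = pat (length e) c" by (simp add: pat_eq_iff)
  then show ?case using c by (intro exI[of _ "c(length e := b)"]) (simp del: fun_upd_apply, simp)
qed simp

definition extend :: "bool list \<Rightarrow> nat \<Rightarrow> bool" where
  "extend e = (SOME c. pat (length e) c = e)"

lemma pat_extend: "pat (length e) (extend e) = e"
  unfolding extend_def by (rule someI_ex[OF pat_surj])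

lemma finite_bool_lists: "finite {e :: bool list. length e = n}"
  using finite_lists_length_eq[of "UNIV :: bool set" n] by simp

definition cyl :: "nat \<Rightarrow> ((nat \<Rightarrow> bool) \<Rightarrow> real) set" where
  "cyl n = {\<sigma>. \<forall>c d. pat n c = pat n d \<longrightarrow> \<sigma> c = \<sigma> d}"

lemma cylD: "\<sigma> \<in> cyl n \<Longrightarrow> pat n c = pat n d \<Longrightarrow> \<sigma> c = \<sigma> d"
  unfolding cyl_def by blast

lemma cyl_mono: "n \<le> k \<Longrightarrow> cyl n \<subseteq> cyl k"
  unfolding cyl_def pat_eq_iff by (blast intro: less_le_trans)

lemma cyl_comp: "\<sigma> \<in> cyl n \<Longrightarrow> (\<lambda>c. f (\<sigma> c)) \<in> cyl n"
  unfolding cyl_def mem_Collect_eq by (intro allI impI arg_cong[of _ _ f]) blast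

lemma cyl_comp2: "\<sigma> \<in> cyl n \<Longrightarrow> \<tau> \<in> cyl n \<Longrightarrow> (\<lambda>c. f (\<sigma> c) (\<tau> c)) \<in> cyl n"
  unfolding cyl_def mem_Collect_eq by (intro allI impI arg_cong2[of _ _ _ _ f]) blast+

text \<open>
  A function of the first \<open>n\<close> digits is a linear combination of indicators of cells; every linear
  functional on such functions is therefore determined by the masses of the cells.
\<close>

lemma cyl_expand:
  assumes "\<sigma> \<in> cyl n"
  shows "\<sigma> c = (\<Sum>e | length e = n. \<sigma> (extend e) * of_bool (pat n c = e))"
proof -
  have "\<sigma> (extend (pat n c)) = \<sigma> c"
    using pat_extend[of "pat n c"] by (intro cylD[OF assms]) simp
  moreover have "(\<Sum>e | length e = n. \<sigma> (extend e) * of_bool (pat n c = e)) =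
      (\<Sum>e | length e = n. if pat n c = e then \<sigma> (extend e) else 0)"
    by (intro sum.cong) auto
  ultimately show ?thesis by (simp add: finite_bool_lists)
qed

lemma cyl_bounded:
  assumes "\<sigma> \<in> cyl n" obtains C where "0 \<le> C" "\<And>c. \<bar>\<sigma> c\<bar> \<le> C"
proof -
  have "\<bar>\<sigma> c\<bar> \<le> (\<Sum>e | length e = n. \<bar>\<sigma> (extend e)\<bar>)" for c
  proof -
    have "\<bar>\<sigma> c\<bar> \<le> (\<Sum>e | length e = n. \<bar>\<sigma> (extend e) * of_bool (pat n c = e)\<bar>)"
      by (subst cyl_expand[OF assms]) (rule sum_abs)
    also have "\<dots> \<le> (\<Sum>e | length e = n. \<bar>\<sigma> (extend e)\<bar>)"
      by (intro sum_mono) (simp add: abs_mult)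
    finally show ?thesis .
  qed
  then show ?thesis by (intro that[of "\<Sum>e | length e = n. \<bar>\<sigma> (extend e)\<bar>"]) (auto intro: sum_nonneg)
qed

definition cylinders :: "((nat \<Rightarrow> bool) \<Rightarrow> real) set" where
  "cylinders = (\<Union>n. cyl n)"

lemma cylinders2:
  assumes "\<sigma> \<in> cylinders" "\<tau> \<in> cylinders" obtains n where "\<sigma> \<in> cyl n" "\<tau> \<in> cyl n"
proof -
  obtain j k where "\<sigma> \<in> cyl j" "\<tau> \<in> cyl k" using assms by (auto simp: cylinders_def)
  then show ?thesis
    using cyl_mono[of j "max j k"] cyl_mono[of k "max j k"] by (intro that[of "max j k"]) auto
qed

lemma subspace_cylinders: "subspace cylinders"
proof (rule subspaceI)
  show "0 \<in> cylinders" by (auto simp: cylinders_def cyl_def)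
next
  fix \<sigma> \<tau> assume "\<sigma> \<in> cylinders" "\<tau> \<in> cylinders"
  then obtain n where "\<sigma> \<in> cyl n" "\<tau> \<in> cyl n" by (rule cylinders2)
  then have "(\<lambda>c. \<sigma> c + \<tau> c) \<in> cyl n" by (rule cyl_comp2)
  then show "\<sigma> + \<tau> \<in> cylinders" by (auto simp: cylinders_def plus_fun_def)
next
  fix a and \<sigma> assume "\<sigma> \<in> cylinders"
  then obtain n where "\<sigma> \<in> cyl n" by (auto simp: cylinders_def)
  then have "(\<lambda>c. a *\<^sub>R \<sigma> c) \<in> cyl n" by (rule cyl_comp)
  then show "a *\<^sub>R \<sigma> \<in> cylinders" by (auto simp: cylinders_def scaleR_fun_def)
qed

lemma finite_cylinders_level:
  assumes "finite B" "\<And>b. b \<in> B \<Longrightarrow> \<sigma> b \<in> cylinders"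
  shows "\<exists>n. \<forall>b\<in>B. \<sigma> b \<in> cyl n"
  using assms
proof (induction B)
  case (insert b B)
  then obtain n where n: "\<forall>b\<in>B. \<sigma> b \<in> cyl n" by blast
  obtain k where k: "\<sigma> b \<in> cyl k" using insert.prems[of b] by (auto simp: cylinders_def)
  then show ?case
    using n cyl_mono[of n "max n k"] cyl_mono[of k "max n k"] by (intro exI[of _ "max n k"]) auto
qed simp

section \<open>Coding the unit interval by binary digits\<close>

abbreviation unit_lebesgue :: "real measure" where
  "unit_lebesgue \<equiv> lebesgue_on {0..1}"

lemma borel_measurable_unit: "f \<in> borel_measurable borel \<Longrightarrow> f \<in> borel_measurable unit_lebesgue"
  by (simp add: measurable_completion measurable_restrict_space1)

lemma AE_unit_neq: "AE t in unit_lebesgue. t \<noteq> (a :: real)"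
proof -
  have "AE t in lebesgue. t \<noteq> a" by (intro AE_completion AE_lborel_singleton)
  then show ?thesis by (subst AE_restrict_space_iff) (auto elim: eventually_mono)
qed

lemma integral_unit_Ico:
  assumes "0 \<le> a" "a \<le> b" "b \<le> (1 :: real)"
  shows "(\<integral>t. indicator {a..<b} t \<partial>unit_lebesgue) = b - a"
proof -
  have "{a..<b} \<subseteq> {0..1}" using assms by auto
  moreover have "measure unit_lebesgue {a..<b} = measure lebesgue {a..<b}"
    using assms by (intro measure_restrict_space) auto
  moreover have "measure lebesgue {a..<b} = b - a"
    using assms by (simp add: measure_def)
  ultimately show ?thesis by (simp add: Int_absorb2)
qed

lemma finite_measure_unit: "finite_measure unit_lebesgue"
  by (rule finite_measureI) (simp add: emeasure_restrict_space)

text \<open>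
  Dominated convergence in \<open>L\<^sub>p\<close>.
\<close>

lemma Lp_norm_dominated_tendsto:
  assumes p: "1 \<le> p" and s: "\<And>i. s i \<in> borel_measurable M" and f: "f \<in> borel_measurable M"
    and g: "g \<in> Lp_funs p M" and lim: "\<And>x. x \<in> space M \<Longrightarrow> (\<lambda>i. s i x) \<longlonglongrightarrow> f x"
    and bound: "\<And>i x. x \<in> space M \<Longrightarrow> \<bar>s i x\<bar> \<le> g x"
  shows "(\<lambda>i. Lp_norm p M (f - s i)) \<longlonglongrightarrow> 0"
proof -
  note [measurable] = s f
  have f_le: "\<bar>f x\<bar> \<le> g x" if "x \<in> space M" for x
    by (rule LIMSEQ_le_const2[OF tendsto_rabs[OF lim[OF that]]]) (use bound that in auto)
  have "(\<lambda>i. \<integral>x. \<bar>(f - s i) x\<bar> powr p \<partial>M) \<longlonglongrightarrow> (\<integral>x. 0 \<partial>M)"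
  proof (rule integral_dominated_convergence)
    show "integrable M (\<lambda>x. 2 powr p * \<bar>g x\<bar> powr p)" using Lp_funsD(2)[OF g] by simp
    show "AE x in M. (\<lambda>i. \<bar>(f - s i) x\<bar> powr p) \<longlonglongrightarrow> 0"
    proof (rule AE_I2)
      fix x assume "x \<in> space M"
      then have "(\<lambda>i. \<bar>f x - s i x\<bar>) \<longlonglongrightarrow> \<bar>f x - f x\<bar>" by (intro tendsto_intros lim)
      then have "(\<lambda>i. \<bar>f x - s i x\<bar> powr p) \<longlonglongrightarrow> 0"
        using p by (intro tendsto_zero_powrI[OF _ tendsto_const]) auto
      then show "(\<lambda>i. \<bar>(f - s i) x\<bar> powr p) \<longlonglongrightarrow> 0" by simp
    qed
    show "AE x in M. norm (\<bar>(f - s i) x\<bar> powr p) \<le> 2 powr p * \<bar>g x\<bar> powr p" for i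
    proof (rule AE_I2)
      fix x assume x: "x \<in> space M"
      have "\<bar>f x - s i x\<bar> \<le> 2 * \<bar>g x\<bar>" using f_le[OF x] bound[OF x, of i] by linarith
      then have "\<bar>f x - s i x\<bar> powr p \<le> (2 * \<bar>g x\<bar>) powr p" using p by (intro powr_mono2) auto
      then show "norm (\<bar>(f - s i) x\<bar> powr p) \<le> 2 powr p * \<bar>g x\<bar> powr p" by (simp add: powr_mult)
    qed
  qed simp_all
  then show ?thesis
    unfolding Lp_norm_def using p
    by (intro tendsto_zero_powrI[OF _ tendsto_const]) auto
qed

text \<open>
  A probability on infinite binary words, given by the masses of its cylinders. Smallness of the masses
  says that there are no atoms, uniformly.
\<close>

locale interval_code =
  fixes mass :: "bool list \<Rightarrow> real"
  assumes mass_nonneg: "0 \<le> mass e"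
    and mass_split: "mass e = mass (False # e) + mass (True # e)"
    and mass_Nil: "mass [] = 1"
    and mass_small: "0 < \<epsilon> \<Longrightarrow> \<exists>n. \<forall>e. length e = n \<longrightarrow> mass e \<le> \<epsilon>"
begin

text \<open>
  The words of length \<open>n\<close> are given consecutive intervals \<open>[left e, left e + mass e)\<close> that partition the
  unit interval; a word is split by cutting its interval in two.
\<close>

primrec left :: "bool list \<Rightarrow> real" where
  "left [] = 0"
| "left (b # e) = left e + (if b then mass (False # e) else 0)"

primrec cell :: "nat \<Rightarrow> real \<Rightarrow> bool list" where
  "cell 0 t = []"
| "cell (Suc n) t = (left (cell n t) + mass (False # cell n t) \<le> t) # cell n t"

definition digits :: "real \<Rightarrow> nat \<Rightarrow> bool" where
  "digits t n = (left (cell n t) + mass (False # cell n t) \<le> t)"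

lemma pat_digits: "pat n (digits t) = cell n t"
  by (induction n) (auto simp: digits_def)

lemma length_cell [simp]: "length (cell n t) = n"
  by (induction n) auto

lemma left_nonneg: "0 \<le> left e"
  by (induction e) (auto simp: mass_nonneg)

lemma left_le_1: "left e + mass e \<le> 1"
proof (induction e)
  case (Cons b e)
  then show ?case
    using mass_split[of e] mass_nonneg[of "True # e"] mass_nonneg[of "False # e"] by (cases b) auto
qed (simp add: mass_Nil)

lemma cell_eq_iff:
  assumes "0 \<le> t" "t < 1"
  shows "length e = n \<Longrightarrow> cell n t = e \<longleftrightarrow> left e \<le> t \<and> t < left e + mass e"
proof (induction n arbitrary: e)
  case 0
  then show ?case using assms by (simp add: mass_Nil)
next
  case (Suc n)
  then obtain b e' where e: "e = b # e'" "length e' = n" by (cases e) auto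
  have IH: "cell n t = e' \<longleftrightarrow> left e' \<le> t \<and> t < left e' + mass e'" by (rule Suc.IH[OF e(2)])
  show ?case
  proof (cases "cell n t = e'")
    case True
    then show ?thesis using IH mass_split[of e'] by (cases b) (auto simp: e)
  next
    case False
    then show ?thesis
      using IH mass_split[of e'] mass_nonneg[of "True # e'"] mass_nonneg[of "False # e'"]
      by (cases b) (auto simp: e)
  qed
qed

lemma pred_cell: "Measurable.pred borel (\<lambda>t. cell n t = e)"
proof (induction n arbitrary: e)
  case (Suc n)
  note [measurable] = Suc
  show ?case
  proof (cases e)
    case (Cons b e')
    have "(cell (Suc n) t = e) \<longleftrightarrow> cell n t = e' \<and> (left e' + mass (False # e') \<le> t) = b" for t
      unfolding Cons by auto
    then show ?thesis by simp
  qed simp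
qed simp

lemma integral_cell:
  assumes "length e = n"
  shows "(\<integral>t. of_bool (cell n t = e) \<partial>unit_lebesgue) = mass e"
    and "integrable unit_lebesgue (\<lambda>t. of_bool (cell n t = e) :: real)"
proof -
  interpret finite_measure unit_lebesgue by (rule finite_measure_unit)
  have meas: "(\<lambda>t. of_bool (cell n t = e) :: real) \<in> borel_measurable unit_lebesgue"
    using pred_cell[measurable] by (intro borel_measurable_unit) measurable
  then show "integrable unit_lebesgue (\<lambda>t. of_bool (cell n t = e) :: real)"
    by (intro integrable_const_bound[of _ 1]) auto
  have "AE t in unit_lebesgue. t \<in> space unit_lebesgue" by (rule AE_space)
  then have "AE t in unit_lebesgue. of_bool (cell n t = e) = (indicator {left e..<left e + mass e} t :: real)"
    using AE_unit_neq[of 1]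
  proof eventually_elim
    case (elim t)
    then have "0 \<le> t" "t < 1" by auto
    from cell_eq_iff[OF this assms] show ?case by (simp add: indicator_def)
  qed
  then have "(\<integral>t. of_bool (cell n t = e) \<partial>unit_lebesgue) =
      (\<integral>t. (indicator {left e..<left e + mass e} t :: real) \<partial>unit_lebesgue)"
    by (intro integral_cong_AE meas borel_measurable_unit borel_measurable_indicator) auto
  also have "\<dots> = mass e"
    using left_nonneg[of e] left_le_1[of e] mass_nonneg[of e] by (subst integral_unit_Ico) auto
  finally show "(\<integral>t. of_bool (cell n t = e) \<partial>unit_lebesgue) = mass e" .
qed

lemma integral_cyl:
  assumes \<sigma>: "\<sigma> \<in> cyl n"
  shows "integrable unit_lebesgue (\<lambda>t. \<sigma> (digits t))"
    and "(\<integral>t. \<sigma> (digits t) \<partial>unit_lebesgue) = (\<Sum>e | length e = n. \<sigma> (extend e) * mass e)"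
proof -
  have eq: "\<sigma> (digits t) = (\<Sum>e | length e = n. \<sigma> (extend e) * of_bool (cell n t = e))" for t
    using cyl_expand[OF \<sigma>, of "digits t"] by (simp add: pat_digits)
  show "integrable unit_lebesgue (\<lambda>t. \<sigma> (digits t))"
    unfolding eq by (intro Bochner_Integration.integrable_sum integrable_mult_right integral_cell) auto
  show "(\<integral>t. \<sigma> (digits t) \<partial>unit_lebesgue) = (\<Sum>e | length e = n. \<sigma> (extend e) * mass e)"
    unfolding eq by (subst Bochner_Integration.integral_sum)
      (auto intro!: integral_cell simp: integral_cell)
qed

lemma cyl_digits_Lp:
  assumes p: "1 \<le> p" and \<sigma>: "\<sigma> \<in> cyl n"
  shows "(\<lambda>t. \<sigma> (digits t)) \<in> Lp_funs p unit_lebesgue"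
    and "Lp_norm p unit_lebesgue (\<lambda>t. \<sigma> (digits t)) =
      (\<Sum>e | length e = n. \<bar>\<sigma> (extend e)\<bar> powr p * mass e) powr (1 / p)"
proof -
  have "(\<lambda>c. \<bar>\<sigma> c\<bar> powr p) \<in> cyl n" by (rule cyl_comp[OF \<sigma>])
  from integral_cyl[OF this] integral_cyl(1)[OF \<sigma>]
  show "(\<lambda>t. \<sigma> (digits t)) \<in> Lp_funs p unit_lebesgue"
    "Lp_norm p unit_lebesgue (\<lambda>t. \<sigma> (digits t)) =
      (\<Sum>e | length e = n. \<bar>\<sigma> (extend e)\<bar> powr p * mass e) powr (1 / p)"
    by (auto simp: Lp_funs_def Lp_norm_def)
qed

lemma cylinders_digits_Lp:
  "1 \<le> p \<Longrightarrow> \<sigma> \<in> cylinders \<Longrightarrow> (\<lambda>t. \<sigma> (digits t)) \<in> Lp_funs p unit_lebesgue"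
  using cyl_digits_Lp(1) by (auto simp: cylinders_def)

text \<open>
  Up to one cell, the half-line \<open>{..a}\<close> is a union of cells, so its indicator is approximated. A Dynkin
  argument extends this to Borel sets, and simple functions reach every element of \<open>L\<^sub>p\<close>.
\<close>

theorem cylinders_dense:
  assumes p: "1 \<le> p" and f: "f \<in> Lp_funs p unit_lebesgue" and "0 < \<epsilon>"
  shows "\<exists>\<sigma>\<in>cylinders. Lp_norm p unit_lebesgue (f - (\<lambda>t. \<sigma> (digits t))) < \<epsilon>"
proof -
  let ?U = "unit_lebesgue" and ?A = "\<lambda>\<sigma> t. \<sigma> (digits t) :: real"
  interpret fm: finite_measure ?U by (rule finite_measure_unit)
  interpret seminormed "Lp_funs p ?U" "Lp_norm p ?U" by (rule seminormed_Lp[OF p])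
  define D where "D = {f \<in> Lp_funs p ?U. \<forall>e>0. \<exists>\<sigma>\<in>cylinders. Lp_norm p ?U (f - ?A \<sigma>) < e}"
  have D: "subspace D"
    unfolding D_def
    by (rule subspace_closure[OF subspace_cylinders])
      (auto simp: cylinders_digits_Lp[OF p] fun_eq_iff)
  have closed: "f \<in> D"
    if f: "f \<in> Lp_funs p ?U" and s: "\<And>i :: nat. s i \<in> D" and lim: "(\<lambda>i. Lp_norm p ?U (f - s i)) \<longlonglongrightarrow> 0"
    for f s
  proof -
    have "\<exists>\<sigma>\<in>cylinders. Lp_norm p ?U (f - ?A \<sigma>) < e" if "0 < e" for e
    proof -
      have e: "0 < e / 2" using that by simp
      then obtain i where i: "Lp_norm p ?U (f - s i) < e / 2"
        using order_tendstoD(2)[OF lim e] unfolding eventually_sequentially by blast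
      obtain \<sigma> where \<sigma>: "\<sigma> \<in> cylinders" "Lp_norm p ?U (s i - ?A \<sigma>) < e / 2"
        using s[of i] e unfolding D_def by blast
      have "Lp_norm p ?U (f - ?A \<sigma>) \<le> Lp_norm p ?U (f - s i) + Lp_norm p ?U (s i - ?A \<sigma>)"
        using s[of i] by (intro N_diff_triangle f cylinders_digits_Lp[OF p] \<sigma>) (auto simp: D_def)
      then show ?thesis using i \<sigma> by (intro bexI[of _ \<sigma>]) auto
    qed
    then show ?thesis using f by (simp add: D_def)
  qed
  have bounded_Lp: "f \<in> Lp_funs p ?U" if "f \<in> borel_measurable ?U" "\<And>t. \<bar>f t\<bar> \<le> (C :: real)" for f C
  proof -
    have "integrable ?U (\<lambda>t. \<bar>f t\<bar> powr p)"
      using that p by (intro fm.integrable_const_bound[of _ "C powr p"]) (auto intro!: powr_mono2)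
    then show ?thesis using that by (simp add: Lp_funs_def)
  qed
  have ind_meas: "(indicator B :: real \<Rightarrow> real) \<in> borel_measurable ?U" if "B \<in> sets borel" for B
    using that by (intro borel_measurable_unit borel_measurable_indicator)
  have ind_Lp: "(indicator B :: real \<Rightarrow> real) \<in> Lp_funs p ?U" if "B \<in> sets borel" for B
    by (rule bounded_Lp[OF ind_meas[OF that], of 1]) (auto simp: indicator_def)
  have ind_int: "integrable ?U (indicator B :: real \<Rightarrow> real)" if "B \<in> sets borel" for B
    using ind_meas[OF that] by (intro fm.integrable_const_bound[of _ 1]) (auto simp: indicator_def)
  have half_line: "(indicator {..a} :: real \<Rightarrow> real) \<in> D" for a
  proof -
    have "\<exists>\<sigma>\<in>cylinders. Lp_norm p ?U (indicator {..a} - ?A \<sigma>) < e" if e: "0 < e" for e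
    proof -
      \<comment> \<open>The two indicators differ at most on the cell that contains \<open>a\<close>, and there only to the right of \<open>a\<close>.\<close>
      define d where "d = (e / 2) powr p"
      have d: "0 < d" using e by (simp add: d_def)
      obtain n where n: "\<And>e. length e = n \<Longrightarrow> mass e \<le> d" using mass_small[OF d] by blast
      define \<sigma> where "\<sigma> c = (of_bool (left (pat n c) \<le> a) :: real)" for c
      have \<sigma>: "\<sigma> \<in> cyl n" unfolding cyl_def \<sigma>_def by auto
      then have \<sigma>': "\<sigma> \<in> cylinders" by (auto simp: cylinders_def)
      have mem: "indicator {..a} - ?A \<sigma> \<in> Lp_funs p ?U"
        by (intro mem_diff ind_Lp cylinders_digits_Lp[OF p \<sigma>']) simp
      let ?J = "{max 0 a..<max 0 (min 1 (a + d))}"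
      have "AE t in ?U. t \<in> space ?U" by (rule AE_space)
      then have "AE t in ?U. \<bar>(indicator {..a} - ?A \<sigma>) t\<bar> powr p \<le> indicator ?J t"
        using AE_unit_neq[of 1] AE_unit_neq[of a]
      proof eventually_elim
        case (elim t)
        then have t: "0 \<le> t" "t < 1" by auto
        let ?e = "cell n t"
        have "left ?e \<le> t" "t < left ?e + mass ?e" using cell_eq_iff[OF t, of ?e n] by auto
        then have "left ?e \<le> t" "t < left ?e + d" using n[of ?e] by auto
        then show ?case
          using t elim p by (auto simp: \<sigma>_def pat_digits indicator_def)
      qed
      then have "(\<integral>t. \<bar>(indicator {..a} - ?A \<sigma>) t\<bar> powr p \<partial>?U) \<le> (\<integral>t. indicator ?J t \<partial>?U)"
        by (intro integral_mono_AE Lp_funsD(2)[OF mem] ind_int) simp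
      also have "\<dots> \<le> d"
      proof (cases "max 0 a \<le> max 0 (min 1 (a + d))")
        case True
        then show ?thesis using d by (subst integral_unit_Ico) auto
      next
        case False
        then have empty: "?J = {}" by auto
        show ?thesis unfolding empty using d by simp
      qed
      finally have "Lp_norm p ?U (indicator {..a} - ?A \<sigma>) \<le> d powr (1 / p)"
        unfolding Lp_norm_def using p by (intro powr_mono2) auto
      also have "\<dots> < e" using e p by (simp add: d_def powr_powr)
      finally show ?thesis using \<sigma>' by blast
    qed
    then show ?thesis using ind_Lp[of "{..a}"] by (simp add: D_def)
  qed
  have one: "(\<lambda>t. 1) \<in> D"
  proof -
    have "(\<lambda>c. 1) \<in> cyl 0" by (simp add: cyl_def)
    then have \<sigma>: "(\<lambda>c. 1) \<in> cylinders" by (auto simp: cylinders_def)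
    have "Lp_norm p ?U ((\<lambda>t. 1) - ?A (\<lambda>c. 1)) = 0" by (simp add: N_0)
    then show ?thesis using \<sigma> cylinders_digits_Lp[OF p \<sigma>] unfolding D_def by force
  qed
  have ind_D: "(indicator B :: real \<Rightarrow> real) \<in> D" if B: "B \<in> sets borel" for B
  proof -
    have "Int_stable (range (\<lambda>a. {..a::real}))"
      by (auto simp: Int_stable_def)
    moreover have "range (\<lambda>a. {..a::real}) \<subseteq> Pow UNIV" by auto
    moreover have "B \<in> sigma_sets UNIV (range (\<lambda>a. {..a::real}))"
      using B by (simp add: borel_eq_atMost sets_measure_of_conv)
    ultimately show ?thesis
    proof (induction rule: sigma_sets_induct_disjoint)
      case (basic A)
      then show ?case using half_line by auto
    next
      case empty
      then show ?case using subspace_0[OF D] by (simp add: zero_fun_def)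
    next
      case (compl A)
      have "(indicator (UNIV - A) :: real \<Rightarrow> real) = (\<lambda>t. 1) - indicator A"
        by (auto simp: indicator_def fun_eq_iff)
      then show ?case using subspace_diff[OF D one compl(2)] by (simp only:)
    next
      case (union A)
      have A_meas: "A i \<in> sets borel" for i
        using union(2) by (auto simp: borel_eq_atMost sets_measure_of_conv)
      let ?s = "\<lambda>i. \<Sum>j<i. (indicator (A j) :: real \<Rightarrow> real)"
      have s_eq: "?s i = indicator (\<Union>j<i. A j)" for i
      proof
        fix t
        have "disjoint_family_on A {..<i}" using union(1) by (auto simp: disjoint_family_on_def)
        then show "?s i t = indicator (\<Union>j<i. A j) t"
          by (simp add: sum_fun_apply indicator_UN_disjoint)
      qed
      show ?case
      proof (rule closed[where s = ?s])
        show "(indicator (\<Union> (range A)) :: real \<Rightarrow> real) \<in> Lp_funs p ?U" using A_meas by (intro ind_Lp) auto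
        show "?s i \<in> D" for i using union(3) by (intro subspace_sum[OF D]) auto
        show "(\<lambda>i. Lp_norm p ?U (indicator (\<Union> (range A)) - ?s i)) \<longlonglongrightarrow> 0"
          unfolding s_eq
        proof (rule Lp_norm_dominated_tendsto[OF p, where g = "\<lambda>t. 1"])
          show "(\<lambda>t. 1) \<in> Lp_funs p ?U" by (rule bounded_Lp[of _ 1]) auto
          fix t :: real
          show "(\<lambda>i. indicator (\<Union>j<i. A j) t) \<longlonglongrightarrow> (indicator (\<Union> (range A)) t :: real)"
            using LIMSEQ_indicator_UN[of A t] by (simp add: lessThan_def)
        qed (use A_meas in \<open>auto intro!: ind_meas simp: indicator_def\<close>)
      qed
    qed
  qed
  have borel_D: "g \<in> D" if g: "g \<in> borel_measurable borel" "g \<in> Lp_funs p ?U" for g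
  proof -
    obtain s :: "nat \<Rightarrow> real \<Rightarrow> real" where s: "\<And>i. simple_function borel (s i)"
        "\<And>x. (\<lambda>i. s i x) \<longlonglongrightarrow> g x" "\<And>i x. \<bar>s i x\<bar> \<le> 2 * \<bar>g x\<bar>"
      using borel_measurable_implies_sequence_metric[OF g(1), of 0] by (auto simp: dist_real_def)
    show ?thesis
    proof (rule closed[OF g(2)])
      fix i
      have "s i = (\<Sum>y\<in>range (s i). y *\<^sub>R (indicator (s i -` {y}) :: real \<Rightarrow> real))"
      proof
        fix t
        have fin: "finite (range (s i))" using simple_functionD(1)[OF s(1), of i] by simp
        have "(\<Sum>y\<in>range (s i). y *\<^sub>R (indicator (s i -` {y}) :: real \<Rightarrow> real)) t =
            (\<Sum>y\<in>range (s i). if y = s i t then y else 0)"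
          unfolding sum_fun_apply by (intro sum.cong) (auto simp: indicator_def)
        then show "s i t = (\<Sum>y\<in>range (s i). y *\<^sub>R (indicator (s i -` {y}) :: real \<Rightarrow> real)) t"
          using fin by simp
      qed
      also have "\<dots> \<in> D"
        using simple_functionD(2)[OF s(1), of i] by (intro subspace_sum[OF D] subspace_scale[OF D] ind_D) auto
      finally show "s i \<in> D" .
    next
      have "(\<lambda>t. 2 * \<bar>g t\<bar>) \<in> Lp_funs p ?U"
        using mem_scale[OF Lp_funs_abs[OF g(2)], of 2] by (simp add: scaleR_fun_def)
      then show "(\<lambda>i. Lp_norm p ?U (g - s i)) \<longlonglongrightarrow> 0"
        using s(2,3) borel_measurable_simple_function[OF s(1)] g(1)
        by (intro Lp_norm_dominated_tendsto[OF p, where g = "\<lambda>t. 2 * \<bar>g t\<bar>"] borel_measurable_unit) auto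
    qed
  qed
  obtain g where g: "g \<in> borel_measurable lborel" "AE t in lborel. (if t \<in> {0..1} then f t else 0) = g t"
    using completion_ex_borel_measurable_real[OF borel_measurable_if_I[OF Lp_funsD(1)[OF f]]] by auto
  have g_meas: "g \<in> borel_measurable ?U" using g(1) by (intro borel_measurable_unit) simp
  have "AE t in lebesgue. (if t \<in> {0..1} then f t else 0) = g t"
    by (rule AE_completion[OF g(2)])
  then have fg: "AE t in ?U. f t = g t"
    by (subst AE_restrict_space_iff) (auto elim: eventually_mono)
  then have "AE t in ?U. \<bar>g t\<bar> \<le> \<bar>f t\<bar>" by eventually_elim simp
  from Lp_dominated(1)[OF p g_meas f this] have g_Lp: "g \<in> Lp_funs p ?U" .
  then have "g \<in> D" using g(1) by (intro borel_D) auto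
  then obtain \<sigma> where \<sigma>: "\<sigma> \<in> cylinders" "Lp_norm p ?U (g - ?A \<sigma>) < \<epsilon>"
    using \<open>0 < \<epsilon>\<close> unfolding D_def by blast
  have "AE t in ?U. (f - ?A \<sigma>) t = (g - ?A \<sigma>) t" using fg by eventually_elim simp
  then have "Lp_norm p ?U (f - ?A \<sigma>) = Lp_norm p ?U (g - ?A \<sigma>)"
    by (intro Lp_norm_cong_AE Lp_funsD(1)[of _ p] mem_diff f g_Lp cylinders_digits_Lp[OF p \<sigma>(1)])
  then show ?thesis using \<sigma> by (intro bexI[of _ \<sigma>]) simp_all
qed

end

text \<open>
  Functions of the first \<open>n\<close> dyadic digits form a space isometric to \<open>\<ell>\<^sub>p\<close> of dimension \<open>2\<^sup>n\<close>, which sits on a line of \<open>X\<close>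
  inside \<open>\<ell>\<^sub>p(X)\<close>.
\<close>

lemma Lp_unit_finitely_representable:
  fixes x0 :: "'x::real_normed_vector"
  assumes p: "1 \<le> p" and x0: "x0 \<noteq> 0"
  shows "finitely_representable (Lp p unit_lebesgue) (ell_p p :: (nat \<Rightarrow> 'x) nspace)"
proof -
  let ?U = "unit_lebesgue"
  interpret seminormed "Lp_funs p ?U" "Lp_norm p ?U" by (rule seminormed_Lp[OF p])
  define mass :: "bool list \<Rightarrow> real" where "mass e = (1 / 2) ^ length e" for e
  interpret interval_code mass
  proof
    fix \<epsilon> :: real assume "0 < \<epsilon>"
    then obtain n where "(1 / 2 :: real) ^ n < \<epsilon>" using real_arch_pow_inv[of \<epsilon> "1 / 2"] by auto
    then show "\<exists>n. \<forall>e. length e = n \<longrightarrow> mass e \<le> \<epsilon>" by (intro exI[of _ n]) (auto simp: mass_def)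
  qed (auto simp: mass_def)
  define x1 where "x1 = (1 / norm x0) *\<^sub>R x0"
  have x1: "norm x1 = 1" using x0 by (simp add: x1_def)
  show ?thesis
  proof (rule finitely_representable_ell_p[OF presents_Lp[OF p] _ p])
    fix B \<delta> assume B: "finite B" "B \<subseteq> Lp_funs p ?U" and \<delta>: "(0 :: real) < \<delta>"
    define e where "e = \<delta> / (real (card B) + 1)"
    have e: "0 < e" using \<delta> by (simp add: e_def)
    have "\<exists>\<sigma>\<in>cylinders. Lp_norm p ?U (b - (\<lambda>t. \<sigma> (digits t))) < e" if "b \<in> B" for b
      using B that by (intro cylinders_dense[OF p _ e]) auto
    then obtain \<sigma> where \<sigma>: "\<And>b. b \<in> B \<Longrightarrow> \<sigma> b \<in> cylinders"
        "\<And>b. b \<in> B \<Longrightarrow> Lp_norm p ?U (b - (\<lambda>t. \<sigma> b (digits t))) < e"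
      by metis
    obtain n where n: "\<And>b. b \<in> B \<Longrightarrow> \<sigma> b \<in> cyl n" using finite_cylinders_level[OF B(1), of \<sigma>] \<sigma>(1) by blast
    define L where "L = card {e :: bool list. length e = n}"
    obtain h where h: "bij_betw h {..<L} {e :: bool list. length e = n}"
      using ex_bij_betw_nat_finite[OF finite_bool_lists[of n]] by (auto simp: L_def atLeast0LessThan)
    define \<phi> :: "(real \<Rightarrow> real) \<Rightarrow> nat \<Rightarrow> 'x"
      where "\<phi> b j = (if j < L then (\<sigma> b (extend (h j)) * mass (h j) powr (1 / p)) *\<^sub>R x1 else 0)" for b j
    have "\<bar>vnorm (ell_p p) (\<Sum>b\<in>B. c b *\<^sub>R \<phi> b) - Lp_norm p ?U (\<Sum>b\<in>B. c b *\<^sub>R b)\<bar> \<le> \<delta>"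
      if c: "\<forall>b\<in>B. \<bar>c b\<bar> \<le> 1" for c
    proof -
      define \<tau> where "\<tau> = (\<Sum>b\<in>B. c b *\<^sub>R \<sigma> b)"
      have \<tau>: "\<tau> \<in> cyl n"
      proof -
        have "\<tau> x = \<tau> y" if "pat n x = pat n y" for x y
          unfolding \<tau>_def sum_fun_apply scaleR_fun_apply
          by (intro sum.cong refl arg_cong[of _ _ "\<lambda>z. _ *\<^sub>R z"] cylD[OF n that])
        then show ?thesis unfolding cyl_def by blast
      qed
      have \<tau>_digits: "(\<lambda>t. \<tau> (digits t)) = (\<Sum>b\<in>B. c b *\<^sub>R (\<lambda>t. \<sigma> b (digits t)))"
        by (simp add: \<tau>_def sum_fun_apply fun_eq_iff)
      have "(\<Sum>b\<in>B. c b *\<^sub>R \<phi> b) j = (\<tau> (extend (h j)) * mass (h j) powr (1 / p)) *\<^sub>R x1" if "j < L" for j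
        using that by (simp add: sum_fun_apply \<phi>_def \<tau>_def scaleR_sum_left sum_distrib_right mult.assoc)
      then have "(\<Sum>j<L. norm ((\<Sum>b\<in>B. c b *\<^sub>R \<phi> b) j) powr p) = (\<Sum>j<L. \<bar>\<tau> (extend (h j))\<bar> powr p * mass (h j))"
        using p x1 mass_nonneg by (intro sum.cong) (auto simp: abs_mult powr_mult powr_powr)
      also have "\<dots> = (\<Sum>e | length e = n. \<bar>\<tau> (extend e)\<bar> powr p * mass e)"
        using sum.reindex_bij_betw[OF h, of "\<lambda>e. \<bar>\<tau> (extend e)\<bar> powr p * mass e"] by simp
      finally have "vnorm (ell_p p) (\<Sum>b\<in>B. c b *\<^sub>R \<phi> b) = Lp_norm p ?U (\<lambda>t. \<tau> (digits t))"
        unfolding cyl_digits_Lp(2)[OF p \<tau>]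
        by (subst finite_support_ell_p(2)[of L]) (simp_all add: sum_fun_apply \<phi>_def)
      moreover have "\<bar>Lp_norm p ?U (\<lambda>t. \<tau> (digits t)) - Lp_norm p ?U (\<Sum>b\<in>B. c b *\<^sub>R b)\<bar> \<le> \<delta>"
      proof -
        have mem: "b \<in> Lp_funs p ?U" "(\<lambda>t. \<sigma> b (digits t)) \<in> Lp_funs p ?U" if "b \<in> B" for b
          using that B \<sigma>(1) cylinders_digits_Lp[OF p] by auto
        have "\<bar>Lp_norm p ?U (\<Sum>b\<in>B. c b *\<^sub>R b) - Lp_norm p ?U (\<Sum>b\<in>B. c b *\<^sub>R (\<lambda>t. \<sigma> b (digits t)))\<bar>
            \<le> Lp_norm p ?U (\<Sum>b\<in>B. c b *\<^sub>R (b - (\<lambda>t. \<sigma> b (digits t))))"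
          unfolding scaleR_diff_right sum_subtractf by (intro abs_N_diff_le mem_sum mem_scale mem)
        also have "\<dots> \<le> (\<Sum>b\<in>B. Lp_norm p ?U (c b *\<^sub>R (b - (\<lambda>t. \<sigma> b (digits t)))))"
          by (intro N_sum mem_scale mem_diff mem)
        also have "\<dots> \<le> (\<Sum>b\<in>B. e)"
        proof (rule sum_mono)
          fix b assume b: "b \<in> B"
          have "Lp_norm p ?U (c b *\<^sub>R (b - (\<lambda>t. \<sigma> b (digits t)))) =
              \<bar>c b\<bar> * Lp_norm p ?U (b - (\<lambda>t. \<sigma> b (digits t)))"
            by (intro N_scale mem_diff mem b)
          also have "\<dots> \<le> 1 * e"
            using c b \<sigma>(2)[OF b] by (intro mult_mono) (auto simp: Lp_norm_nonneg)
          finally show "Lp_norm p ?U (c b *\<^sub>R (b - (\<lambda>t. \<sigma> b (digits t)))) \<le> e" by simp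
        qed
        also have "\<dots> \<le> \<delta>" using \<delta> by (simp add: e_def field_simps)
        finally show ?thesis unfolding \<tau>_digits by linarith
      qed
      ultimately show ?thesis by simp
    qed
    moreover have "\<forall>b\<in>B. \<forall>i\<ge>L. \<phi> b i = 0" by (simp add: \<phi>_def)
    ultimately show "\<exists>(\<phi> :: (real \<Rightarrow> real) \<Rightarrow> nat \<Rightarrow> 'x) L. (\<forall>b\<in>B. \<forall>i\<ge>L. \<phi> b i = 0) \<and>
        (\<forall>c. (\<forall>b\<in>B. \<bar>c b\<bar> \<le> 1) \<longrightarrow>
          \<bar>vnorm (ell_p p) (\<Sum>b\<in>B. c b *\<^sub>R \<phi> b) - Lp_norm p ?U (\<Sum>b\<in>B. c b *\<^sub>R b)\<bar> \<le> \<delta>)"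
      by blast
  qed
qed

section \<open>A weight for displacements in function spaces\<close>

lemma lift_Lp:
  assumes p: "1 \<le> p" and h: "h \<in> Lp_funs p M"
  shows "(\<lambda>z. h (fst z)) \<in> Lp_funs p (M \<Otimes>\<^sub>M unit_lebesgue)"
    and "Lp_norm p (M \<Otimes>\<^sub>M unit_lebesgue) (\<lambda>z. h (fst z)) = Lp_norm p M h"
proof -
  interpret U: finite_measure unit_lebesgue by (rule finite_measure_unit)
  note [measurable] = Lp_funsD(1)[OF h]
  have one: "emeasure unit_lebesgue {0..1} = 1" by (simp add: emeasure_restrict_space)
  have "(\<integral>\<^sup>+z. ennreal (\<bar>h (fst z)\<bar> powr p) \<partial>(M \<Otimes>\<^sub>M unit_lebesgue)) =
      (\<integral>\<^sup>+x. \<integral>\<^sup>+t. ennreal (\<bar>h x\<bar> powr p) \<partial>unit_lebesgue \<partial>M)"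
    by (subst U.nn_integral_fst[symmetric]) simp_all
  also have "\<dots> = (\<integral>\<^sup>+x. ennreal (\<bar>h x\<bar> powr p) \<partial>M)" by (simp add: one)
  also have "\<dots> = ennreal (Lp_norm p M h powr p)" by (rule nn_integral_Lp[OF p h])
  finally have eq: "(\<integral>\<^sup>+z. ennreal (\<bar>h (fst z)\<bar> powr p) \<partial>(M \<Otimes>\<^sub>M unit_lebesgue)) = ennreal (Lp_norm p M h powr p)" .
  show mem: "(\<lambda>z. h (fst z)) \<in> Lp_funs p (M \<Otimes>\<^sub>M unit_lebesgue)"
    by (rule Lp_funsI_nn_integral(1)[OF p _ Lp_norm_nonneg[of p M h]]) (simp_all add: eq)
  have "Lp_norm p (M \<Otimes>\<^sub>M unit_lebesgue) (\<lambda>z. h (fst z)) powr p = Lp_norm p M h powr p"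
    using eq nn_integral_Lp[OF p mem] by simp
  then have "(Lp_norm p (M \<Otimes>\<^sub>M unit_lebesgue) (\<lambda>z. h (fst z)) powr p) powr (1 / p) =
      (Lp_norm p M h powr p) powr (1 / p)" by simp
  then show "Lp_norm p (M \<Otimes>\<^sub>M unit_lebesgue) (\<lambda>z. h (fst z)) = Lp_norm p M h"
    using p by (simp only: powr_powr) (simp add: Lp_norm_nonneg)
qed

text \<open>
  The extra coordinate is independent of \<open>h\<close>, so a strip of width \<open>2 \<delta>\<close> carries at most that proportion of the
  integral.
\<close>

lemma integral_strip_le:
  assumes p: "1 \<le> p" and h: "h \<in> Lp_funs p M" and \<delta>: "0 \<le> \<delta>"
  shows "(\<integral>z. of_bool (\<bar>snd z - s\<bar> \<le> \<delta>) * \<bar>h (fst z)\<bar> powr p \<partial>(M \<Otimes>\<^sub>M unit_lebesgue))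
           \<le> 2 * \<delta> * Lp_norm p M h powr p"
    and "integrable (M \<Otimes>\<^sub>M unit_lebesgue) (\<lambda>z. of_bool (\<bar>snd z - s\<bar> \<le> \<delta>) * \<bar>h (fst z)\<bar> powr p)"
proof -
  interpret U: finite_measure unit_lebesgue by (rule finite_measure_unit)
  let ?MU = "M \<Otimes>\<^sub>M unit_lebesgue"
  note [measurable] = Lp_funsD(1)[OF h]
  have [measurable]: "(\<lambda>t. t :: real) \<in> borel_measurable unit_lebesgue"
    by (intro borel_measurable_unit) simp
  have [measurable]: "(\<lambda>z. snd z :: real) \<in> borel_measurable ?MU"
    by (rule measurable_compose[OF measurable_snd]) simp
  have meas: "(\<lambda>z. of_bool (\<bar>snd z - s\<bar> \<le> \<delta>) * \<bar>h (fst z)\<bar> powr p) \<in> borel_measurable ?MU"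
    by measurable
  have strip: "emeasure unit_lebesgue {t \<in> {0..1}. \<bar>t - s\<bar> \<le> \<delta>} \<le> ennreal (2 * \<delta>)"
  proof -
    have "{t \<in> {0..1}. \<bar>t - s\<bar> \<le> \<delta>} = {max 0 (s - \<delta>)..min 1 (s + \<delta>)}" by auto
    then have "emeasure unit_lebesgue {t \<in> {0..1}. \<bar>t - s\<bar> \<le> \<delta>} = emeasure lebesgue {max 0 (s - \<delta>)..min 1 (s + \<delta>)}"
      by (simp add: emeasure_restrict_space)
    also have "\<dots> \<le> emeasure lebesgue {s - \<delta>..s + \<delta>}" by (intro emeasure_mono) auto
    also have "\<dots> = ennreal (2 * \<delta>)" using \<delta> by simp
    finally show ?thesis .
  qed
  have inner: "(\<integral>\<^sup>+t. ennreal (of_bool (\<bar>t - s\<bar> \<le> \<delta>) * c) \<partial>unit_lebesgue) \<le> ennreal (2 * \<delta>) * ennreal c"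
    if "0 \<le> c" for c
  proof -
    have sets: "{t \<in> {0..1}. \<bar>t - s\<bar> \<le> \<delta>} \<in> sets unit_lebesgue"
    proof -
      have "{t \<in> space unit_lebesgue. \<bar>t - s\<bar> \<le> \<delta>} \<in> sets unit_lebesgue" by measurable
      then show ?thesis by simp
    qed
    have "(\<integral>\<^sup>+t. ennreal (of_bool (\<bar>t - s\<bar> \<le> \<delta>) * c) \<partial>unit_lebesgue) =
        (\<integral>\<^sup>+t. ennreal c * indicator {t \<in> {0..1}. \<bar>t - s\<bar> \<le> \<delta>} t \<partial>unit_lebesgue)"
      by (intro nn_integral_cong) (auto simp: indicator_def)
    also have "\<dots> = ennreal c * emeasure unit_lebesgue {t \<in> {0..1}. \<bar>t - s\<bar> \<le> \<delta>}"
      by (rule nn_integral_cmult_indicator[OF sets])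
    also have "\<dots> \<le> ennreal c * ennreal (2 * \<delta>)" by (intro mult_left_mono strip) simp
    finally show ?thesis by (simp add: mult.commute)
  qed
  have "(\<integral>\<^sup>+z. ennreal (of_bool (\<bar>snd z - s\<bar> \<le> \<delta>) * \<bar>h (fst z)\<bar> powr p) \<partial>?MU) =
      (\<integral>\<^sup>+x. \<integral>\<^sup>+t. ennreal (of_bool (\<bar>t - s\<bar> \<le> \<delta>) * \<bar>h x\<bar> powr p) \<partial>unit_lebesgue \<partial>M)"
    using meas by (subst U.nn_integral_fst[symmetric]) simp_all
  also have "\<dots> \<le> (\<integral>\<^sup>+x. ennreal (2 * \<delta>) * ennreal (\<bar>h x\<bar> powr p) \<partial>M)"
    by (intro nn_integral_mono inner) simp
  also have "\<dots> = ennreal (2 * \<delta>) * (\<integral>\<^sup>+x. ennreal (\<bar>h x\<bar> powr p) \<partial>M)"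
    by (intro nn_integral_cmult) measurable
  also have "\<dots> = ennreal (2 * \<delta> * Lp_norm p M h powr p)"
    using \<delta> by (simp add: nn_integral_Lp[OF p h] ennreal_mult)
  finally have le: "(\<integral>\<^sup>+z. ennreal (of_bool (\<bar>snd z - s\<bar> \<le> \<delta>) * \<bar>h (fst z)\<bar> powr p) \<partial>?MU)
      \<le> ennreal (2 * \<delta> * Lp_norm p M h powr p)" .
  show int: "integrable ?MU (\<lambda>z. of_bool (\<bar>snd z - s\<bar> \<le> \<delta>) * \<bar>h (fst z)\<bar> powr p)"
    using le_less_trans[OF le ennreal_less_top] meas by (intro integrableI_bounded) auto
  show "(\<integral>z. of_bool (\<bar>snd z - s\<bar> \<le> \<delta>) * \<bar>h (fst z)\<bar> powr p \<partial>?MU) \<le> 2 * \<delta> * Lp_norm p M h powr p"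
    using le \<delta> nn_integral_eq_integral[OF int] by simp
qed

text \<open>
  Used with the events \<open>r < u\<close>: a bounded number is determined up to \<open>\<delta>\<close> by finitely many rational
  comparisons.
\<close>

lemma rational_grid:
  fixes B \<delta> :: real
  assumes "0 < \<delta>"
  shows "\<exists>Q. finite Q \<and> Q \<subseteq> \<rat> \<and>
    (\<forall>u v. \<bar>u\<bar> \<le> B \<longrightarrow> \<bar>v\<bar> \<le> B \<longrightarrow> (\<forall>r\<in>Q. r < u \<longleftrightarrow> r < v) \<longrightarrow> \<bar>u - v\<bar> \<le> \<delta>)"
proof -
  obtain d where d: "d \<in> \<rat>" "0 < d" "d < \<delta>" using Rats_dense_in_real[OF assms] by auto
  define L where "L = \<lceil>\<bar>B\<bar> / d\<rceil> + 1"
  define Q where "Q = (\<lambda>k. real_of_int k * d) ` {- L..L}"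
  have step: "v - u \<le> \<delta>"
    if uv: "\<bar>u\<bar> \<le> B" "\<bar>v\<bar> \<le> B" "\<forall>r\<in>Q. r < u \<longleftrightarrow> r < v" for u v
  proof (rule ccontr)
    assume "\<not> v - u \<le> \<delta>"
    then have "d < v - u" using d by simp
    define k where "k = \<lceil>v / d\<rceil> - 1"
    have k: "real_of_int k < v / d" "v / d \<le> real_of_int k + 1" unfolding k_def by linarith+
    then have kd: "real_of_int k * d < v" "v \<le> (real_of_int k + 1) * d"
      using d by (simp_all add: field_simps)
    then have "u < real_of_int k * d" using \<open>d < v - u\<close> by (simp add: distrib_right)
    moreover have "k \<in> {- L..L}"
    proof -
      have "\<bar>v\<bar> / d \<le> \<bar>B\<bar> / d" using uv d by (intro divide_right_mono) auto
      then have "\<bar>v / d\<bar> \<le> \<bar>B\<bar> / d" using d by (simp add: abs_divide)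
      moreover have "\<bar>B\<bar> / d \<le> real_of_int \<lceil>\<bar>B\<bar> / d\<rceil>" by (rule le_of_int_ceiling)
      ultimately have "real_of_int (- L) \<le> real_of_int k" "real_of_int k \<le> real_of_int L"
        using k unfolding L_def by linarith+
      then show ?thesis by simp
    qed
    ultimately show False using uv(3) kd unfolding Q_def by force
  qed
  have "\<bar>u - v\<bar> \<le> \<delta>" if "\<bar>u\<bar> \<le> B" "\<bar>v\<bar> \<le> B" "\<forall>r\<in>Q. r < u \<longleftrightarrow> r < v" for u v
    using step[OF that] step[of v u] that by fastforce
  moreover have "finite Q" "Q \<subseteq> \<rat>" using d by (auto simp: Q_def)
  ultimately show ?thesis by blast
qed

text \<open>
  The values are functions on \<open>M\<close>. They are also read as functions on the product of \<open>M\<close> with the unit interval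
  that do not depend on the second coordinate; facts about the latter reading carry the prefix \<open>L\<close>.
\<close>

locale function_displacement =
  averaged_displacement G m "Lp_funs p M" "Lp_norm p M" p f K
  for G :: "('g, 'b) monoid_scheme" (structure) and m and M :: "'m measure" and p :: real
    and f :: "'g \<Rightarrow> 'm \<Rightarrow> real" and K :: "'g \<Rightarrow> real" +
  assumes countable_G: "countable (carrier G)"
begin

abbreviation MU :: "('m \<times> real) measure" where
  "MU \<equiv> M \<Otimes>\<^sub>M unit_lebesgue"

sublocale L: averaged_displacement G m "Lp_funs p MU" "Lp_norm p MU" p "\<lambda>g z. f g (fst z)" K
proof (intro averaged_displacement.intro averaged.intro averaged_axioms.intro
    averaged_displacement_axioms.intro)
  show "mean_group G m" by unfold_locales
  show "seminormed (Lp_funs p MU) (Lp_norm p MU)" by (rule seminormed_Lp[OF p])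
  show "1 \<le> p" by (rule p)
  show "(\<lambda>z. f g (fst z)) \<in> Lp_funs p MU" if "g \<in> carrier G" for g
    by (rule lift_Lp(1)[OF p f_mem[OF that]])
  fix x g assume "x \<in> carrier G" "g \<in> carrier G"
  then have "f (inv x \<otimes> g) - f (inv x) \<in> Lp_funs p M" by (intro U.mem_diff f_mem) auto
  from lift_Lp(2)[OF p this] displacement_bound[of x g]
  show "Lp_norm p MU ((\<lambda>z. f (inv x \<otimes> g) (fst z)) - (\<lambda>z. f (inv x) (fst z))) \<le> K g"
    using \<open>x \<in> carrier G\<close> \<open>g \<in> carrier G\<close> by (simp add: fun_diff_def)
qed

lemma L_disp: "L.disp g x = (\<lambda>z. disp g x (fst z))"
  by (auto simp: L.disp_def disp_def fun_eq_iff)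

definition elt :: "nat \<Rightarrow> 'g" where
  "elt = from_nat_into (carrier G)"

text \<open>
  Normalised such that the \<open>j\<close>-th term of the weight has norm at most \<open>2\<^sup>-\<^sup>j\<close> at every base point.
\<close>

definition coeff :: "nat \<Rightarrow> real" where
  "coeff j = (1 / 2) ^ j / (1 + \<bar>K (elt j)\<bar>)"

definition weight :: "'g \<Rightarrow> 'm \<Rightarrow> real" where
  "weight x \<omega> = (\<Sum>j. \<bar>coeff j * disp (elt j) x \<omega>\<bar>)"

definition index :: "'g \<Rightarrow> nat" where
  "index = to_nat_on (carrier G)"

text \<open>
  The quotient \<open>disp g / weight\<close>. The condition fails on null sets only; the value \<open>0\<close> there makes the quotient
  bounded everywhere.
\<close>

definition ratio :: "'g \<Rightarrow> 'g \<Rightarrow> 'm \<Rightarrow> real" where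
  "ratio g x \<omega> = (if coeff (index g) * \<bar>disp g x \<omega>\<bar> \<le> weight x \<omega> then disp g x \<omega> / weight x \<omega> else 0)"

lemma elt_mem: "elt j \<in> carrier G"
  unfolding elt_def by (rule from_nat_into) auto

lemma elt_index: "g \<in> carrier G \<Longrightarrow> elt (index g) = g"
  unfolding elt_def index_def by (rule from_nat_into_to_nat_on[OF countable_G])

lemma coeff_pos: "0 < coeff j"
  by (simp add: coeff_def add_pos_nonneg)

lemma disp_Lp: "g \<in> carrier G \<Longrightarrow> x \<in> carrier G \<Longrightarrow> disp g x \<in> Lp_funs p M"
  using VD(2)[OF disp_V] .

context
  fixes x assumes x: "x \<in> carrier G"
begin

lemma term_Lp: "(\<lambda>\<omega>. coeff j * disp (elt j) x \<omega>) \<in> Lp_funs p M"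
  using U.mem_scale[OF disp_Lp[OF elt_mem x], of "coeff j" j] by (simp add: scaleR_fun_def)

lemma term_norm: "Lp_norm p M (\<lambda>\<omega>. coeff j * disp (elt j) x \<omega>) \<le> (1 / 2) ^ j"
proof -
  have "Lp_norm p M (\<lambda>\<omega>. coeff j * disp (elt j) x \<omega>) = coeff j * Lp_norm p M (disp (elt j) x)"
    using U.N_scale[OF disp_Lp[OF elt_mem x], of "coeff j" j] coeff_pos[of j] by (simp add: scaleR_fun_def)
  also have "\<dots> \<le> coeff j * (1 + \<bar>K (elt j)\<bar>)"
    using n_disp_le[OF elt_mem x, of j] coeff_pos[of j] by (intro mult_left_mono) auto
  also have "\<dots> = (1 / 2) ^ j"
  proof -
    have "1 + \<bar>K (elt j)\<bar> \<noteq> 0" by (metis abs_ge_zero add_nonneg_eq_0_iff zero_le_one zero_neq_one)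
    then show ?thesis by (simp add: coeff_def)
  qed
  finally show ?thesis .
qed

lemma term_summable: "summable (\<lambda>j. Lp_norm p M (\<lambda>\<omega>. coeff j * disp (elt j) x \<omega>))"
  by (rule summable_comparison_test'[OF summable_geometric[of "1 / 2 :: real"], of 0])
    (simp_all add: term_norm Lp_norm_nonneg)

lemma term_tail: "(\<Sum>j. Lp_norm p M (\<lambda>\<omega>. coeff (j + n) * disp (elt (j + n)) x \<omega>)) \<le> 2 * (1 / 2) ^ n"
proof -
  have geo: "summable (\<lambda>k. (1 / 2 :: real) ^ k)" by (rule summable_geometric) simp
  have "(\<Sum>j. Lp_norm p M (\<lambda>\<omega>. coeff (j + n) * disp (elt (j + n)) x \<omega>)) \<le> (\<Sum>j. (1 / 2) ^ n * (1 / 2) ^ j)"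
  proof (rule suminf_le)
    show "Lp_norm p M (\<lambda>\<omega>. coeff (j + n) * disp (elt (j + n)) x \<omega>) \<le> (1 / 2) ^ n * (1 / 2) ^ j" for j
      using term_norm[of "j + n"] by (simp add: power_add mult.commute)
    show "summable (\<lambda>j. Lp_norm p M (\<lambda>\<omega>. coeff (j + n) * disp (elt (j + n)) x \<omega>))"
      using term_summable by (rule summable_ignore_initial_segment)
  qed (use geo in auto)
  also have "\<dots> = 2 * (1 / 2) ^ n"
    using geo by (subst suminf_mult) (auto simp: suminf_geometric)
  finally show ?thesis .
qed

lemma weight_Lp: "weight x \<in> Lp_funs p M"
  using Lp_suminf_abs(2)[OF p term_Lp term_summable] by (simp add: weight_def[abs_def])

lemma weight_norm: "Lp_norm p M (weight x) \<le> 2"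
  using Lp_suminf_abs(3)[OF p term_Lp term_summable] term_tail[of 0] by (simp add: weight_def[abs_def])

lemma weight_tail:
  "Lp_norm p M (weight x - (\<Sum>j<n. (\<lambda>\<omega>. \<bar>coeff j * disp (elt j) x \<omega>\<bar>))) \<le> 2 * (1 / 2) ^ n"
  using Lp_suminf_tail(2)[OF p, of "\<lambda>j \<omega>. \<bar>coeff j * disp (elt j) x \<omega>\<bar>", OF Lp_funs_abs[OF term_Lp], of n]
    term_summable term_tail[of n]
  unfolding Lp_norm_abs weight_def[abs_def] by linarith

lemma weight_ge: "AE \<omega> in M. \<forall>j. coeff j * \<bar>disp (elt j) x \<omega>\<bar> \<le> weight x \<omega>"
  using Lp_suminf_abs(1)[OF p term_Lp term_summable]
proof eventually_elim
  case (elim \<omega>)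
  show ?case
  proof
    fix j
    have "(\<Sum>i\<in>{j}. \<bar>coeff i * disp (elt i) x \<omega>\<bar>) \<le> weight x \<omega>"
      unfolding weight_def using elim by (intro sum_le_suminf) auto
    then show "coeff j * \<bar>disp (elt j) x \<omega>\<bar> \<le> weight x \<omega>"
      using coeff_pos[of j] by (simp add: abs_mult)
  qed
qed

lemma weight_nonneg: "AE \<omega> in M. 0 \<le> weight x \<omega>"
  using weight_ge
proof eventually_elim
  case (elim \<omega>)
  have "0 \<le> coeff 0 * \<bar>disp (elt 0) x \<omega>\<bar>" using coeff_pos[of 0] by (intro mult_nonneg_nonneg) auto
  then show ?case using elim[rule_format, of 0] by linarith
qed

lemma ratio_measurable: "g \<in> carrier G \<Longrightarrow> ratio g x \<in> borel_measurable M"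
  using Lp_funsD(1)[OF disp_Lp[OF _ x], of g] Lp_funsD(1)[OF weight_Lp]
  unfolding ratio_def[abs_def] by measurable

lemma ratio_times_weight:
  assumes g: "g \<in> carrier G"
  shows "AE \<omega> in M. disp g x \<omega> = ratio g x \<omega> * weight x \<omega>"
  using weight_ge
proof eventually_elim
  case (elim \<omega>)
  then have le: "coeff (index g) * \<bar>disp g x \<omega>\<bar> \<le> weight x \<omega>"
    using elt_index[OF g] by (auto dest: spec[of _ "index g"])
  show ?case
  proof (cases "weight x \<omega> = 0")
    case True
    then have "\<bar>disp g x \<omega>\<bar> \<le> 0" using le coeff_pos[of "index g"] by (simp add: mult_le_0_iff)
    then show ?thesis using True by simp
  next
    case False
    then show ?thesis using le by (simp add: ratio_def)
  qed
qed

end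

lemma ratio_le: "\<bar>ratio g x \<omega>\<bar> \<le> 1 / coeff (index g)"
proof -
  have c: "0 < coeff (index g)" by (rule coeff_pos)
  show ?thesis
  proof (cases "coeff (index g) * \<bar>disp g x \<omega>\<bar> \<le> weight x \<omega> \<and> weight x \<omega> \<noteq> 0")
    case True
    then have "0 \<le> weight x \<omega>" using c by (meson abs_ge_zero less_imp_le mult_nonneg_nonneg order_trans)
    with True c show ?thesis by (simp add: ratio_def field_simps)
  next
    case False
    then show ?thesis using c by (auto simp: ratio_def)
  qed
qed

text \<open>
  The first family contains all translates of the level sets of the ratios. The events \<open>r < snd z\<close> are
  translation-invariant and force the masses of the cells to be small.
\<close>

definition events :: "('g \<Rightarrow> 'm \<times> real \<Rightarrow> bool) set" where
  "events = (\<lambda>(h, g, r) x z. r < ratio g (inv h \<otimes> x) (fst z)) ` (carrier G \<times> carrier G \<times> \<rat>) \<union>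
            (\<lambda>r x z. r < snd z) ` \<rat>"

definition code :: "'g \<Rightarrow> 'm \<times> real \<Rightarrow> nat \<Rightarrow> bool" where
  "code x z i = from_nat_into events i x z"

lemma countable_events: "countable events"
  unfolding events_def using countable_G countable_rat by auto

lemma event_mem: "from_nat_into events i \<in> events"
  by (rule from_nat_into) (auto simp: events_def intro: Rats_0)

lemma event_index:
  assumes "E \<in> events" obtains i where "\<And>x z. code x z i = E x z"
  using from_nat_into_surj[OF countable_events assms] that unfolding code_def by metis

lemma code_measurable:
  assumes x: "x \<in> carrier G"
  shows "Measurable.pred MU (\<lambda>z. code x z i)"
proof -
  have "from_nat_into events i \<in> events" by (rule event_mem)
  then consider h g r where "h \<in> carrier G" "g \<in> carrier G"
      "from_nat_into events i = (\<lambda>x z. r < ratio g (inv h \<otimes> x) (fst z))"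
    | r where "from_nat_into events i = (\<lambda>x z. r < snd z)"
    unfolding events_def by auto
  then show ?thesis
  proof cases
    case 1
    then have [measurable]: "ratio g (inv h \<otimes> x) \<in> borel_measurable M"
      using x by (intro ratio_measurable) auto
    show ?thesis unfolding code_def 1(3) by measurable
  next
    case 2
    have "(\<lambda>t. t :: real) \<in> borel_measurable unit_lebesgue" by (intro borel_measurable_unit) simp
    then have [measurable]: "(\<lambda>z. snd z :: real) \<in> borel_measurable MU"
      by (rule measurable_compose[OF measurable_snd])
    show ?thesis unfolding code_def 2 by measurable
  qed
qed

lemma pat_code_measurable:
  assumes x: "x \<in> carrier G"
  shows "Measurable.pred MU (\<lambda>z. pat n (code x z) = e)"
proof (induction n arbitrary: e)
  case (Suc n)
  note [measurable] = Suc code_measurable[OF x]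
  show ?case by (cases e) simp_all
qed simp

lemma cyl_code_measurable:
  assumes x: "x \<in> carrier G" and \<sigma>: "\<sigma> \<in> cyl n"
  shows "(\<lambda>z. \<sigma> (code x z)) \<in> borel_measurable MU"
proof -
  note [measurable] = pat_code_measurable[OF x]
  have "(\<lambda>z. \<sigma> (code x z)) = (\<lambda>z. \<Sum>e | length e = n. \<sigma> (extend e) * of_bool (pat n (code x z) = e))"
    by (rule ext) (rule cyl_expand[OF \<sigma>])
  then show ?thesis by simp
qed

text \<open>
  Translation permutes the events into one another, hence only reindexes the bits of the code.
\<close>

lemma cylinders_translate:
  assumes k: "k \<in> carrier G" and \<sigma>: "\<sigma> \<in> cylinders"
  shows "\<exists>\<sigma>'\<in>cylinders. \<forall>x\<in>carrier G. \<forall>z. \<sigma> (code (inv k \<otimes> x) z) = \<sigma>' (code x z)"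
proof -
  have "\<exists>j. \<forall>x\<in>carrier G. \<forall>z. code (inv k \<otimes> x) z i = code x z j" for i
  proof -
    have "from_nat_into events i \<in> events" by (rule event_mem)
    then consider h g r where "h \<in> carrier G" "g \<in> carrier G" "r \<in> \<rat>"
        "from_nat_into events i = (\<lambda>x z. r < ratio g (inv h \<otimes> x) (fst z))"
      | r where "r \<in> \<rat>" "from_nat_into events i = (\<lambda>x z. r < snd z)"
      unfolding events_def by auto
    then show ?thesis
    proof cases
      case 1
      have "(\<lambda>x z. r < ratio g (inv (k \<otimes> h) \<otimes> x) (fst z)) \<in> events"
        unfolding events_def using 1 k by (intro UnI1 image_eqI[of _ _ "(k \<otimes> h, g, r)"]) auto
      then obtain j where "\<And>x z. code x z j = (r < ratio g (inv (k \<otimes> h) \<otimes> x) (fst z))"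
        by (rule event_index) blast
      then show ?thesis
        using 1 k by (intro exI[of _ j]) (auto simp: code_def inv_mult_group m_assoc)
    next
      case 2
      then show ?thesis by (intro exI[of _ i]) (simp add: code_def)
    qed
  qed
  then obtain t where t: "\<And>i x z. x \<in> carrier G \<Longrightarrow> code (inv k \<otimes> x) z i = code x z (t i)" by metis
  obtain n where n: "\<sigma> \<in> cyl n" using \<sigma> by (auto simp: cylinders_def)
  define N where "N = Suc (\<Sum>i<n. t i)"
  have tN: "t i < N" if "i < n" for i
    unfolding N_def using that by (intro le_imp_less_Suc member_le_sum) auto
  have "(\<lambda>c. \<sigma> (\<lambda>i. c (t i))) \<in> cyl N"
    unfolding cyl_def mem_Collect_eq pat_eq_iff
    by (intro allI impI cylD[OF n]) (auto simp: pat_eq_iff tN)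
  moreover have "code (inv k \<otimes> x) z = (\<lambda>i. code x z (t i))" if "x \<in> carrier G" for x z
    by (rule ext) (rule t[OF that])
  ultimately show ?thesis
    by (intro bexI[of _ "\<lambda>c. \<sigma> (\<lambda>i. c (t i))"]) (auto simp: cylinders_def)
qed

text \<open>
  Uniform continuity with respect to the code: steady functions are the uniform limits of functions of
  finitely many bits.
\<close>

definition steady :: "('g \<Rightarrow> 'm \<times> real \<Rightarrow> real) \<Rightarrow> bool" where
  "steady \<theta> \<longleftrightarrow> (\<forall>\<delta>>0. \<exists>n. \<forall>x\<in>carrier G. \<forall>y\<in>carrier G. \<forall>z w.
     pat n (code x z) = pat n (code y w) \<longrightarrow> \<bar>\<theta> x z - \<theta> y w\<bar> \<le> \<delta>)"

lemma steadyE: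
  assumes "steady \<theta>" "0 < \<delta>"
  obtains n where "\<And>k x y z w. n \<le> k \<Longrightarrow> x \<in> carrier G \<Longrightarrow> y \<in> carrier G \<Longrightarrow>
    pat k (code x z) = pat k (code y w) \<Longrightarrow> \<bar>\<theta> x z - \<theta> y w\<bar> \<le> \<delta>"
proof -
  obtain n where n: "\<forall>x\<in>carrier G. \<forall>y\<in>carrier G. \<forall>z w.
      pat n (code x z) = pat n (code y w) \<longrightarrow> \<bar>\<theta> x z - \<theta> y w\<bar> \<le> \<delta>"
    using assms unfolding steady_def by blast
  have "pat n c = pat n d" if "n \<le> k" "pat k c = pat k d" for k c d
    using that by (auto simp: pat_eq_iff)
  then show ?thesis using n by (intro that[of n]) blast
qed

lemma steadyI:
  assumes "\<And>\<delta>. 0 < \<delta> \<Longrightarrow> \<exists>n. \<forall>x\<in>carrier G. \<forall>y\<in>carrier G. \<forall>z w.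
     pat n (code x z) = pat n (code y w) \<longrightarrow> \<bar>\<theta> x z - \<theta> y w\<bar> \<le> \<delta>"
  shows "steady \<theta>"
  using assms unfolding steady_def by blast

text \<open>
  Finitely many events are decided by a long enough initial piece of the code.
\<close>

lemma events_separate:
  assumes "finite Q" and "\<forall>r\<in>Q. E r \<in> events"
  shows "\<exists>n. \<forall>x y z w. pat n (code x z) = pat n (code y w) \<longrightarrow> (\<forall>r\<in>Q. E r x z = E r y w)"
  using assms
proof (induction Q)
  case (insert r Q)
  then obtain n where n: "\<forall>x y z w. pat n (code x z) = pat n (code y w) \<longrightarrow> (\<forall>r\<in>Q. E r x z = E r y w)"
    by blast
  have "E r \<in> events" using insert.prems by blast
  then obtain i where i: "\<And>x z. code x z i = E r x z" by (rule event_index) blast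
  have "E s x z = E s y w"
    if "pat (max n (Suc i)) (code x z) = pat (max n (Suc i)) (code y w)" "s \<in> insert r Q" for x y z w s
  proof -
    have "pat n (code x z) = pat n (code y w)" "code x z i = code y w i"
      using that(1) by (auto simp: pat_eq_iff)
    then show ?thesis using n that(2) i by blast
  qed
  then show ?case by blast
qed simp

lemma steady_ratio:
  assumes g: "g \<in> carrier G"
  shows "steady (\<lambda>x z. ratio g x (fst z))"
proof (rule steadyI)
  fix \<delta> :: real assume "0 < \<delta>"
  obtain Q where Q: "finite Q" "Q \<subseteq> \<rat>"
    "\<forall>u v. \<bar>u\<bar> \<le> 1 / coeff (index g) \<longrightarrow> \<bar>v\<bar> \<le> 1 / coeff (index g) \<longrightarrow> (\<forall>r\<in>Q. r < u \<longleftrightarrow> r < v) \<longrightarrow> \<bar>u - v\<bar> \<le> \<delta>"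
    using rational_grid[OF \<open>0 < \<delta>\<close>, of "1 / coeff (index g)"] by (elim exE conjE)
  let ?E = "\<lambda>r x z. r < ratio g (inv \<one> \<otimes> x) (fst z)"
  have E: "\<forall>r\<in>Q. ?E r \<in> events"
  proof
    fix r assume "r \<in> Q"
    then show "?E r \<in> events"
      unfolding events_def using Q(2) g by (intro UnI1 image_eqI[of _ _ "(\<one>, g, r)"]) auto
  qed
  obtain n where n: "\<forall>x y z w. pat n (code x z) = pat n (code y w) \<longrightarrow> (\<forall>r\<in>Q. ?E r x z = ?E r y w)"
    using events_separate[OF Q(1) E] by (elim exE)
  have "\<bar>ratio g x (fst z) - ratio g y (fst w)\<bar> \<le> \<delta>"
    if xy: "x \<in> carrier G" "y \<in> carrier G" and eq: "pat n (code x z) = pat n (code y w)" for x y z w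
  proof (rule Q(3)[rule_format])
    fix r assume "r \<in> Q"
    then show "r < ratio g x (fst z) \<longleftrightarrow> r < ratio g y (fst w)" using n[rule_format, OF eq] xy by auto
  qed (rule ratio_le)+
  then show "\<exists>n. \<forall>x\<in>carrier G. \<forall>y\<in>carrier G. \<forall>z w.
      pat n (code x z) = pat n (code y w) \<longrightarrow> \<bar>ratio g x (fst z) - ratio g y (fst w)\<bar> \<le> \<delta>" by blast
qed

lemma steady_diff:
  assumes "steady \<theta>" "steady \<eta>"
  shows "steady (\<lambda>x z. \<theta> x z - \<eta> x z)"
proof (rule steadyI)
  fix \<delta> :: real assume "0 < \<delta>"
  then have "0 < \<delta> / 2" by simp
  obtain j where j: "\<And>k x y z w. j \<le> k \<Longrightarrow> x \<in> carrier G \<Longrightarrow> y \<in> carrier G \<Longrightarrow>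
      pat k (code x z) = pat k (code y w) \<Longrightarrow> \<bar>\<theta> x z - \<theta> y w\<bar> \<le> \<delta> / 2"
    by (rule steadyE[OF assms(1) \<open>0 < \<delta> / 2\<close>]) (rule that)
  obtain l where l: "\<And>k x y z w. l \<le> k \<Longrightarrow> x \<in> carrier G \<Longrightarrow> y \<in> carrier G \<Longrightarrow>
      pat k (code x z) = pat k (code y w) \<Longrightarrow> \<bar>\<eta> x z - \<eta> y w\<bar> \<le> \<delta> / 2"
    by (rule steadyE[OF assms(2) \<open>0 < \<delta> / 2\<close>]) (rule that)
  have "\<bar>(\<theta> x z - \<eta> x z) - (\<theta> y w - \<eta> y w)\<bar> \<le> \<delta>"
    if "x \<in> carrier G" "y \<in> carrier G" "pat (max j l) (code x z) = pat (max j l) (code y w)" for x y z w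
    using j[OF max.cobounded1 that] l[OF max.cobounded2 that] by linarith
  then show "\<exists>n. \<forall>x\<in>carrier G. \<forall>y\<in>carrier G. \<forall>z w. pat n (code x z) = pat n (code y w) \<longrightarrow>
      \<bar>(\<theta> x z - \<eta> x z) - (\<theta> y w - \<eta> y w)\<bar> \<le> \<delta>" by blast
qed

lemma steady_cyl_times:
  assumes \<theta>: "steady \<theta>" and \<sigma>: "\<sigma> \<in> cylinders"
  shows "steady (\<lambda>x z. \<sigma> (code x z) * \<theta> x z)"
proof (rule steadyI)
  obtain i where i: "\<sigma> \<in> cyl i" using \<sigma> by (auto simp: cylinders_def)
  obtain C where C: "0 \<le> C" "\<And>c. \<bar>\<sigma> c\<bar> \<le> C" using cyl_bounded[OF i] by blast
  fix \<delta> :: real assume "0 < \<delta>"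
  then have "0 < \<delta> / (C + 1)" using C by simp
  obtain j where j: "\<And>k x y z w. j \<le> k \<Longrightarrow> x \<in> carrier G \<Longrightarrow> y \<in> carrier G \<Longrightarrow>
      pat k (code x z) = pat k (code y w) \<Longrightarrow> \<bar>\<theta> x z - \<theta> y w\<bar> \<le> \<delta> / (C + 1)"
    by (rule steadyE[OF \<theta> \<open>0 < \<delta> / (C + 1)\<close>]) (rule that)
  have "\<bar>\<sigma> (code x z) * \<theta> x z - \<sigma> (code y w) * \<theta> y w\<bar> \<le> \<delta>"
    if "x \<in> carrier G" "y \<in> carrier G" and eq: "pat (max j i) (code x z) = pat (max j i) (code y w)" for x y z w
  proof -
    have "pat i (code x z) = pat i (code y w)" using eq by (auto simp: pat_eq_iff)
    then have "\<sigma> (code x z) = \<sigma> (code y w)" by (rule cylD[OF i])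
    then have "\<bar>\<sigma> (code x z) * \<theta> x z - \<sigma> (code y w) * \<theta> y w\<bar> = \<bar>\<sigma> (code y w)\<bar> * \<bar>\<theta> x z - \<theta> y w\<bar>"
      by (simp add: right_diff_distrib[symmetric] abs_mult)
    also have "\<dots> \<le> (C + 1) * (\<delta> / (C + 1))"
      using C(2)[of "code y w"] j[OF max.cobounded1 that] C(1) by (intro mult_mono) auto
    also have "\<dots> = \<delta>" using C(1) by simp
    finally show ?thesis .
  qed
  then show "\<exists>n. \<forall>x\<in>carrier G. \<forall>y\<in>carrier G. \<forall>z w. pat n (code x z) = pat n (code y w) \<longrightarrow>
      \<bar>\<sigma> (code x z) * \<theta> x z - \<sigma> (code y w) * \<theta> y w\<bar> \<le> \<delta>" by blast
qed

lemma steady_const: "steady (\<lambda>x z. c)"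
  by (rule steadyI) auto

lemma steady_abs: "steady \<theta> \<Longrightarrow> steady (\<lambda>x z. \<bar>\<theta> x z\<bar>)"
  unfolding steady_def by (blast intro: order_trans[OF abs_triangle_ineq3])

lemma steady_scale: "steady \<theta> \<Longrightarrow> steady (\<lambda>x z. c * \<theta> x z)"
  using steady_cyl_times[of \<theta> "\<lambda>_. c"] by (auto simp: cylinders_def cyl_def)

lemma steady_sum:
  fixes n :: nat
  assumes "\<And>j. j < n \<Longrightarrow> steady (\<theta> j)"
  shows "steady (\<lambda>x z. \<Sum>j<n. \<theta> j x z)"
  using assms
proof (induction n)
  case (Suc n)
  then have "steady (\<lambda>x z. (\<Sum>j<n. \<theta> j x z) - (- 1) * \<theta> n x z)"
    by (intro steady_diff steady_scale) auto
  then show ?case by simp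
qed (simp add: steady_const)

lemma steady_approx:
  assumes \<theta>: "steady \<theta>" and \<delta>: "0 < \<delta>"
  shows "\<exists>\<sigma>\<in>cylinders. \<forall>x\<in>carrier G. \<forall>z. \<bar>\<theta> x z - \<sigma> (code x z)\<bar> \<le> \<delta>"
proof -
  obtain n where n: "\<forall>x\<in>carrier G. \<forall>y\<in>carrier G. \<forall>z w.
      pat n (code x z) = pat n (code y w) \<longrightarrow> \<bar>\<theta> x z - \<theta> y w\<bar> \<le> \<delta>"
    using \<theta> \<delta> unfolding steady_def by blast
  define s where "s e = (SOME v. \<exists>x\<in>carrier G. \<exists>z. pat n (code x z) = e \<and> v = \<theta> x z)" for e
  have "(\<lambda>c. s (pat n c)) \<in> cyl n" unfolding cyl_def by simp
  moreover have "\<bar>\<theta> x z - s (pat n (code x z))\<bar> \<le> \<delta>" if x: "x \<in> carrier G" for x z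
  proof -
    have "\<exists>v. \<exists>y\<in>carrier G. \<exists>w. pat n (code y w) = pat n (code x z) \<and> v = \<theta> y w" using x by blast
    then have "\<exists>y\<in>carrier G. \<exists>w. pat n (code y w) = pat n (code x z) \<and> s (pat n (code x z)) = \<theta> y w"
      unfolding s_def by (rule someI_ex)
    then obtain y w where "y \<in> carrier G" "pat n (code y w) = pat n (code x z)"
        "s (pat n (code x z)) = \<theta> y w" by blast
    then show ?thesis using n[rule_format, OF x, of y z w] by simp
  qed
  ultimately show ?thesis
    by (intro bexI[of _ "\<lambda>c. s (pat n c)"]) (auto simp: cylinders_def)
qed

end

section \<open>The closure of the weighted functions of finitely many bits\<close>

context function_displacement
begin

text \<open>
  The functions \<open>realize \<sigma>\<close> model the simple functions of the limiting \<open>L\<^sub>p\<close> space, relative to the weight.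
\<close>

definition weighted :: "('g \<Rightarrow> 'm \<times> real \<Rightarrow> real) \<Rightarrow> 'g \<Rightarrow> 'm \<times> real \<Rightarrow> real" where
  "weighted \<theta> x = (\<lambda>z. if x \<in> carrier G then \<theta> x z * weight x (fst z) else 0)"

definition realize :: "((nat \<Rightarrow> bool) \<Rightarrow> real) \<Rightarrow> 'g \<Rightarrow> 'm \<times> real \<Rightarrow> real" where
  "realize \<sigma> = weighted (\<lambda>x z. \<sigma> (code x z))"

definition W :: "('g \<Rightarrow> 'm \<times> real \<Rightarrow> real) set" where
  "W = {F \<in> L.V. \<forall>e>0. \<exists>\<sigma>\<in>cylinders. L.q (F - realize \<sigma>) < e}"

lemma lifted_weight:
  assumes x: "x \<in> carrier G"
  shows "(\<lambda>z. weight x (fst z)) \<in> Lp_funs p MU" "Lp_norm p MU (\<lambda>z. weight x (fst z)) \<le> 2"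
  using lift_Lp[OF p weight_Lp[OF x]] weight_norm[OF x] by auto

lemma weighted_norm:
  assumes x: "x \<in> carrier G" and \<phi>: "\<phi> \<in> borel_measurable MU" and h: "h \<in> Lp_funs p MU"
    and C: "\<And>z. \<bar>\<phi> z\<bar> \<le> C"
  shows "(\<lambda>z. \<phi> z * h z) \<in> Lp_funs p MU" "Lp_norm p MU (\<lambda>z. \<phi> z * h z) \<le> C * Lp_norm p MU h"
proof -
  have C0: "0 \<le> C" using C[of undefined] by linarith
  have g: "(\<lambda>z. C * h z) \<in> Lp_funs p MU" "Lp_norm p MU (\<lambda>z. C * h z) = C * Lp_norm p MU h"
    using L.U.mem_scale[OF h, of C] L.U.N_scale[OF h, of C] C0 by (simp_all add: scaleR_fun_def)
  have meas: "(\<lambda>z. \<phi> z * h z) \<in> borel_measurable MU" using \<phi> Lp_funsD(1)[OF h] by measurable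
  have le: "AE z in MU. \<bar>\<phi> z * h z\<bar> \<le> \<bar>C * h z\<bar>"
    using C C0 by (intro AE_I2) (auto simp: abs_mult intro!: mult_right_mono)
  show "(\<lambda>z. \<phi> z * h z) \<in> Lp_funs p MU" by (rule Lp_dominated(1)[OF p meas g(1) le])
  show "Lp_norm p MU (\<lambda>z. \<phi> z * h z) \<le> C * Lp_norm p MU h"
    using Lp_dominated(2)[OF p meas g(1) le] g(2) by simp
qed

lemma weighted_V:
  assumes meas: "\<And>x. x \<in> carrier G \<Longrightarrow> \<theta> x \<in> borel_measurable MU"
    and C: "\<And>x z. x \<in> carrier G \<Longrightarrow> \<bar>\<theta> x z\<bar> \<le> C"
  shows "weighted \<theta> \<in> L.V" and "L.q (weighted \<theta>) \<le> 2 * C"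
proof -
  have C0: "0 \<le> C" using C[OF one_closed, of undefined] by linarith
  have w: "weighted \<theta> x \<in> Lp_funs p MU" "Lp_norm p MU (weighted \<theta> x) \<le> 2 * C" if x: "x \<in> carrier G" for x
  proof -
    note N = weighted_norm[OF x meas[OF x] lifted_weight(1)[OF x] C[OF x]]
    show "weighted \<theta> x \<in> Lp_funs p MU" using N(1) x by (simp add: weighted_def)
    have "Lp_norm p MU (weighted \<theta> x) \<le> C * Lp_norm p MU (\<lambda>z. weight x (fst z))"
      using N(2) x by (simp add: weighted_def)
    also have "\<dots> \<le> C * 2" using lifted_weight(2)[OF x] C0 by (intro mult_left_mono)
    finally show "Lp_norm p MU (weighted \<theta> x) \<le> 2 * C" by simp
  qed
  show V: "weighted \<theta> \<in> L.V"
    by (rule L.VI[of _ "2 * C"]) (use w in \<open>auto simp: weighted_def zero_fun_def\<close>)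
  show "L.q (weighted \<theta>) \<le> 2 * C" using C0 by (intro L.q_le V w) auto
qed

lemma realize_V: "\<sigma> \<in> cylinders \<Longrightarrow> realize \<sigma> \<in> L.V"
proof -
  assume "\<sigma> \<in> cylinders"
  then obtain n where n: "\<sigma> \<in> cyl n" by (auto simp: cylinders_def)
  obtain C where "0 \<le> C" "\<And>c. \<bar>\<sigma> c\<bar> \<le> C" using cyl_bounded[OF n] by blast
  then show ?thesis unfolding realize_def by (intro weighted_V(1)[of _ C] cyl_code_measurable[OF _ n]) auto
qed

lemma weighted_diff: "weighted \<theta> - weighted \<eta> = weighted (\<lambda>x z. \<theta> x z - \<eta> x z)"
  by (auto simp: weighted_def fun_eq_iff left_diff_distrib)

lemma realize_add: "realize (\<sigma> + \<tau>) = realize \<sigma> + realize \<tau>"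
  by (auto simp: realize_def weighted_def fun_eq_iff distrib_right)

lemma realize_scale: "realize (c *\<^sub>R \<sigma>) = c *\<^sub>R realize \<sigma>"
  by (auto simp: realize_def weighted_def fun_eq_iff)

lemma subspace_W: "subspace W"
  unfolding W_def
  by (rule L.V.subspace_closure[OF subspace_cylinders]) (auto simp: realize_V realize_add realize_scale)

lemma W_subset: "W \<subseteq> L.V"
  by (auto simp: W_def)

lemma realize_W: "\<sigma> \<in> cylinders \<Longrightarrow> realize \<sigma> \<in> W"
  unfolding W_def using realize_V L.V.N_0 by (auto intro!: bexI[of _ \<sigma>])

lemma W_closed:
  assumes F: "F \<in> L.V" and approx: "\<And>e. 0 < e \<Longrightarrow> \<exists>H\<in>W. L.q (F - H) \<le> e"
  shows "F \<in> W"
proof -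
  have "\<exists>\<sigma>\<in>cylinders. L.q (F - realize \<sigma>) < e" if "0 < e" for e
  proof -
    have e: "0 < e / 2" using that by simp
    obtain H where H: "H \<in> W" "L.q (F - H) \<le> e / 2" using approx[OF e] by blast
    then obtain \<sigma> where \<sigma>: "\<sigma> \<in> cylinders" "L.q (H - realize \<sigma>) < e / 2" using e unfolding W_def by blast
    have "L.q (F - realize \<sigma>) \<le> L.q (F - H) + L.q (H - realize \<sigma>)"
      using H(1) W_subset by (intro L.V.N_diff_triangle F realize_V \<sigma>) auto
    then have "L.q (F - realize \<sigma>) < e" using H(2) \<sigma>(2) by linarith
    then show ?thesis using \<sigma>(1) by (rule bexI)
  qed
  then show ?thesis using F unfolding W_def by blast
qed

lemma steady_in_W:
  assumes \<theta>: "steady \<theta>" and meas: "\<And>x. x \<in> carrier G \<Longrightarrow> \<theta> x \<in> borel_measurable MU"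
  shows "weighted \<theta> \<in> W"
proof (rule W_closed)
  obtain \<sigma> where \<sigma>: "\<sigma> \<in> cylinders" "\<forall>x\<in>carrier G. \<forall>z. \<bar>\<theta> x z - \<sigma> (code x z)\<bar> \<le> 1"
    using steady_approx[OF \<theta>, of 1] by auto
  obtain n where n: "\<sigma> \<in> cyl n" using \<sigma>(1) by (auto simp: cylinders_def)
  obtain C where C: "0 \<le> C" "\<And>c. \<bar>\<sigma> c\<bar> \<le> C" using cyl_bounded[OF n] by blast
  have "\<bar>\<theta> x z\<bar> \<le> C + 1" if "x \<in> carrier G" for x z
  proof -
    have "\<bar>\<theta> x z - \<sigma> (code x z)\<bar> \<le> 1" using \<sigma>(2) that by blast
    then show ?thesis using C(2)[of "code x z"] by linarith
  qed
  then show "weighted \<theta> \<in> L.V" by (intro weighted_V(1)[of _ "C + 1"] meas)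
  fix e :: real assume "0 < e"
  then have "0 < e / 2" by simp
  from steady_approx[OF \<theta> this] obtain \<tau>
    where \<tau>: "\<tau> \<in> cylinders" "\<forall>x\<in>carrier G. \<forall>z. \<bar>\<theta> x z - \<tau> (code x z)\<bar> \<le> e / 2" by blast
  obtain k where k: "\<tau> \<in> cyl k" using \<tau>(1) by (auto simp: cylinders_def)
  have "L.q (weighted (\<lambda>x z. \<theta> x z - \<tau> (code x z))) \<le> 2 * (e / 2)"
    using \<tau>(2) by (intro weighted_V(2) borel_measurable_diff meas cyl_code_measurable[OF _ k]) auto
  then have "L.q (weighted \<theta> - realize \<tau>) \<le> e" by (simp add: realize_def weighted_diff)
  then show "\<exists>H\<in>W. L.q (weighted \<theta> - H) \<le> e" using realize_W[OF \<tau>(1)] by blast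
qed

lemma AE_lift:
  assumes "AE \<omega> in M. P \<omega>"
  shows "AE z in MU. P (fst z)"
proof -
  interpret U: finite_measure unit_lebesgue by (rule finite_measure_unit)
  obtain N where N: "{\<omega> \<in> space M. \<not> P \<omega>} \<subseteq> N" "N \<in> null_sets M" using assms by (rule AE_E) (auto simp: null_sets_def)
  have "N \<times> space unit_lebesgue \<in> null_sets MU"
    using N(2) by (intro U.times_in_null_sets1) auto
  then show ?thesis
    by (rule AE_I') (use N(1) in \<open>auto simp: space_pair_measure\<close>)
qed

lemma lifted_ratio_measurable:
  assumes "x \<in> carrier G" "g \<in> carrier G"
  shows "(\<lambda>z. ratio g x (fst z)) \<in> borel_measurable MU"
  by (rule measurable_compose[OF measurable_fst ratio_measurable[OF assms]])

text \<open>
  Almost everywhere \<open>disp g\<close> is the product of a ratio, which is steady, and the weight.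
\<close>

lemma disp_in_W:
  assumes g: "g \<in> carrier G"
  shows "L.disp g \<in> W"
proof (rule W_closed)
  show V: "L.disp g \<in> L.V" by (rule L.disp_V[OF g])
  let ?H = "weighted (\<lambda>x z. ratio g x (fst z))"
  have H: "?H \<in> W" by (intro steady_in_W steady_ratio lifted_ratio_measurable g)
  have "L.q (L.disp g - ?H) \<le> 0"
  proof (rule L.q_le)
    show HV: "L.disp g - ?H \<in> L.V" using H W_subset by (intro L.V.mem_diff V) auto
    fix x assume x: "x \<in> carrier G"
    have "AE z in MU. disp g x (fst z) = ratio g x (fst z) * weight x (fst z)"
      by (rule AE_lift[OF ratio_times_weight[OF x g]])
    then have "AE z in MU. (L.disp g - ?H) x z = 0"
      by eventually_elim (simp add: L_disp weighted_def x)
    then show "Lp_norm p MU ((L.disp g - ?H) x) \<le> 0"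
      using Lp_norm_eq_0_iff[OF p L.VD(2)[OF HV x]] by simp
  qed simp
  then show "\<exists>H\<in>W. L.q (L.disp g - H) \<le> e" if "0 < e" for e using H that by (intro bexI[of _ ?H]) auto
qed

text \<open>
  The translated weight is the sum of the \<open>coeff j \<bar>disp (k \<otimes> elt j) - disp k\<bar>\<close>. Its quotient by the original
  weight may be unbounded, but each partial sum is a steady multiple \<open>\<theta>\<close> of the original weight, and the tails are
  small in norm uniformly in the base point.
\<close>

lemma translate_realize_in_W:
  assumes k: "k \<in> carrier G" and \<sigma>: "\<sigma> \<in> cylinders"
  shows "L.translate k (realize \<sigma>) \<in> W"
proof (rule W_closed)
  show V: "L.translate k (realize \<sigma>) \<in> L.V" by (intro L.translate_V realize_V \<sigma> k)
  obtain \<sigma>' where \<sigma>': "\<sigma>' \<in> cylinders" "\<And>x z. x \<in> carrier G \<Longrightarrow> \<sigma> (code (inv k \<otimes> x) z) = \<sigma>' (code x z)"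
    using cylinders_translate[OF k \<sigma>] by blast
  obtain l where l: "\<sigma>' \<in> cyl l" using \<sigma>'(1) by (auto simp: cylinders_def)
  obtain C where C: "0 \<le> C" "\<And>c. \<bar>\<sigma>' c\<bar> \<le> C" using cyl_bounded[OF l] by blast
  fix e :: real assume "0 < e"
  then have "0 < e / (2 * (C + 1))" using C by simp
  then obtain n where n: "(1 / 2 :: real) ^ n < e / (2 * (C + 1))"
    using real_arch_pow_inv[of _ "1 / 2 :: real"] by auto
  have Cn: "C * (2 * (1 / 2) ^ n) \<le> e"
  proof -
    have "C * (2 * (1 / 2) ^ n) \<le> (C + 1) * (2 * (e / (2 * (C + 1))))"
      using n C by (intro mult_mono) auto
    also have "\<dots> = e" using C by (simp add: field_simps)
    finally show ?thesis .
  qed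
  define \<theta> where "\<theta> x z = (\<Sum>j<n. coeff j * \<bar>ratio (k \<otimes> elt j) x (fst z) - ratio k x (fst z)\<bar>)"
    for x and z :: "'m \<times> real"
  have kj: "k \<otimes> elt j \<in> carrier G" for j using k elt_mem by blast
  have \<theta>: "steady \<theta>"
    unfolding \<theta>_def by (intro steady_sum steady_scale steady_abs steady_diff steady_ratio kj k)
  have \<theta>_meas: "\<theta> x \<in> borel_measurable MU" if "x \<in> carrier G" for x
    using lifted_ratio_measurable[OF that kj] lifted_ratio_measurable[OF that k]
    unfolding \<theta>_def by (intro borel_measurable_sum borel_measurable_times borel_measurable_abs
        borel_measurable_diff borel_measurable_const)
  let ?H = "weighted (\<lambda>x z. \<sigma>' (code x z) * \<theta> x z)"
  have H: "?H \<in> W"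
    by (intro steady_in_W steady_cyl_times \<theta> \<sigma>'(1) borel_measurable_times cyl_code_measurable[OF _ l] \<theta>_meas)
  have "L.q (L.translate k (realize \<sigma>) - ?H) \<le> e"
  proof (rule L.q_le)
    show HV: "L.translate k (realize \<sigma>) - ?H \<in> L.V" using H W_subset by (intro L.V.mem_diff V) auto
    fix x assume x: "x \<in> carrier G"
    let ?y = "inv k \<otimes> x"
    have y: "?y \<in> carrier G" using k x by simp
    let ?d = "weight ?y - (\<Sum>j<n. (\<lambda>\<omega>. \<bar>coeff j * disp (elt j) ?y \<omega>\<bar>))"
    have d_mem: "?d \<in> Lp_funs p M"
      by (intro U.mem_diff weight_Lp y U.mem_sum Lp_funs_abs term_Lp)
    have d_norm: "Lp_norm p MU (\<lambda>z. ?d (fst z)) \<le> 2 * (1 / 2) ^ n"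
      using lift_Lp(2)[OF p d_mem] weight_tail[OF y, of n] by linarith
    have disp_y: "disp (elt j) ?y \<omega> = disp (k \<otimes> elt j) x \<omega> - disp k x \<omega>" for j \<omega>
    proof -
      have "translate k (disp (elt j)) x \<omega> = (disp (k \<otimes> elt j) - disp k) x \<omega>"
        by (simp only: translate_disp[OF k elt_mem])
      then show ?thesis using x by (simp add: translate_def)
    qed
    have "AE z in MU. disp k x (fst z) = ratio k x (fst z) * weight x (fst z)"
      by (rule AE_lift[OF ratio_times_weight[OF x k]])
    moreover have "AE z in MU. \<forall>j\<in>{..<n}. disp (k \<otimes> elt j) x (fst z) = ratio (k \<otimes> elt j) x (fst z) * weight x (fst z)"
      by (intro AE_finite_allI finite_lessThan AE_lift[OF ratio_times_weight[OF x kj]])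
    moreover have "AE z in MU. 0 \<le> weight x (fst z)"
      by (rule AE_lift[OF weight_nonneg[OF x]])
    ultimately have ae: "AE z in MU. (L.translate k (realize \<sigma>) - ?H) x z = \<sigma>' (code x z) * ?d (fst z)"
    proof eventually_elim
      case (elim z)
      have term_eq: "\<bar>coeff j * disp (elt j) ?y (fst z)\<bar> =
          coeff j * \<bar>ratio (k \<otimes> elt j) x (fst z) - ratio k x (fst z)\<bar> * weight x (fst z)" if "j < n" for j
      proof -
        have "disp (elt j) ?y (fst z) = (ratio (k \<otimes> elt j) x (fst z) - ratio k x (fst z)) * weight x (fst z)"
          unfolding disp_y using elim(1,2) that by (simp add: left_diff_distrib)
        then show ?thesis using elim(3) coeff_pos[of j] by (simp add: abs_mult)
      qed
      have "?d (fst z) = weight ?y (fst z) - \<theta> x z * weight x (fst z)"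
        using term_eq by (simp add: sum_fun_apply \<theta>_def sum_distrib_right)
      then show ?case
        using x y \<sigma>'(2)[OF x] by (simp add: L.translate_def realize_def weighted_def right_diff_distrib mult.assoc)
    qed
    have P: "(\<lambda>z. \<sigma>' (code x z) * ?d (fst z)) \<in> Lp_funs p MU"
      "Lp_norm p MU (\<lambda>z. \<sigma>' (code x z) * ?d (fst z)) \<le> C * Lp_norm p MU (\<lambda>z. ?d (fst z))"
      using weighted_norm[OF x cyl_code_measurable[OF x l] lift_Lp(1)[OF p d_mem] C(2)] by auto
    have "Lp_norm p MU ((L.translate k (realize \<sigma>) - ?H) x) = Lp_norm p MU (\<lambda>z. \<sigma>' (code x z) * ?d (fst z))"
      by (rule Lp_norm_cong_AE[OF Lp_funsD(1)[OF L.VD(2)[OF HV x]] Lp_funsD(1)[OF P(1)] ae])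
    also have "\<dots> \<le> C * (2 * (1 / 2) ^ n)"
      using P(2) mult_left_mono[OF d_norm C(1)] by linarith
    also have "\<dots> \<le> e" by (rule Cn)
    finally show "Lp_norm p MU ((L.translate k (realize \<sigma>) - ?H) x) \<le> e" .
  qed (use \<open>0 < e\<close> in simp)
  then show "\<exists>H\<in>W. L.q (L.translate k (realize \<sigma>) - H) \<le> e" using H by blast
qed

lemma translate_in_W:
  assumes k: "k \<in> carrier G" and F: "F \<in> W"
  shows "L.translate k F \<in> W"
proof (rule W_closed)
  have FV: "F \<in> L.V" using F W_subset by blast
  show "L.translate k F \<in> L.V" by (rule L.translate_V[OF FV k])
  fix e :: real assume "0 < e"
  then obtain \<sigma> where \<sigma>: "\<sigma> \<in> cylinders" "L.q (F - realize \<sigma>) < e" using F unfolding W_def by blast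
  have "L.q (L.translate k F - L.translate k (realize \<sigma>)) = L.q (F - realize \<sigma>)"
    unfolding L.translate_diff[symmetric] by (intro L.q_translate L.V.mem_diff FV realize_V \<sigma>(1) k)
  then show "\<exists>H\<in>W. L.q (L.translate k F - H) \<le> e"
    using \<sigma> translate_realize_in_W[OF k \<sigma>(1)] by (intro bexI[of _ "L.translate k (realize \<sigma>)"]) auto
qed

text \<open>
  The masses of the cells, \<open>level\<close>, form the law of the code under the finitely additive measure with density
  \<open>weight\<^sup>p\<close>.
\<close>

definition density :: "'g \<Rightarrow> 'm \<times> real \<Rightarrow> real" where
  "density x z = \<bar>weight x (fst z)\<bar> powr p"

definition level :: "bool list \<Rightarrow> real" where
  "level e = m (\<lambda>x. \<integral>z. of_bool (pat (length e) (code x z) = e) * density x z \<partial>MU)"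

lemma density_integrable: "x \<in> carrier G \<Longrightarrow> integrable MU (density x)"
  using Lp_funsD(2)[OF lifted_weight(1)] unfolding density_def[abs_def] by simp

lemma density_integral:
  assumes x: "x \<in> carrier G"
  shows "(\<integral>z. density x z \<partial>MU) \<le> 2 powr p"
proof -
  have "(\<integral>z. density x z \<partial>MU) = Lp_norm p MU (\<lambda>z. weight x (fst z)) powr p"
    by (simp add: Lp_norm_powr[OF p] density_def)
  also have "\<dots> \<le> 2 powr p" using lifted_weight(2)[OF x] p by (intro powr_mono2) (auto simp: Lp_norm_nonneg)
  finally show ?thesis .
qed

lemma density_nonneg: "0 \<le> density x z"
  by (simp add: density_def)

lemma cell_density_integrable:
  assumes x: "x \<in> carrier G"
  shows "integrable MU (\<lambda>z. of_bool (pat n (code x z) = e) * density x z)"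
proof (rule Bochner_Integration.integrable_bound[OF density_integrable[OF x]])
  show "(\<lambda>z. of_bool (pat n (code x z) = e) * density x z) \<in> borel_measurable MU"
    using pat_code_measurable[OF x, measurable] borel_measurable_integrable[OF density_integrable[OF x], measurable]
    by measurable
qed (auto simp: density_nonneg)

lemma cell_density_bounds:
  assumes x: "x \<in> carrier G"
  shows "0 \<le> (\<integral>z. of_bool (pat n (code x z) = e) * density x z \<partial>MU)"
    and "(\<integral>z. of_bool (pat n (code x z) = e) * density x z \<partial>MU) \<le> 2 powr p"
proof -
  show "0 \<le> (\<integral>z. of_bool (pat n (code x z) = e) * density x z \<partial>MU)"
    by (intro Bochner_Integration.integral_nonneg) (simp add: density_nonneg)
  have "(\<integral>z. of_bool (pat n (code x z) = e) * density x z \<partial>MU) \<le> (\<integral>z. density x z \<partial>MU)"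
    by (intro integral_mono cell_density_integrable density_integrable x) (auto simp: density_nonneg)
  then show "(\<integral>z. of_bool (pat n (code x z) = e) * density x z \<partial>MU) \<le> 2 powr p"
    using density_integral[OF x] by linarith
qed

lemma cell_density_bounded:
  "(\<lambda>x. \<integral>z. of_bool (pat n (code x z) = e) * density x z \<partial>MU) \<in> bounded_funs G"
  using cell_density_bounds by (intro bounded_funsI[of _ "2 powr p"]) (simp add: abs_of_nonneg)

lemma level_nonneg: "0 \<le> level e"
  unfolding level_def by (intro mean_nonneg cell_density_bounded cell_density_bounds)

lemma level_split: "level e = level (False # e) + level (True # e)"
proof -
  have "level e = m (\<lambda>x. (\<integral>z. of_bool (pat (length (False # e)) (code x z) = False # e) * density x z \<partial>MU) +
      (\<integral>z. of_bool (pat (length (True # e)) (code x z) = True # e) * density x z \<partial>MU))"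
    unfolding level_def
  proof (rule mean_cong[OF cell_density_bounded])
    fix x assume x: "x \<in> carrier G"
    have "(\<integral>z. of_bool (pat (length (False # e)) (code x z) = False # e) * density x z \<partial>MU) +
        (\<integral>z. of_bool (pat (length (True # e)) (code x z) = True # e) * density x z \<partial>MU) =
        (\<integral>z. of_bool (pat (length (False # e)) (code x z) = False # e) * density x z +
          of_bool (pat (length (True # e)) (code x z) = True # e) * density x z \<partial>MU)"
      by (rule Bochner_Integration.integral_add[symmetric]) (intro cell_density_integrable x)+
    also have "\<dots> = (\<integral>z. of_bool (pat (length e) (code x z) = e) * density x z \<partial>MU)"
      by (intro Bochner_Integration.integral_cong) auto
    finally show "(\<integral>z. of_bool (pat (length e) (code x z) = e) * density x z \<partial>MU) =
        (\<integral>z. of_bool (pat (length (False # e)) (code x z) = False # e) * density x z \<partial>MU) +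
        (\<integral>z. of_bool (pat (length (True # e)) (code x z) = True # e) * density x z \<partial>MU)" ..
  qed
  also have "\<dots> = level (False # e) + level (True # e)"
    unfolding level_def by (rule mean_add[OF cell_density_bounded cell_density_bounded])
  finally show ?thesis .
qed

text \<open>
  All points with the same long code have nearly the same second coordinate, so a cell lies in a thin strip.
\<close>

lemma level_small:
  assumes "0 < \<epsilon>"
  shows "\<exists>n. \<forall>e. length e = n \<longrightarrow> level e \<le> \<epsilon>"
proof -
  define \<delta> where "\<delta> = \<epsilon> / (2 * 2 powr p)"
  have \<delta>: "0 < \<delta>" using assms by (simp add: \<delta>_def)
  obtain Q where Q: "finite Q" "Q \<subseteq> \<rat>"
    "\<forall>u v. \<bar>u\<bar> \<le> 1 \<longrightarrow> \<bar>v\<bar> \<le> 1 \<longrightarrow> (\<forall>r\<in>Q. r < u \<longleftrightarrow> r < v) \<longrightarrow> \<bar>u - v\<bar> \<le> \<delta>"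
    using rational_grid[OF \<delta>, of 1] by (elim exE conjE)
  have E: "\<forall>r\<in>Q. (\<lambda>x z. r < snd z) \<in> events" using Q(2) by (auto simp: events_def)
  obtain n where n: "\<forall>x y z w. pat n (code x z) = pat n (code y w) \<longrightarrow> (\<forall>r\<in>Q. (r < snd z) = (r < snd w))"
    using events_separate[OF Q(1) E] by (elim exE)
  have "level e \<le> \<epsilon>" if e: "length e = n" for e
  proof -
    have "\<exists>s. \<forall>x\<in>carrier G. \<forall>z\<in>space MU. pat n (code x z) = e \<longrightarrow> \<bar>snd z - s\<bar> \<le> \<delta>"
    proof (cases "\<exists>x\<in>carrier G. \<exists>z\<in>space MU. pat n (code x z) = e")
      case True
      then obtain x0 z0 where 0: "z0 \<in> space MU" "pat n (code x0 z0) = e" by blast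
      have "\<bar>snd z - snd z0\<bar> \<le> \<delta>" if z: "z \<in> space MU" "pat n (code x z) = e" for x z
      proof (rule Q(3)[rule_format])
        show "\<bar>snd z\<bar> \<le> 1" "\<bar>snd z0\<bar> \<le> 1" using z(1) 0(1) by (auto simp: space_pair_measure)
        fix r assume "r \<in> Q"
        then show "(r < snd z) = (r < snd z0)" using n z(2) 0(2) by metis
      qed
      then show ?thesis by blast
    qed auto
    then obtain s where s: "\<And>x z. x \<in> carrier G \<Longrightarrow> z \<in> space MU \<Longrightarrow> pat n (code x z) = e \<Longrightarrow> \<bar>snd z - s\<bar> \<le> \<delta>"
      by blast
    show ?thesis
      unfolding level_def e
    proof (rule mean_le[OF cell_density_bounded])
      fix x assume x: "x \<in> carrier G"
      note strip = integral_strip_le[OF p weight_Lp[OF x], of \<delta> s]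
      have "(\<integral>z. of_bool (pat n (code x z) = e) * density x z \<partial>MU) \<le>
          (\<integral>z. of_bool (\<bar>snd z - s\<bar> \<le> \<delta>) * \<bar>weight x (fst z)\<bar> powr p \<partial>MU)"
        using strip(2) \<delta> s[OF x]
        by (intro integral_mono cell_density_integrable x) (auto simp: density_def)
      also have "\<dots> \<le> 2 * \<delta> * Lp_norm p M (weight x) powr p" using strip(1) \<delta> by simp
      also have "\<dots> \<le> 2 * \<delta> * 2 powr p"
        using weight_norm[OF x] \<delta> p by (intro mult_left_mono powr_mono2) (auto simp: Lp_norm_nonneg)
      also have "\<dots> = \<epsilon>" by (simp add: \<delta>_def)
      finally show "(\<integral>z. of_bool (pat n (code x z) = e) * density x z \<partial>MU) \<le> \<epsilon>" .
    qed
  qed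
  then show ?thesis by blast
qed

lemma q_realize:
  assumes \<sigma>: "\<sigma> \<in> cyl n"
  shows "L.q (realize \<sigma>) = (\<Sum>e | length e = n. \<bar>\<sigma> (extend e)\<bar> powr p * level e) powr (1 / p)"
proof -
  have \<tau>: "(\<lambda>c. \<bar>\<sigma> c\<bar> powr p) \<in> cyl n" by (rule cyl_comp[OF \<sigma>])
  have V: "realize \<sigma> \<in> L.V" using \<sigma> by (intro realize_V) (auto simp: cylinders_def)
  have "m (\<lambda>x. Lp_norm p MU (realize \<sigma> x) powr p) =
      m (\<lambda>x. \<Sum>e | length e = n. \<bar>\<sigma> (extend e)\<bar> powr p *
        (\<integral>z. of_bool (pat n (code x z) = e) * density x z \<partial>MU))"
  proof (rule mean_cong[OF L.powr_bounded[OF V]])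
    fix x assume x: "x \<in> carrier G"
    have "Lp_norm p MU (realize \<sigma> x) powr p = (\<integral>z. \<bar>\<sigma> (code x z)\<bar> powr p * density x z \<partial>MU)"
      using x by (simp add: Lp_norm_powr[OF p] realize_def weighted_def density_def abs_mult powr_mult)
    also have "\<dots> = (\<integral>z. (\<Sum>e | length e = n. \<bar>\<sigma> (extend e)\<bar> powr p *
        (of_bool (pat n (code x z) = e) * density x z)) \<partial>MU)"
      by (intro Bochner_Integration.integral_cong refl, subst cyl_expand[OF \<tau>])
        (simp add: sum_distrib_right mult.assoc)
    also have "\<dots> = (\<Sum>e | length e = n. \<bar>\<sigma> (extend e)\<bar> powr p *
        (\<integral>z. of_bool (pat n (code x z) = e) * density x z \<partial>MU))"
      by (subst Bochner_Integration.integral_sum)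
        (auto intro!: integrable_mult_right cell_density_integrable x simp: cell_density_integrable[OF x])
    finally show "Lp_norm p MU (realize \<sigma> x) powr p = (\<Sum>e | length e = n. \<bar>\<sigma> (extend e)\<bar> powr p *
        (\<integral>z. of_bool (pat n (code x z) = e) * density x z \<partial>MU))" .
  qed
  also have "\<dots> = (\<Sum>e | length e = n. m (\<lambda>x. \<bar>\<sigma> (extend e)\<bar> powr p *
        (\<integral>z. of_bool (pat n (code x z) = e) * density x z \<partial>MU)))"
    by (intro mean_sum bounded_funs_scale cell_density_bounded)
  also have "\<dots> = (\<Sum>e | length e = n. \<bar>\<sigma> (extend e)\<bar> powr p * level e)"
    by (intro sum.cong refl) (simp add: mean_scale[OF cell_density_bounded] level_def)
  finally show ?thesis by (simp add: L.q_def)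
qed

text \<open>
  The maps \<open>\<sigma> \<mapsto> realize \<sigma>\<close> and \<open>\<sigma> \<mapsto> \<sigma>(digits)\<close> see the same masses, the latter normalised by the total
  mass \<open>\<Lambda>\<close>; the factor \<open>\<Lambda>\<^sup>1\<^sup>/\<^sup>p\<close> compensates for this. Both have dense images, so the completion of \<open>W\<close> is presented
  by \<open>L\<^sub>p([0,1])\<close>.
\<close>

theorem equivariant_into_unit_Lp:
  "\<exists>\<Psi>. equivariant G (Lp p unit_lebesgue) \<Psi> \<and>
    (\<forall>g\<in>carrier G. \<forall>h\<in>carrier G.
      vnorm (Lp p unit_lebesgue) (vdiff (Lp p unit_lebesgue) (\<Psi> g) (\<Psi> h)) = L.q (L.disp g - L.disp h))"
proof (cases "level [] = 0")
  case True
  \<comment> \<open>Without mass all displacements are null, and a constant map will do.\<close>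
  interpret Z: seminormed "Lp_funs p unit_lebesgue" "Lp_norm p unit_lebesgue" by (rule seminormed_Lp[OF p])
  note pres = presents_Lp[OF p, of unit_lebesgue]
  have level_0: "level e = 0" for e
  proof (induction e)
    case (Cons b e)
    then show ?case using level_split[of e] level_nonneg[of "False # e"] level_nonneg[of "True # e"]
      by (cases b) auto
  qed (rule True)
  have W_0: "L.q F = 0" if F: "F \<in> W" for F
  proof -
    have FV: "F \<in> L.V" using F W_subset by blast
    have "L.q F \<le> e" if "0 < e" for e
    proof -
      obtain \<sigma> where \<sigma>: "\<sigma> \<in> cylinders" "L.q (F - realize \<sigma>) < e" using F \<open>0 < e\<close> unfolding W_def by blast
      then obtain n where "\<sigma> \<in> cyl n" by (auto simp: cylinders_def)
      from q_realize[OF this] have "L.q (realize \<sigma>) = 0" by (simp add: level_0)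
      then show ?thesis using L.V.abs_N_diff_le[OF FV realize_V[OF \<sigma>(1)]] \<sigma>(2) by linarith
    qed
    then have "L.q F \<le> 0" by (rule field_le_epsilon[of _ 0, simplified])
    then show ?thesis using L.V.N_nonneg[OF FV] by simp
  qed
  show ?thesis
  proof (intro exI conjI ballI)
    show "equivariant G (Lp p unit_lebesgue) (\<lambda>g. Lp_class p unit_lebesgue 0)"
      by (rule Z.presents_equivariant[OF pres, where P = "\<lambda>g x. x" and B = "\<lambda>g. 0"])
        (auto simp: Z.mem_0 is_group)
    fix g h assume "g \<in> carrier G" "h \<in> carrier G"
    then have "L.disp g - L.disp h \<in> W" by (intro subspace_diff[OF subspace_W] disp_in_W)
    from W_0[OF this] show "vnorm (Lp p unit_lebesgue) (vdiff (Lp p unit_lebesgue) (Lp_class p unit_lebesgue 0)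
        (Lp_class p unit_lebesgue 0)) = L.q (L.disp g - L.disp h)"
      using Z.presents_vdiff[OF pres Z.mem_0 Z.mem_0] presentsD(6)[OF pres Z.mem_0] by (simp add: Z.N_0)
  qed
next
  case False
  define \<Lambda> where "\<Lambda> = level []"
  have \<Lambda>: "0 < \<Lambda>" using False level_nonneg[of "[]"] by (simp add: \<Lambda>_def)
  interpret IC: interval_code "\<lambda>e. level e / \<Lambda>"
  proof
    show "0 \<le> level e / \<Lambda>" for e using level_nonneg \<Lambda> by simp
    show "level e / \<Lambda> = level (False # e) / \<Lambda> + level (True # e) / \<Lambda>" for e
      by (subst level_split) (rule add_divide_distrib)
    show "level [] / \<Lambda> = 1" using \<Lambda> by (simp add: \<Lambda>_def)
    fix \<epsilon> :: real assume "0 < \<epsilon>"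
    then have "0 < \<epsilon> * \<Lambda>" using \<Lambda> by simp
    then obtain n where "\<forall>e. length e = n \<longrightarrow> level e \<le> \<epsilon> * \<Lambda>" using level_small by blast
    then show "\<exists>n. \<forall>e. length e = n \<longrightarrow> level e / \<Lambda> \<le> \<epsilon>" using \<Lambda> by (auto simp: field_simps)
  qed
  interpret W: seminormed W L.q by (rule L.V.seminormed_subspace[OF subspace_W W_subset])
  interpret C: seminormed "cauchy_seqs W L.q" "lim_norm L.q" by (rule W.seminormed_completion)
  interpret Z: seminormed "Lp_funs p unit_lebesgue" "Lp_norm p unit_lebesgue" by (rule seminormed_Lp[OF p])
  let ?c = "\<Lambda> powr (1 / p)"
  have c: "0 < ?c" using \<Lambda> by simp
  define A :: "((nat \<Rightarrow> bool) \<Rightarrow> real) \<Rightarrow> nat \<Rightarrow> 'g \<Rightarrow> 'm \<times> real \<Rightarrow> real" where "A \<sigma> = (\<lambda>i. realize \<sigma>)" for \<sigma>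
  define B where "B \<sigma> = ?c *\<^sub>R (\<lambda>t. \<sigma> (IC.digits t))" for \<sigma> :: "(nat \<Rightarrow> bool) \<Rightarrow> real"
  have "\<exists>\<kappa>. presents (cauchy_seqs W L.q) (lim_norm L.q) \<kappa> (Lp p unit_lebesgue)"
  proof (rule transfer_presentation[where A = A and B = B])
    show "seminormed (cauchy_seqs W L.q) (lim_norm L.q)" by (rule W.seminormed_completion)
    show "complete_in (cauchy_seqs W L.q) (lim_norm L.q)" by (rule W.complete_completion)
    show "seminormed (Lp_funs p unit_lebesgue) (Lp_norm p unit_lebesgue)" by (rule seminormed_Lp[OF p])
    show "complete_in (Lp_funs p unit_lebesgue) (Lp_norm p unit_lebesgue)" by (rule complete_Lp[OF p])
    show "subspace cylinders" by (rule subspace_cylinders)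
    show "presents (Lp_funs p unit_lebesgue) (Lp_norm p unit_lebesgue) (Lp_class p unit_lebesgue) (Lp p unit_lebesgue)"
      by (rule presents_Lp[OF p])
    show "A \<sigma> \<in> cauchy_seqs W L.q" if "\<sigma> \<in> cylinders" for \<sigma>
      unfolding A_def by (intro W.const_in_cauchy_seqs realize_W that)
    show "A (\<sigma> + \<tau>) = A \<sigma> + A \<tau>" for \<sigma> \<tau> by (simp add: A_def realize_add fun_eq_iff)
    show "A (a *\<^sub>R \<sigma>) = a *\<^sub>R A \<sigma>" for a \<sigma> by (simp add: A_def realize_scale fun_eq_iff)
    show "B \<sigma> \<in> Lp_funs p unit_lebesgue" if "\<sigma> \<in> cylinders" for \<sigma>
      unfolding B_def by (intro Z.mem_scale IC.cylinders_digits_Lp p that)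
    show "B (\<sigma> + \<tau>) = B \<sigma> + B \<tau>" for \<sigma> \<tau> by (simp add: B_def fun_eq_iff distrib_left)
    show "B (a *\<^sub>R \<sigma>) = a *\<^sub>R B \<sigma>" for a \<sigma> by (simp add: B_def fun_eq_iff)
    show "lim_norm L.q (A \<sigma>) = Lp_norm p unit_lebesgue (B \<sigma>)" if "\<sigma> \<in> cylinders" for \<sigma>
    proof -
      obtain n where n: "\<sigma> \<in> cyl n" using \<open>\<sigma> \<in> cylinders\<close> by (auto simp: cylinders_def)
      let ?S = "\<Sum>e | length e = n. \<bar>\<sigma> (extend e)\<bar> powr p * level e"
      have S0: "0 \<le> ?S" by (intro sum_nonneg mult_nonneg_nonneg level_nonneg) auto
      have "Lp_norm p unit_lebesgue (B \<sigma>) = ?c * (?S / \<Lambda>) powr (1 / p)"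
        unfolding B_def Z.N_scale[OF IC.cylinders_digits_Lp[OF p that]] IC.cyl_digits_Lp(2)[OF p n]
        using c by (simp add: sum_divide_distrib)
      also have "\<dots> = ?S powr (1 / p)" using \<Lambda> S0 by (simp add: powr_divide)
      finally show ?thesis by (simp add: A_def q_realize[OF n])
    qed
    show "\<exists>\<sigma>\<in>cylinders. lim_norm L.q (z - A \<sigma>) < e" if z: "z \<in> cauchy_seqs W L.q" and e: "0 < e" for z e
    proof -
      obtain i where i: "lim_norm L.q (z - (\<lambda>k. z i)) < e / 2" using W.completion_approx[OF z, of "e / 2"] e by auto
      have zi: "z i \<in> W" using z by (auto simp: cauchy_seqs_def)
      then obtain \<sigma> where \<sigma>: "\<sigma> \<in> cylinders" "L.q (z i - realize \<sigma>) < e / 2"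
        using e unfolding W_def by (auto dest!: spec[of _ "e / 2"])
      have "lim_norm L.q (z - A \<sigma>) \<le> lim_norm L.q (z - (\<lambda>k. z i)) + lim_norm L.q ((\<lambda>k. z i) - A \<sigma>)"
        unfolding A_def by (intro C.N_diff_triangle z W.const_in_cauchy_seqs zi realize_W \<sigma>)
      moreover have "(\<lambda>k. z i) - A \<sigma> = (\<lambda>k. z i - realize \<sigma>)" by (simp add: A_def fun_eq_iff)
      ultimately have "lim_norm L.q (z - A \<sigma>) < e" using i \<sigma>(2) by simp
      then show ?thesis using \<sigma>(1) by (rule bexI)
    qed
    show "\<exists>\<sigma>\<in>cylinders. Lp_norm p unit_lebesgue (z - B \<sigma>) < e"
      if z: "z \<in> Lp_funs p unit_lebesgue" and e: "0 < e" for z e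
    proof -
      obtain \<sigma> where \<sigma>: "\<sigma> \<in> cylinders" "Lp_norm p unit_lebesgue (z - (\<lambda>t. \<sigma> (IC.digits t))) < e"
        using IC.cylinders_dense[OF p z e] by blast
      have "B ((1 / ?c) *\<^sub>R \<sigma>) = (\<lambda>t. \<sigma> (IC.digits t))" using \<Lambda> by (simp add: B_def fun_eq_iff)
      then show ?thesis using \<sigma> subspace_scale[OF subspace_cylinders \<sigma>(1)] by metis
    qed
  qed
  then obtain \<kappa> where pres: "presents (cauchy_seqs W L.q) (lim_norm L.q) \<kappa> (Lp p unit_lebesgue)" by blast
  from L.equivariant_in_completion(2,3)[OF subspace_W W_subset translate_in_W disp_in_W pres]
  show ?thesis by blast
qed

end

section \<open>Word metrics and the theorem\<close>

text \<open>
  Every element of the generated subgroup is the product of a word over \<open>S\<close>.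
\<close>

lemma (in group) countable_generate:
  assumes S: "countable S" "S \<subseteq> carrier G" and inv: "\<forall>s\<in>S. inv s \<in> S"
  shows "countable (generate G S)"
proof (rule countable_subset)
  let ?w = "\<lambda>ws. foldr (\<lambda>s t. s \<otimes> t) ws \<one>"
  show "countable (?w ` lists S)" using S by (intro countable_image countable_lists)
  have closed: "?w ws \<in> carrier G" if "ws \<in> lists S" for ws
    using that S(2) by (induction ws) auto
  have append: "?w (us @ vs) = ?w us \<otimes> ?w vs" if "us \<in> lists S" "vs \<in> lists S" for us vs
    using that S(2) by (induction us) (auto simp: m_assoc closed subset_iff)
  show "generate G S \<subseteq> ?w ` lists S"
  proof
    fix g assume "g \<in> generate G S"
    then show "g \<in> ?w ` lists S"
    proof (induction rule: generate.induct)
      case one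
      show ?case by (intro image_eqI[of _ _ "[]"]) auto
    next
      case (incl s)
      then show ?case using S(2) by (intro image_eqI[of _ _ "[s]"]) auto
    next
      case (inv s)
      then show ?case using S(2) assms(3) by (intro image_eqI[of _ _ "[inv s]"]) auto
    next
      case (eng g h)
      then obtain us vs where "us \<in> lists S" "vs \<in> lists S" "g = ?w us" "h = ?w vs" by blast
      then show ?case using append[of us vs] by (intro image_eqI[of _ _ "us @ vs"]) auto
    qed
  qed
qed

lemma (in group) word_dist_left_invariant:
  assumes "x \<in> carrier G" "g \<in> carrier G" "h \<in> carrier G"
  shows "word_dist G S (x \<otimes> g) (x \<otimes> h) = word_dist G S g h"
proof -
  have "inv x \<otimes> (x \<otimes> h) = h" using assms by (simp add: m_assoc[symmetric])
  then have "inv (x \<otimes> g) \<otimes> (x \<otimes> h) = inv g \<otimes> h"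
    using assms by (simp add: inv_mult_group m_assoc)
  then show ?thesis by (simp add: word_dist_def)
qed

lemma isometric_spaces_refl:
  assumes "normed_space V"
  shows "isometric_spaces V V"
proof -
  interpret comm_group "\<lparr>carrier = vcarrier V, mult = vadd V, one = vzero V\<rparr>"
    using assms by (simp add: normed_space_def)
  have "linear_between V (vcarrier V) V (\<lambda>x. x)" by (auto simp: linear_between_def)
  then show ?thesis unfolding isometric_spaces_def by (intro exI[of _ "\<lambda>x. x"]) auto
qed

theorem theorem9p1:
  fixes G :: "('g, 'b) monoid_scheme" and S :: "'g set"
    and p :: real and \<omega> \<Omega> :: "real \<Rightarrow> real"
    and \<psi> :: "'g \<Rightarrow> 'x::banach"
  assumes "group G" and "amenable G"
    and "S \<subseteq> carrier G" and "finite S" and "\<forall>s\<in>S. inv\<^bsub>G\<^esub> s \<in> S"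
    and "generate G S = carrier G"
    and "1 \<le> p"
    and "\<omega> \<in> {0..} \<rightarrow> {0..}" and "\<Omega> \<in> {0..} \<rightarrow> {0..}"
    and "\<forall>g\<in>carrier G. \<forall>h\<in>carrier G.
           \<omega> (real (word_dist G S g h)) \<le> norm (\<psi> g - \<psi> h) \<and>
           norm (\<psi> g - \<psi> h) \<le> \<Omega> (real (word_dist G S g h))"
  shows "(\<exists>(Y :: point nspace) \<Psi>.
            banach_space Y \<and>
            finitely_representable Y (ell_p p :: (nat \<Rightarrow> 'x) nspace) \<and>
            equivariant G Y \<Psi> \<and>
            (\<forall>g\<in>carrier G. \<forall>h\<in>carrier G.
               \<omega> (real (word_dist G S g h)) \<le> vnorm Y (vdiff Y (\<Psi> g) (\<Psi> h)) \<and>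
               vnorm Y (vdiff Y (\<Psi> g) (\<Psi> h)) \<le> \<Omega> (real (word_dist G S g h)))) \<and>
         (\<forall>M :: 'm measure.
            isometric_spaces (type_space :: 'x nspace) (Lp p M) \<longrightarrow>
            (\<exists>(Y :: point nspace) \<Psi>.
               banach_space Y \<and>
               isometric_spaces Y (Lp p (lebesgue_on {0..1::real})) \<and>
               ((UNIV :: 'x set) \<noteq> {0} \<longrightarrow>
                  finitely_representable Y (ell_p p :: (nat \<Rightarrow> 'x) nspace)) \<and>
               equivariant G Y \<Psi> \<and>
               (\<forall>g\<in>carrier G. \<forall>h\<in>carrier G.
                  \<omega> (real (word_dist G S g h)) \<le> vnorm Y (vdiff Y (\<Psi> g) (\<Psi> h)) \<and>
                  vnorm Y (vdiff Y (\<Psi> g) (\<Psi> h)) \<le> \<Omega> (real (word_dist G S g h)))))"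
proof -
  interpret G: group G by (rule assms(1))
  obtain m where "left_invariant_mean G m" using assms(2) by (auto simp: amenable_def)
  then interpret mean_group G m by unfold_locales
  have p: "1 \<le> p" by (rule assms(7))
  have countable_G: "countable (carrier G)"
    using G.countable_generate[OF countable_finite[OF assms(4)] assms(3,5)] assms(6) by simp
  \<comment> \<open>By left-invariance \<open>x\<inverse> g\<close> and \<open>x\<inverse>\<close> are as far apart as \<open>g\<close> and the unit.\<close>
  define K where "K g = \<Omega> (real (word_dist G S g \<one>\<^bsub>G\<^esub>))" for g
  have nonneg: "0 \<le> \<omega> (real k)" "0 \<le> \<Omega> (real k)" for k using assms(8,9) by auto
  have lower: "\<omega> (real (word_dist G S g h)) \<le> norm (\<psi> (x \<otimes>\<^bsub>G\<^esub> g) - \<psi> (x \<otimes>\<^bsub>G\<^esub> h))"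
    and upper: "norm (\<psi> (x \<otimes>\<^bsub>G\<^esub> g) - \<psi> (x \<otimes>\<^bsub>G\<^esub> h)) \<le> \<Omega> (real (word_dist G S g h))"
    if "g \<in> carrier G" "h \<in> carrier G" "x \<in> carrier G" for x g h
    using assms(10)[rule_format, of "x \<otimes>\<^bsub>G\<^esub> g" "x \<otimes>\<^bsub>G\<^esub> h"] that
    by (auto simp: G.word_dist_left_invariant)
  have K: "norm (\<psi> (inv\<^bsub>G\<^esub> x \<otimes>\<^bsub>G\<^esub> g) - \<psi> (inv\<^bsub>G\<^esub> x)) \<le> K g"
    if "x \<in> carrier G" "g \<in> carrier G" for x g
    using upper[of g "\<one>\<^bsub>G\<^esub>" "inv\<^bsub>G\<^esub> x"] that by (simp add: K_def)
  show ?thesis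
  proof (intro conjI allI impI)
    interpret X: averaged_displacement G m "UNIV :: 'x set" norm p \<psi> K
      by unfold_locales (auto simp: p K norm_triangle_ineq)
    interpret XV: averaged_vectors G m p ..
    obtain W and \<kappa> :: "(nat \<Rightarrow> 'g \<Rightarrow> 'x) \<Rightarrow> point" and Y
      where W: "subspace W" "W \<subseteq> X.V" and pres: "presents (cauchy_seqs W X.q) (lim_norm X.q) \<kappa> Y"
        and Y: "banach_space Y" "equivariant G Y (\<lambda>g. \<kappa> (\<lambda>i. X.disp g))"
        and dist: "\<forall>g\<in>carrier G. \<forall>h\<in>carrier G.
          vnorm Y (vdiff Y (\<kappa> (\<lambda>i. X.disp g)) (\<kappa> (\<lambda>i. X.disp h))) = X.q (X.disp g - X.disp h)"
      using X.equivariant_points[OF countable_G] by (elim exE conjE)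
    show "\<exists>(Y :: point nspace) \<Psi>.
            banach_space Y \<and>
            finitely_representable Y (ell_p p :: (nat \<Rightarrow> 'x) nspace) \<and>
            equivariant G Y \<Psi> \<and>
            (\<forall>g\<in>carrier G. \<forall>h\<in>carrier G.
               \<omega> (real (word_dist G S g h)) \<le> vnorm Y (vdiff Y (\<Psi> g) (\<Psi> h)) \<and>
               vnorm Y (vdiff Y (\<Psi> g) (\<Psi> h)) \<le> \<Omega> (real (word_dist G S g h)))"
    proof (intro exI[of _ Y] exI[of _ "\<lambda>g. \<kappa> (\<lambda>i. X.disp g)"] conjI ballI Y)
      show "finitely_representable Y (ell_p p :: (nat \<Rightarrow> 'x) nspace)"
        by (rule XV.completion_finitely_representable[OF W pres])
      fix g h assume gh: "g \<in> carrier G" "h \<in> carrier G"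
      note B = X.q_disp_bounds[OF gh lower[OF gh] upper[OF gh] nonneg]
      show "\<omega> (real (word_dist G S g h)) \<le> vnorm Y (vdiff Y (\<kappa> (\<lambda>i. X.disp g)) (\<kappa> (\<lambda>i. X.disp h)))"
        "vnorm Y (vdiff Y (\<kappa> (\<lambda>i. X.disp g)) (\<kappa> (\<lambda>i. X.disp h))) \<le> \<Omega> (real (word_dist G S g h))"
        using B dist gh by simp_all
    qed
  next
    fix M :: "'m measure"
    assume "isometric_spaces (type_space :: 'x nspace) (Lp p M)"
    then obtain T where T: "linear_between (type_space :: 'x nspace) UNIV (Lp p M) T"
        "\<And>x. vnorm (Lp p M) (T x) = norm x"
      unfolding isometric_spaces_def by (auto simp: type_space_def)
    interpret LM: seminormed "Lp_funs p M" "Lp_norm p M" by (rule seminormed_Lp[OF p])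
    note P = presentsD[OF presents_Lp[OF p, of M]]
    have "\<exists>u\<in>Lp_funs p M. Lp_class p M u = T y" for y
      using T(1) unfolding linear_between_def P(1) by fastforce
    \<comment> \<open>Representatives of the images in \<open>L\<^sub>p(\<mu>)\<close>; only their distances matter.\<close>
    then obtain r where r: "\<And>y. r y \<in> Lp_funs p M" "\<And>y. Lp_class p M (r y) = T y" by metis
    have T_diff: "T (y - y') = vdiff (Lp p M) (T y) (T y')" for y y'
    proof -
      have "T (y - y') = T (vadd type_space y (vscale type_space (- 1) y'))"
        by (simp add: type_space_def)
      also have "\<dots> = vdiff (Lp p M) (T y) (T y')"
        using T(1) unfolding linear_between_def vdiff_def by simp
      finally show ?thesis .
    qed
    have r_dist: "Lp_norm p M (r y - r y') = norm (y - y')" for y y'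
    proof -
      have "Lp_norm p M (r y - r y') = vnorm (Lp p M) (Lp_class p M (r y - r y'))"
        by (intro P(6)[symmetric] LM.mem_diff r)
      also have "Lp_class p M (r y - r y') = T (y - y')"
        unfolding T_diff unfolding r(2)[symmetric] by (rule LM.presents_vdiff[OF presents_Lp[OF p] r(1) r(1), symmetric])
      also have "vnorm (Lp p M) (T (y - y')) = norm (y - y')" by (rule T(2))
      finally show ?thesis .
    qed
    interpret F: function_displacement G m M p "\<lambda>g. r (\<psi> g)" K
    proof (intro function_displacement.intro averaged_displacement.intro averaged.intro
        averaged_axioms.intro averaged_displacement_axioms.intro function_displacement_axioms.intro)
      show "mean_group G m" by unfold_locales
      show "seminormed (Lp_funs p M) (Lp_norm p M)" by (rule LM.seminormed_axioms)
    qed (simp_all add: p r(1) r_dist K countable_G)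
    let ?Y = "Lp p unit_lebesgue :: point nspace"
    interpret LU: seminormed "Lp_funs p unit_lebesgue" "Lp_norm p unit_lebesgue" by (rule seminormed_Lp[OF p])
    obtain \<Psi> where \<Psi>: "equivariant G ?Y \<Psi>"
        "\<forall>g\<in>carrier G. \<forall>h\<in>carrier G. vnorm ?Y (vdiff ?Y (\<Psi> g) (\<Psi> h)) = F.L.q (F.L.disp g - F.L.disp h)"
      using F.equivariant_into_unit_Lp by (elim exE conjE)
    show "\<exists>(Y :: point nspace) \<Psi>.
               banach_space Y \<and>
               isometric_spaces Y (Lp p (lebesgue_on {0..1::real})) \<and>
               ((UNIV :: 'x set) \<noteq> {0} \<longrightarrow>
                  finitely_representable Y (ell_p p :: (nat \<Rightarrow> 'x) nspace)) \<and>
               equivariant G Y \<Psi> \<and>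
               (\<forall>g\<in>carrier G. \<forall>h\<in>carrier G.
                  \<omega> (real (word_dist G S g h)) \<le> vnorm Y (vdiff Y (\<Psi> g) (\<Psi> h)) \<and>
                  vnorm Y (vdiff Y (\<Psi> g) (\<Psi> h)) \<le> \<Omega> (real (word_dist G S g h)))"
    proof (intro exI[of _ ?Y] exI[of _ \<Psi>] conjI ballI impI)
      show "banach_space ?Y" by (rule LU.presents_banach_space[OF presents_Lp[OF p] complete_Lp[OF p]])
      show "isometric_spaces ?Y ?Y"
        by (rule isometric_spaces_refl[OF LU.presents_normed_space[OF presents_Lp[OF p]]])
      show "finitely_representable ?Y (ell_p p :: (nat \<Rightarrow> 'x) nspace)" if "(UNIV :: 'x set) \<noteq> {0}"
      proof -
        obtain x0 :: 'x where "x0 \<noteq> 0" using \<open>UNIV \<noteq> {0}\<close> by blast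
        then show ?thesis by (rule Lp_unit_finitely_representable[OF p])
      qed
      show "equivariant G ?Y \<Psi>" by (rule \<Psi>(1))
      fix g h assume gh: "g \<in> carrier G" "h \<in> carrier G"
      have lift: "Lp_norm p F.MU ((\<lambda>z. r y (fst z)) - (\<lambda>z. r y' (fst z))) = norm (y - y')" for y y'
        unfolding r_dist[symmetric]
        using lift_Lp(2)[OF p LM.mem_diff[OF r(1) r(1)], of y y'] by (simp add: fun_diff_def)
      note B = F.L.q_disp_bounds[OF gh, unfolded lift, OF lower[OF gh] upper[OF gh] nonneg]
      show "\<omega> (real (word_dist G S g h)) \<le> vnorm ?Y (vdiff ?Y (\<Psi> g) (\<Psi> h))"
        "vnorm ?Y (vdiff ?Y (\<Psi> g) (\<Psi> h)) \<le> \<Omega> (real (word_dist G S g h))"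
        using B \<Psi>(2) gh by simp_all
    qed
  qed
qed

end
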